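(* Let $N\ge 3$ and let $w_1,\dots,w_r\in\mathbb{R}^N$ be pairwise distinct points which are not contained in any real affine plane (affine subspace of dimension $2$). Let $$F(x)=\prod_{j=1}^r |x-w_j|^2,\qquad f(x)=\log F(x)=\sum_{j=1}^r\log|x-w_j|^2 \quad (x\in\mathbb{R}^N\setminus\{w_1,\dots,w_r\}).$$ Then at every critical point of $f$ (respectively, of $F$ on $\mathbb{R}^N$) the Hessian has positivity index at least $N-1$; in particular its negativity index is $0$ or $1$. Moreover, the critical points of $f$ (and of $F$) are isolated.
   Context: $|\cdot|$ is the Euclidean norm. For a real symmetric bilinear form (e.g. a Hessian), the positivity index (resp. negativity index) is the number of positive (resp. negative) eigenvalues of its matrix, counted with multiplicity. *)

theory Defs
  imports "HOL-Analysis.Analysis" "HOL-Computational_Algebra.Polynomial"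
begin

definition hessian :: "(real ^ 'n \<Rightarrow> real) \<Rightarrow> real ^ 'n \<Rightarrow> real ^ 'n ^ 'n" where
  "hessian f x = (\<chi> i j. frechet_derivative
       (\<lambda>y. frechet_derivative f (at y) (axis j 1)) (at x) (axis i 1))"

definition charpoly :: "real ^ 'n ^ 'n \<Rightarrow> real poly" where
  "charpoly A = det (\<chi> i j. (if i = j then [:0, 1:] else 0) - [:A $ i $ j:])"

definition pos_index :: "real ^ 'n ^ 'n \<Rightarrow> nat" where
  "pos_index A = (\<Sum>c\<in>{c. c > 0 \<and> poly (charpoly A) c = 0}. order c (charpoly A))"

definition neg_index :: "real ^ 'n ^ 'n \<Rightarrow> nat" where
  "neg_index A = (\<Sum>c\<in>{c. c < 0 \<and> poly (charpoly A) c = 0}. order c (charpoly A))"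

definition critical_point :: "(real ^ 'n \<Rightarrow> real) \<Rightarrow> (real ^ 'n) set \<Rightarrow> real ^ 'n \<Rightarrow> bool" where
  "critical_point g D x \<longleftrightarrow> x \<in> D \<and> (g has_derivative (\<lambda>h. 0)) (at x)"

end

theory Submission
  imports Defs "HOL-Complex_Analysis.Conformal_Mappings"
begin

text \<open>At every point the Hessian of \<open>f\<close>, and hence that of \<open>F\<close>, has positive trace on every plane:
  with \<open>v\<^sub>j = (x - w\<^sub>j) / |x - w\<^sub>j|\<^sup>2\<close>, half the trace of the Hessian of \<open>f\<close> over a plane \<open>P\<close> is twice the sum of the squared
  distances of the \<open>v\<^sub>j\<close> from \<open>P\<close>, which vanishes only if all \<open>w\<^sub>j\<close> lie in the plane \<open>x + P\<close>. So the two
  smallest eigenvalues have a positive sum, which gives the bounds on the indices.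

  Suppose that critical points accumulate. By analyticity the set of accumulation points is
  a compact set \<open>W\<close> that is a regular arc near each of its points. It contains a closed curve, more precisely a
  point \<open>q\<close> both of whose neighbours in \<open>W\<close> can be joined to a base point by rectifiable paths in \<open>W\<close> that avoid \<open>q\<close>.
  Now iterate a gradient step \<open>\<phi>(x) = x - \<eta> \<nabla>F(x)\<close>. It preserves a large ball, fixes \<open>W\<close> pointwise, and, because the
  plane traces are positive, contracts two-dimensional areas by a factor less than 1. By Stokes' theorem
  the integral of a 1-form around a closed curve in \<open>W\<close> equals the integral of its differential over the image under
  an iterate of \<open>\<phi>\<close> of a disc spanned by the curve, so it is zero; a bump form supported near \<open>q\<close> contradicts this.\<close>

section \<open>Index and plane traces of symmetric matrices\<close>

text \<open>The index bound allows a one-dimensional kernel of the Hessian, so by itself it does not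
  exclude a curve of degenerate critical points; hence the global argument. It works with
  \<open>F\<close> rather than \<open>f\<close>: \<open>F\<close> is a polynomial without
  singularities whose plane traces are positive also at the points \<open>w j\<close>, so the
  gradient step is a polynomial map that contracts area at every point of the ball, with a factor
  that compactness makes uniform. The ball is convex, so cones over 0 serve as discs. Neither a disc
  nor a line integral is formed. For an iterate \<open>\<Phi>\<close> of the step, a form
  \<open>P d(v . x)\<close> is pulled back to \<open>P(\<Phi>) d(v . \<Phi>)\<close>. Along curves
  in \<open>W\<close> both take the same values, because \<open>\<Phi>\<close> fixes
  \<open>W\<close>, while the differential of the second is small. Its radial primitive
  \<open>K\<close> is thus almost a primitive along all curves in \<open>W\<close> at once. Nor is a
  closed curve parametrised: Lipschitz paths from a base point to both sides of \<open>q\<close>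
  suffice to compare values of \<open>K\<close>.\<close>

lemma rayleigh_max_eigenvector:
  fixes A :: "real ^ 'n ^ 'n"
  assumes sym: "transpose A = A" and S: "subspace S" "S \<noteq> {0}" and inv: "\<And>x. x \<in> S \<Longrightarrow> A *v x \<in> S"
  obtains e l where "e \<in> S" "norm e = 1" "A *v e = l *\<^sub>R e"
proof -
  have symd: "x \<bullet> (A *v y) = y \<bullet> (A *v x)" for x y
    by (metis dot_lmul_matrix inner_commute sym transpose_matrix_vector)
  obtain x0 where x0: "x0 \<in> S" "x0 \<noteq> 0" using S subspace_0 by blast
  have "compact (S \<inter> sphere 0 1)"
    by (simp add: S(1) closed_Int_compact closed_subspace)
  moreover have "x0 /\<^sub>R norm x0 \<in> S \<inter> sphere 0 1"
    using x0 S by (auto simp: subspace_scale)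
  moreover have "continuous_on (S \<inter> sphere 0 1) (\<lambda>x. x \<bullet> (A *v x))"
    by (intro continuous_intros)
  ultimately obtain e where e: "e \<in> S" "norm e = 1"
    and mx: "\<And>y. y \<in> S \<Longrightarrow> norm y = 1 \<Longrightarrow> y \<bullet> (A *v y) \<le> e \<bullet> (A *v e)"
    using continuous_attains_sup[of "S \<inter> sphere 0 1" "\<lambda>x. x \<bullet> (A *v x)"]
    by (force simp del: inverse_eq_divide)
  define l where "l = e \<bullet> (A *v e)"
  have ray: "y \<bullet> (A *v y) \<le> l * (y \<bullet> y)" if "y \<in> S" for y
  proof (cases "y = 0")
    case False
    have "(y /\<^sub>R norm y) \<bullet> (A *v (y /\<^sub>R norm y)) \<le> l"
      unfolding l_def using mx[of "y /\<^sub>R norm y"] that S False by (auto simp: subspace_scale)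
    then have "(y \<bullet> (A *v y)) / (norm y)^2 \<le> l"
      by (simp add: matrix_vector_mult_scaleR power2_eq_square divide_simps)
    then show ?thesis using False by (simp add: divide_simps power2_norm_eq_inner)
  qed simp
  \<comment> \<open>First variation at the maximum \<open>e\<close>: moving it by
    \<open>t *\<^sub>R y\<close> gives \<open>2 * t * a \<le> t^2 * b\<close> for every
    \<open>t\<close>. This forces \<open>a = 0\<close>, as \<open>t = a / k\<close> with
    \<open>k > \<bar>b\<bar>\<close> shows.\<close>
  have orth: "y \<bullet> (A *v e) = 0" if y: "y \<in> S" "y \<bullet> e = 0" for y
  proof -
    define a b where "a = y \<bullet> (A *v e)" and "b = l * (y \<bullet> y) - y \<bullet> (A *v y)"
    have q: "2 * t * a \<le> t^2 * b" for t
    proof -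
      have "(e + t *\<^sub>R y) \<bullet> (A *v (e + t *\<^sub>R y)) \<le> l * ((e + t *\<^sub>R y) \<bullet> (e + t *\<^sub>R y))"
        using ray e y S by (simp add: subspace_add subspace_scale)
      moreover have "(e + t *\<^sub>R y) \<bullet> (A *v (e + t *\<^sub>R y)) = l + 2 * t * a + t^2 * (y \<bullet> (A *v y))"
        using symd[of e y] unfolding l_def a_def
        by (simp add: inner_add_left inner_add_right matrix_vector_right_distrib matrix_vector_mult_scaleR
            power2_eq_square algebra_simps)
      moreover have "(e + t *\<^sub>R y) \<bullet> (e + t *\<^sub>R y) = 1 + t^2 * (y \<bullet> y)"
        using e y by (simp add: inner_add_left inner_add_right power2_eq_square inner_commute[of e y]
            norm_eq_1)
      ultimately have "l + 2 * t * a + t^2 * (y \<bullet> (A *v y)) \<le> l * (1 + t^2 * (y \<bullet> y))" by simp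
      then show ?thesis unfolding b_def by (simp add: algebra_simps)
    qed
    have "a = 0"
    proof (rule ccontr)
      assume a: "a \<noteq> 0"
      define k where "k = \<bar>b\<bar> + 1"
      have k: "k > 0" "b < k" unfolding k_def by auto
      have "2 * a^2 / k \<le> a^2 * b / k^2"
        using q[of "a / k"] by (simp add: power2_eq_square)
      then have "2 * a^2 * k \<le> a^2 * b"
        using k by (simp add: divide_simps power2_eq_square)
      then have "2 * k \<le> b" using a by (simp add: algebra_simps)
      then show False using k by linarith
    qed
    then show ?thesis by (simp add: a_def)
  qed
  define y where "y = A *v e - l *\<^sub>R e"
  have yS: "y \<in> S" unfolding y_def using e inv S by (simp add: subspace_diff subspace_scale)
  have "e \<bullet> e = 1" using e by (simp add: norm_eq_1)
  then have ye: "y \<bullet> e = 0" unfolding y_def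
    by (simp add: inner_diff_left l_def inner_commute[of "A *v e"])
  have "y \<bullet> y = 0"
  proof -
    have "y \<bullet> y = y \<bullet> (A *v e) - l * (y \<bullet> e)"
      by (subst (2) y_def) (simp add: inner_diff_right)
    then show ?thesis using orth[OF yS ye] ye by simp
  qed
  then have "A *v e = l *\<^sub>R e" by (simp add: y_def)
  then show thesis using that e by blast
qed

text \<open>Spectral theorem by induction on the dimension: since \<open>A\<close> is symmetric, the
  orthogonal complement of an eigenvector inside \<open>S\<close> is again invariant.\<close>

lemma symmetric_eigenvector_basis_of_subspace:
  fixes A :: "real ^ 'n ^ 'n"
  assumes sym: "transpose A = A"
  shows "subspace S \<Longrightarrow> (\<And>x. x \<in> S \<Longrightarrow> A *v x \<in> S) \<Longrightarrow>
    \<exists>B. pairwise orthogonal B \<and> (\<forall>b\<in>B. norm b = 1 \<and> (\<exists>l. A *v b = l *\<^sub>R b)) \<and> span B = S"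
proof (induction "dim S" arbitrary: S rule: less_induct)
  case less
  show ?case
  proof (cases "S = {0}")
    case True
    then show ?thesis by (intro exI[of _ "{}"]) auto
  next
    case False
    obtain e l where e: "e \<in> S" "norm e = 1" and Ae: "A *v e = l *\<^sub>R e"
      using rayleigh_max_eigenvector[OF sym less.prems(1) False less.prems(2)] by blast
    define S' where "S' = {y \<in> S. e \<bullet> y = 0}"
    have sub': "subspace S'"
      unfolding S'_def using subspace_inter[OF less.prems(1) subspace_hyperplane[of e]]
      by (simp add: Int_def)
    have ee: "e \<bullet> e = 1" using e by (simp add: norm_eq_1)
    have "e \<notin> S'" using ee by (auto simp: S'_def)
    then have "S' \<subset> S" using e(1) unfolding S'_def by blast
    then have "dim S' < dim S"
      using sub' less.prems(1) by (metis dim_psubset span_eq_iff)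
    moreover have "A *v x \<in> S'" if "x \<in> S'" for x
    proof -
      have "e \<bullet> (A *v x) = x \<bullet> (A *v e)"
        by (metis dot_lmul_matrix inner_commute sym transpose_matrix_vector)
      then show ?thesis using that less.prems(2) by (auto simp: S'_def Ae inner_commute)
    qed
    ultimately obtain B where B: "pairwise orthogonal B" "span B = S'"
      "\<And>b. b \<in> B \<Longrightarrow> norm b = 1 \<and> (\<exists>l. A *v b = l *\<^sub>R b)"
      using less.hyps[OF _ sub'] by blast
    have "B \<subseteq> S'" using B(2) span_superset by blast
    then have "pairwise orthogonal (insert e B)"
      using B(1) by (auto simp: pairwise_insert S'_def orthogonal_def inner_commute)
    moreover have "span (insert e B) = S"
    proof
      show "span (insert e B) \<subseteq> S"
        using \<open>B \<subseteq> S'\<close> e less.prems(1) by (intro span_minimal) (auto simp: S'_def)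
      show "S \<subseteq> span (insert e B)"
      proof
        fix x assume x: "x \<in> S"
        have "x - (e \<bullet> x) *\<^sub>R e \<in> S'"
          using x e less.prems(1) by (auto simp: S'_def subspace_diff subspace_scale inner_diff_right ee)
        then show "x \<in> span (insert e B)"
          using B(2) by (auto simp: span_insert)
      qed
    qed
    ultimately show ?thesis
      using B(3) e Ae by (intro exI[of _ "insert e B"]) auto
  qed
qed

lemma symmetric_eigenvector_basis:
  fixes A :: "real ^ 'n ^ 'n"
  assumes sym: "transpose A = A"
  obtains b :: "'n \<Rightarrow> real ^ 'n" and d where
    "\<And>i j. b i \<bullet> b j = (if i = j then 1 else 0)" "\<And>i. A *v b i = d i *\<^sub>R b i"
proof -
  obtain B where B: "pairwise orthogonal B" "span B = UNIV"
      "\<And>b. b \<in> B \<Longrightarrow> norm b = 1 \<and> (\<exists>l. A *v b = l *\<^sub>R b)"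
    using symmetric_eigenvector_basis_of_subspace[OF sym, of UNIV] by auto
  have ind: "independent B" using B by (intro pairwise_orthogonal_independent) force+
  then have fin: "finite B" by (rule independent_imp_finite)
  have "card B = CARD('n)"
    using dim_span_eq_card_independent[OF ind] B(2) by simp
  then obtain b where b: "bij_betw b (UNIV :: 'n set) B"
    using finite_same_card_bij[of "UNIV :: 'n set" B] fin by auto
  have bB: "b i \<in> B" for i using b by (auto simp: bij_betw_def)
  have "\<forall>i. \<exists>l. A *v b i = l *\<^sub>R b i" using B(3) bB by blast
  from choice[OF this] obtain d where "\<And>i. A *v b i = d i *\<^sub>R b i" by blast
  moreover have "b i \<bullet> b j = (if i = j then 1 else 0)" for i j
  proof (cases "i = j")
    case True
    then show ?thesis using B(3)[OF bB[of i]] by (simp add: norm_eq_1)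
  next
    case False
    then have "b i \<noteq> b j" using b by (auto simp: bij_betw_def inj_def)
    then show ?thesis using B(1) bB False by (auto simp: pairwise_def orthogonal_def)
  qed
  ultimately show thesis using that by blast
qed

text \<open>The eigenvectors are the columns of \<open>P\<close>, and \<open>P\<close> conjugates
  \<open>A\<close> to a diagonal matrix. The two polynomials are compared through their values,
  because evaluation at \<open>c\<close> turns the determinant over polynomials into the determinant
  of the real matrix \<open>mat c - A\<close>.\<close>

lemma charpoly_eq_prod:
  fixes A :: "real ^ 'n ^ 'n"
  assumes ortho: "\<And>i j. b i \<bullet> b j = (if i = j then 1 else 0)"
    and eig: "\<And>i :: 'n. A *v b i = d i *\<^sub>R b i"
  shows "charpoly A = (\<Prod>i\<in>UNIV. [:- d i, 1:])"
proof -
  define P :: "real ^ 'n ^ 'n" where "P = (\<chi> i j. b j $ i)"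
  have "transpose P ** P = mat 1"
    using ortho by (simp add: vec_eq_iff matrix_matrix_mult_def transpose_def P_def mat_def inner_vec_def)
  then have dP: "det P * det P = 1"
    by (metis det_I det_mul det_transpose)
  have ev: "poly (charpoly A) c = (\<Prod>i\<in>UNIV. c - d i)" for c
  proof -
    let ?M = "mat c - A"
    define D :: "real ^ 'n ^ 'n" where "D = (\<chi> i j. if i = j then c - d i else 0)"
    have "poly (charpoly A) c = det ?M"
      unfolding charpoly_def det_def
      by (simp add: poly_sum poly_prod mat_def if_distrib cong: if_cong)
         (intro sum.cong refl arg_cong2[where f="(*)"] prod.cong, auto simp: of_int_poly poly_diff split: if_splits)
    moreover have "?M ** P = P ** D"
    proof -
      have "(?M ** P) $ i $ j = (P ** D) $ i $ j" for i j
      proof -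
        have "(A *v b j) $ i = d j * b j $ i" by (simp add: eig)
        then have *: "(\<Sum>k\<in>UNIV. A $ i $ k * b j $ k) = d j * b j $ i"
          by (simp add: matrix_vector_mult_def)
        have "(?M ** P) $ i $ j = (\<Sum>k\<in>UNIV. (if i = k then c * b j $ k else 0) - A $ i $ k * b j $ k)"
          unfolding matrix_matrix_mult_def P_def by (simp add: mat_def left_diff_distrib if_distrib if_distribR cong: if_cong)
        also have "\<dots> = (c - d j) * b j $ i" by (simp add: sum_subtractf * left_diff_distrib)
        also have "\<dots> = (\<Sum>k\<in>UNIV. if k = j then (c - d j) * b j $ i else 0)" by simp
        also have "\<dots> = (P ** D) $ i $ j"
          unfolding matrix_matrix_mult_def P_def D_def
          by (simp add: if_distrib cong: if_cong)
        finally show ?thesis .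
      qed
      then show ?thesis by (simp add: vec_eq_iff)
    qed
    then have "det ?M * det P = det P * det D" by (metis det_mul)
    then have "det ?M = det D" using dP by (metis mult.commute mult_cancel_left mult_zero_left zero_neq_one)
    moreover have "det D = (\<Prod>i\<in>UNIV. c - d i)"
      by (subst det_diagonal) (auto simp: D_def)
    ultimately show ?thesis by simp
  qed
  have "poly (charpoly A) = poly (\<Prod>i\<in>UNIV. [:- d i, 1:])"
    by (rule ext) (simp add: ev poly_prod)
  then show ?thesis by (simp add: poly_eq_poly_eq_iff)
qed

lemma order_prod_linear:
  fixes d :: "'i \<Rightarrow> 'a :: idom"
  assumes "finite I"
  shows "order c (\<Prod>i\<in>I. [:- d i, 1:]) = card {i \<in> I. d i = c}"
  using assms
proof (induction I)
  case (insert i I)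
  have nz: "(\<Prod>i\<in>I. [:- d i, 1:]) \<noteq> 0" using insert by simp
  have o: "order c [:- d i, 1:] = (if d i = c then 1 else 0)"
    using order_power_n_n[of c 1] by (auto simp: order_0I)
  have "{j \<in> insert i I. d j = c} = (if d i = c then insert i {j \<in> I. d j = c} else {j \<in> I. d j = c})"
    by auto
  moreover have "order c (\<Prod>i\<in>insert i I. [:- d i, 1:]) = order c [:- d i, 1:] + order c (\<Prod>i\<in>I. [:- d i, 1:])"
  proof -
    have "order c ([:- d i, 1:] * (\<Prod>i\<in>I. [:- d i, 1:])) = order c [:- d i, 1:] + order c (\<Prod>i\<in>I. [:- d i, 1:])"
      by (rule order_mult) (use nz in \<open>simp del: mult_pCons_left\<close>)
    then show ?thesis using insert by (simp del: mult_pCons_left)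
  qed
  ultimately show ?case using insert o by auto
qed (simp add: order_0I)

text \<open>Turns the sums of root orders that define the two indices into a count of eigenvalues;
  \<open>R\<close> stands for positivity or negativity.\<close>

lemma sum_order_prod_linear:
  fixes d :: "'i :: finite \<Rightarrow> real"
  defines "p \<equiv> \<Prod>i\<in>UNIV. [:- d i, 1:]"
  shows "(\<Sum>c\<in>{c. R c \<and> poly p c = 0}. order c p) = card {i. R (d i)}"
proof -
  have roots: "{c. R c \<and> poly p c = 0} = d ` {i. R (d i)}"
    by (auto simp: p_def poly_prod)
  have "(\<Sum>c\<in>{c. R c \<and> poly p c = 0}. order c p) = (\<Sum>c\<in>d ` {i. R (d i)}. card {i. d i = c})"
    unfolding roots by (intro sum.cong refl) (use order_prod_linear[of UNIV _ d] in \<open>simp add: p_def\<close>)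
  also have "(\<Sum>c\<in>d ` {i. R (d i)}. card {i. d i = c}) = (\<Sum>c\<in>d ` {i. R (d i)}. card {i \<in> {i. R (d i)}. d i = c})"
    by (intro sum.cong refl arg_cong[where f=card]) auto
  also have "\<dots> = card {i. R (d i)}"
    using sum.image_gen[of "{i. R (d i)}" "\<lambda>_. 1::nat" d] by simp
  finally show ?thesis by (simp only:)
qed

text \<open>Two different eigenvectors of the basis span a plane of trace \<open>d i + d j\<close>,
  so at most one eigenvalue fails to be positive.\<close>

lemma index_of_plane_trace_positive:
  fixes A :: "real ^ 'n ^ 'n"
  assumes sym: "transpose A = A"
    and pos: "\<And>e f. norm e = 1 \<Longrightarrow> norm f = 1 \<Longrightarrow> e \<bullet> f = 0 \<Longrightarrow> 0 < e \<bullet> (A *v e) + f \<bullet> (A *v f)"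
  shows "pos_index A \<ge> CARD('n) - 1 \<and> neg_index A \<in> {0, 1}"
proof -
  obtain b :: "'n \<Rightarrow> real ^ 'n" and d where b: "\<And>i j. b i \<bullet> b j = (if i = j then 1 else 0)"
    and e: "\<And>i. A *v b i = d i *\<^sub>R b i"
    using symmetric_eigenvector_basis[OF sym] by blast
  have cp: "charpoly A = (\<Prod>i\<in>UNIV. [:- d i, 1:])" using charpoly_eq_prod b e .
  have p: "pos_index A = card {i. d i > 0}" and n: "neg_index A = card {i. d i < 0}"
    unfolding pos_index_def neg_index_def cp by (rule sum_order_prod_linear)+
  have pair: "d i + d j > 0" if "i \<noteq> j" for i j
    using pos[of "b i" "b j"] b e that by (simp add: norm_eq_1)
  have np: "card {i. d i \<le> 0} \<le> 1"
  proof (rule ccontr)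
    assume "\<not> card {i. d i \<le> 0} \<le> 1"
    then obtain i j where "i \<noteq> j" "d i \<le> 0" "d j \<le> 0"
      by (auto simp: not_le card_le_Suc0_iff_eq)
    then show False using pair[of i j] by linarith
  qed
  have "card {i. d i < 0} \<le> card {i. d i \<le> 0}" by (intro card_mono) auto
  moreover have "CARD('n) = card {i. d i \<le> 0} + card {i. d i > 0}"
    by (subst card_Un_disjoint[symmetric]) (auto intro!: arg_cong[where f=card])
  ultimately show ?thesis using p n np by (simp only: insert_iff empty_iff) linarith
qed

section \<open>Gradient and Hessian of a product of squared distances\<close>

text \<open>The field is left general so that one set of formulas serves the real gradient and its
  holomorphic extension. Over the complex numbers this is the sum of the squares themselves, not of
  their moduli.\<close>

definition sqd :: "real ^ 'n \<Rightarrow> 'a::real_normed_field ^ 'n \<Rightarrow> 'a" where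
  "sqd a z = (\<Sum>i\<in>UNIV. (z $ i - of_real (a $ i))\<^sup>2)"

text \<open>Factors are omitted from the product instead of divided out, so the formulas for
  gradient and Hessian stay valid at the points \<open>w j\<close> and at complex zeros of
  \<open>sqd\<close>.\<close>

definition prod_grad :: "('i \<Rightarrow> real ^ 'n) \<Rightarrow> 'i set \<Rightarrow> 'a::real_normed_field ^ 'n \<Rightarrow> 'a ^ 'n" where
  "prod_grad w J z = (\<chi> i. \<Sum>j\<in>J. 2 * (z $ i - of_real (w j $ i)) * (\<Prod>k\<in>J - {j}. sqd (w k) z))"

definition prod_hess :: "('i \<Rightarrow> real ^ 'n) \<Rightarrow> 'i set \<Rightarrow> 'a::real_normed_field ^ 'n \<Rightarrow> 'a ^ 'n ^ 'n" where
  "prod_hess w J z = (\<chi> i l. \<Sum>j\<in>J. (if i = l then 2 * (\<Prod>k\<in>J - {j}. sqd (w k) z) else 0)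
     + 2 * (z $ i - of_real (w j $ i)) *
       (\<Sum>m\<in>J - {j}. 2 * (z $ l - of_real (w m $ l)) * (\<Prod>k\<in>J - {j} - {m}. sqd (w k) z)))"

lemma norm_vec_le_sum: "norm (x :: 'a::real_normed_vector ^ 'n) \<le> (\<Sum>i\<in>UNIV. norm (x $ i))"
  unfolding norm_vec_def by (rule L2_set_le_sum) simp

lemma bounded_linear_vec_lambda:
  fixes f :: "'n::finite \<Rightarrow> 'a::real_normed_vector \<Rightarrow> 'b::real_normed_vector"
  assumes "\<And>i. bounded_linear (f i)"
  shows "bounded_linear (\<lambda>h. \<chi> i. f i h)"
proof -
  have "\<forall>i. \<exists>K. \<forall>h. norm (f i h) \<le> norm h * K"
    using bounded_linear.bounded[OF assms] by blast
  then obtain K where K: "\<And>i h. norm (f i h) \<le> norm h * K i" by metis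
  have "norm (\<chi> i. f i h) \<le> norm h * (\<Sum>i\<in>UNIV. K i)" for h
  proof -
    have "norm (\<chi> i. f i h) \<le> (\<Sum>i\<in>UNIV. norm (f i h))"
      using norm_vec_le_sum[of "\<chi> i. f i h"] by simp
    also have "\<dots> \<le> (\<Sum>i\<in>UNIV. norm h * K i)" by (intro sum_mono K)
    finally show ?thesis by (simp add: sum_distrib_left)
  qed
  then show ?thesis
    by (intro bounded_linear_intro)
       (auto simp: vec_eq_iff linear_add[OF bounded_linear.linear[OF assms]]
         linear_scale[OF bounded_linear.linear[OF assms]])
qed

lemma has_derivative_vec_lambda:
  fixes f :: "'n::finite \<Rightarrow> 'a::real_normed_vector \<Rightarrow> 'b::real_normed_vector"
  assumes "\<And>i. (f i has_derivative f' i) (at x within S)"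
  shows "((\<lambda>x. \<chi> i. f i x) has_derivative (\<lambda>h. \<chi> i. f' i h)) (at x within S)"
  unfolding has_derivative_def
proof (intro conjI)
  show "bounded_linear (\<lambda>h. \<chi> i. f' i h)"
    using assms by (intro bounded_linear_vec_lambda) (auto simp: has_derivative_def)
  show "((\<lambda>y. ((\<chi> i. f i y) - (\<chi> i. f i (Lim (at x within S) (\<lambda>x. x))) -
      (\<chi> i. f' i (y - Lim (at x within S) (\<lambda>x. x)))) /\<^sub>R norm (y - Lim (at x within S) (\<lambda>x. x))) \<longlongrightarrow> 0) (at x within S)"
    using assms by (intro vec_tendstoI) (auto simp: has_derivative_def)
qed

lemma sqd_has_derivative [derivative_intros]:
  fixes g :: "'b::real_normed_vector \<Rightarrow> 'a::real_normed_field ^ 'n"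
  assumes "(g has_derivative g') (at x within S)"
  shows "((\<lambda>x. sqd a (g x)) has_derivative (\<lambda>h. \<Sum>i\<in>UNIV. 2 * (g x $ i - of_real (a $ i)) * g' h $ i)) (at x within S)"
proof -
  have [derivative_intros]: "((\<lambda>x. g x $ i) has_derivative (\<lambda>h. g' h $ i)) (at x within S)" for i
    using bounded_linear.has_derivative[OF bounded_linear_vec_nth assms] .
  show ?thesis unfolding sqd_def
    by (auto intro!: derivative_eq_intros sum.cong simp: algebra_simps)
qed

lemma sqd_real: "sqd a x = (norm (x - a))\<^sup>2"
  by (simp add: sqd_def norm_vec_def L2_set_def real_sqrt_pow2 sum_nonneg)

lemma sqd_of_real: "sqd a (\<chi> i. of_real (x $ i)) = (of_real (sqd a x) :: 'a::real_normed_field)"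
  by (simp add: sqd_def)

lemma prod_grad_of_real:
  "prod_grad w J (\<chi> i. of_real (x $ i)) = ((\<chi> i. of_real (prod_grad w J x $ i)) :: 'a::real_normed_field ^ 'n)"
  by (simp add: prod_grad_def sqd_of_real)

lemma prod_hess_of_real:
  "prod_hess w J (\<chi> i. of_real (x $ i)) = ((\<chi> i l. of_real (prod_hess w J x $ i $ l)) :: 'a::real_normed_field ^ 'n ^ 'n)"
  by (simp add: prod_hess_def sqd_of_real vec_eq_iff) (auto intro!: sum.cong simp: sqd_of_real)

lemma continuous_on_sqd [continuous_intros]:
  "continuous_on S g \<Longrightarrow> continuous_on S (\<lambda>x. sqd a (g x))"
  unfolding sqd_def by (intro continuous_intros)

lemma continuous_on_prod_hess_component:
  "continuous_on S g \<Longrightarrow> continuous_on S (\<lambda>z. prod_hess w J (g z) $ i $ l)"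
  unfolding prod_hess_def by (cases "i = l") (auto intro!: continuous_intros)

lemma prod_sqd_has_derivative:
  fixes x :: "real ^ 'n"
  shows "((\<lambda>x. \<Prod>j\<in>J. sqd (w j) x) has_derivative (\<lambda>h. prod_grad w J x \<bullet> h)) (at x)"
proof -
  have "((\<lambda>x. \<Prod>j\<in>J. sqd (w j) x) has_derivative
     (\<lambda>h. \<Sum>j\<in>J. (\<Sum>i\<in>UNIV. 2 * (x $ i - of_real (w j $ i)) * h $ i) * (\<Prod>k\<in>J - {j}. sqd (w k) x))) (at x)"
    by (rule derivative_intros sqd_has_derivative has_derivative_ident)+
  moreover have "(\<Sum>j\<in>J. (\<Sum>i\<in>UNIV. 2 * (x $ i - of_real (w j $ i)) * h $ i) * (\<Prod>k\<in>J - {j}. sqd (w k) x))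
     = prod_grad w J x \<bullet> h" for h
    unfolding prod_grad_def inner_vec_def sum_distrib_right
    by (subst sum.swap) (simp add: sum_distrib_left sum_distrib_right mult_ac)
  ultimately show ?thesis by simp
qed

lemma prod_grad_has_derivative:
  fixes z :: "'a::real_normed_field ^ 'n"
  shows "(prod_grad w J has_derivative (\<lambda>h. prod_hess w J z *v h)) (at z)"
proof -
  have 1: "((\<lambda>z. 2 * (z $ i - of_real (w j $ i)) * (\<Prod>k\<in>J - {j}. sqd (w k) z)) has_derivative
    (\<lambda>h. 2 * h $ i * (\<Prod>k\<in>J - {j}. sqd (w k) z) + 2 * (z $ i - of_real (w j $ i)) *
      (\<Sum>m\<in>J - {j}. (\<Sum>l\<in>UNIV. 2 * (z $ l - of_real (w m $ l)) * h $ l) * (\<Prod>k\<in>J - {j} - {m}. sqd (w k) z)))) (at z)" for i j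
    by (rule derivative_eq_intros bounded_linear.has_derivative[OF bounded_linear_vec_nth] refl)+
       (auto simp: algebra_simps)
  have "((\<lambda>z. \<chi> i. \<Sum>j\<in>J. 2 * (z $ i - of_real (w j $ i)) * (\<Prod>k\<in>J - {j}. sqd (w k) z)) has_derivative
    (\<lambda>h. \<chi> i. \<Sum>j\<in>J. 2 * h $ i * (\<Prod>k\<in>J - {j}. sqd (w k) z) + 2 * (z $ i - of_real (w j $ i)) *
      (\<Sum>m\<in>J - {j}. (\<Sum>l\<in>UNIV. 2 * (z $ l - of_real (w m $ l)) * h $ l) * (\<Prod>k\<in>J - {j} - {m}. sqd (w k) z)))) (at z)"
    by (intro has_derivative_vec_lambda has_derivative_sum 1)
  moreover have "(\<Sum>j\<in>J. 2 * h $ i * (\<Prod>k\<in>J - {j}. sqd (w k) z) + 2 * (z $ i - of_real (w j $ i)) *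
      (\<Sum>m\<in>J - {j}. (\<Sum>l\<in>UNIV. 2 * (z $ l - of_real (w m $ l)) * h $ l) * (\<Prod>k\<in>J - {j} - {m}. sqd (w k) z)))
     = (prod_hess w J z *v h) $ i" for h i
  proof -
    have "(prod_hess w J z *v h) $ i = (\<Sum>j\<in>J. \<Sum>l\<in>UNIV. ((if i = l then 2 * (\<Prod>k\<in>J - {j}. sqd (w k) z) else 0)
     + 2 * (z $ i - of_real (w j $ i)) *
       (\<Sum>m\<in>J - {j}. 2 * (z $ l - of_real (w m $ l)) * (\<Prod>k\<in>J - {j} - {m}. sqd (w k) z))) * h $ l)"
      unfolding matrix_vector_mult_def prod_hess_def by (simp add: sum_distrib_right) (rule sum.swap)
    also have "\<dots> = (\<Sum>j\<in>J. 2 * h $ i * (\<Prod>k\<in>J - {j}. sqd (w k) z) + 2 * (z $ i - of_real (w j $ i)) *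
      (\<Sum>m\<in>J - {j}. (\<Sum>l\<in>UNIV. 2 * (z $ l - of_real (w m $ l)) * h $ l) * (\<Prod>k\<in>J - {j} - {m}. sqd (w k) z)))"
    proof (intro sum.cong refl)
      fix j assume "j \<in> J"
      let ?u = "\<lambda>m l. 2 * (z $ l - of_real (w m $ l))"
      let ?p = "\<lambda>m. \<Prod>k\<in>J - {j} - {m}. sqd (w k) z"
      have "(\<Sum>l\<in>UNIV. ?u j i * (\<Sum>m\<in>J - {j}. ?u m l * ?p m) * h $ l)
        = ?u j i * (\<Sum>m\<in>J - {j}. (\<Sum>l\<in>UNIV. ?u m l * h $ l) * ?p m)"
        unfolding sum_distrib_left sum_distrib_right
        by (subst sum.swap) (simp add: mult_ac)
      moreover have "(\<Sum>l\<in>UNIV. (if i = l then 2 * (\<Prod>k\<in>J - {j}. sqd (w k) z) else 0) * h $ l)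
         = 2 * h $ i * (\<Prod>k\<in>J - {j}. sqd (w k) z)"
        by (simp add: if_distrib if_distribR cong: if_cong)
      ultimately show "(\<Sum>l\<in>UNIV. ((if i = l then 2 * (\<Prod>k\<in>J - {j}. sqd (w k) z) else 0)
       + ?u j i * (\<Sum>m\<in>J - {j}. ?u m l * ?p m)) * h $ l) = 2 * h $ i * (\<Prod>k\<in>J - {j}. sqd (w k) z) + ?u j i *
       (\<Sum>m\<in>J - {j}. (\<Sum>l\<in>UNIV. ?u m l * h $ l) * ?p m)"
        by (simp add: distrib_right sum.distrib)
    qed
    finally show ?thesis by simp
  qed
  ultimately show ?thesis unfolding prod_grad_def[abs_def]
    by (elim has_derivative_eq_rhs) (simp add: fun_eq_iff vec_eq_iff)
qed

lemma continuous_on_prod_grad: "continuous_on S (prod_grad w J)"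
  by (meson continuous_at_imp_continuous_on has_derivative_continuous prod_grad_has_derivative)

text \<open>Written over all ordered pairs of different indices, the double sum is symmetric:
  exchanging \<open>j\<close> and \<open>m\<close> amounts to exchanging \<open>i\<close> and
  \<open>l\<close>.\<close>

lemma transpose_prod_hess: "transpose (prod_hess w J z) = prod_hess w J z"
proof -
  let ?u = "\<lambda>m l. 2 * (z $ l - of_real (w m $ l))"
  let ?p = "\<lambda>j m. \<Prod>k\<in>J - {j} - {m}. sqd (w k) z"
  have "(\<Sum>j\<in>J. ?u j i * (\<Sum>m\<in>J - {j}. ?u m l * ?p j m)) = (\<Sum>j\<in>J. ?u j l * (\<Sum>m\<in>J - {j}. ?u m i * ?p j m))" for i l
  proof (cases "finite J")
    case True
    have *: "(\<Sum>j\<in>J. ?u j i * (\<Sum>m\<in>J - {j}. ?u m l * ?p j m)) =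
       (\<Sum>j\<in>J. \<Sum>m\<in>J. if m \<noteq> j then ?u j i * ?u m l * ?p j m else 0)" for i l
    proof (intro sum.cong refl)
      fix j assume "j \<in> J"
      have "(\<Sum>m\<in>J. if m \<noteq> j then ?u j i * ?u m l * ?p j m else 0) = (\<Sum>m\<in>J - {j}. ?u j i * ?u m l * ?p j m)"
        using True by (intro sum.mono_neutral_cong_right) auto
      then show "?u j i * (\<Sum>m\<in>J - {j}. ?u m l * ?p j m) = (\<Sum>m\<in>J. if m \<noteq> j then ?u j i * ?u m l * ?p j m else 0)"
        by (simp add: sum_distrib_left mult_ac)
    qed
    have sw: "J - {j} - {m} = J - {m} - {j}" for j m by auto
    show ?thesis unfolding *
      by (subst sum.swap) (intro sum.cong refl if_cong, auto simp: sw mult_ac)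
  qed auto
  then show ?thesis
    by (simp add: transpose_def prod_hess_def vec_eq_iff sum.distrib cong: if_cong) (auto intro!: sum.cong)
qed

section \<open>Quadratic form of the Hessian and its plane traces\<close>

lemma hess_quadratic_form:
  fixes x h :: "real ^ 'n"
  shows "h \<bullet> (prod_hess w J x *v h) = (\<Sum>j\<in>J. 2 * (h \<bullet> h) * (\<Prod>k\<in>J - {j}. sqd (w k) x) +
     2 * ((x - w j) \<bullet> h) * (\<Sum>m\<in>J - {j}. 2 * ((x - w m) \<bullet> h) * (\<Prod>k\<in>J - {j} - {m}. sqd (w k) x)))"
proof -
  let ?u = "\<lambda>m l. 2 * (x $ l - w m $ l)"
  let ?p = "\<lambda>j m. \<Prod>k\<in>J - {j} - {m}. sqd (w k) x"
  let ?q = "\<lambda>j. \<Prod>k\<in>J - {j}. sqd (w k) x"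
  have uh: "(\<Sum>l\<in>UNIV. ?u m l * h $ l) = 2 * ((x - w m) \<bullet> h)" for m
    by (simp add: inner_vec_def sum_distrib_left mult_ac)
  have "h \<bullet> (prod_hess w J x *v h) = (\<Sum>i\<in>UNIV. \<Sum>l\<in>UNIV. \<Sum>j\<in>J. h $ i * ((if i = l then 2 * ?q j else 0) +
      ?u j i * (\<Sum>m\<in>J - {j}. ?u m l * ?p j m)) * h $ l)"
    by (simp add: inner_vec_def matrix_vector_mult_def prod_hess_def sum_distrib_left sum_distrib_right mult_ac)
  also have "\<dots> = (\<Sum>j\<in>J. \<Sum>i\<in>UNIV. \<Sum>l\<in>UNIV. h $ i * ((if i = l then 2 * ?q j else 0) +
      ?u j i * (\<Sum>m\<in>J - {j}. ?u m l * ?p j m)) * h $ l)"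
  proof -
    have "(\<Sum>i\<in>UNIV. \<Sum>l\<in>UNIV. \<Sum>j\<in>J. f i l j) = (\<Sum>j\<in>J. \<Sum>i\<in>UNIV. \<Sum>l\<in>UNIV. f i l j)"
      for f :: "'n \<Rightarrow> 'n \<Rightarrow> 'a \<Rightarrow> real"
    proof -
      have "(\<Sum>i\<in>UNIV. \<Sum>l\<in>UNIV. \<Sum>j\<in>J. f i l j) = (\<Sum>i\<in>UNIV. \<Sum>j\<in>J. \<Sum>l\<in>UNIV. f i l j)"
        by (intro sum.cong refl sum.swap)
      then show ?thesis by (subst (2) sum.swap) simp
    qed
    then show ?thesis .
  qed
  also have "\<dots> = (\<Sum>j\<in>J. 2 * (h \<bullet> h) * ?q j + 2 * ((x - w j) \<bullet> h) * (\<Sum>m\<in>J - {j}. 2 * ((x - w m) \<bullet> h) * ?p j m))"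
  proof (intro sum.cong refl)
    fix j
    have "(\<Sum>i\<in>UNIV. \<Sum>l\<in>UNIV. h $ i * ((if i = l then 2 * ?q j else 0) + ?u j i * (\<Sum>m\<in>J - {j}. ?u m l * ?p j m)) * h $ l)
      = (\<Sum>i\<in>UNIV. \<Sum>l\<in>UNIV. if l = i then 2 * ?q j * (h $ i * h $ i) else 0)
        + (\<Sum>i\<in>UNIV. \<Sum>l\<in>UNIV. (?u j i * h $ i) * ((\<Sum>m\<in>J - {j}. ?u m l * ?p j m) * h $ l))"
      unfolding sum.distrib[symmetric] by (intro sum.cong refl) (auto simp: algebra_simps)
    also have "(\<Sum>i\<in>UNIV. \<Sum>l\<in>UNIV. if l = i then 2 * ?q j * (h $ i * h $ i) else 0) = 2 * (h \<bullet> h) * ?q j"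
      by (simp add: inner_vec_def sum_distrib_left sum_distrib_right mult_ac)
    also have "(\<Sum>i\<in>UNIV. \<Sum>l\<in>UNIV. (?u j i * h $ i) * ((\<Sum>m\<in>J - {j}. ?u m l * ?p j m) * h $ l))
       = (\<Sum>i\<in>UNIV. ?u j i * h $ i) * (\<Sum>l\<in>UNIV. (\<Sum>m\<in>J - {j}. ?u m l * ?p j m) * h $ l)"
      by (simp only: sum_product)
    also have "(\<Sum>l\<in>UNIV. (\<Sum>m\<in>J - {j}. ?u m l * ?p j m) * h $ l) = (\<Sum>m\<in>J - {j}. (\<Sum>l\<in>UNIV. ?u m l * h $ l) * ?p j m)"
      unfolding sum_distrib_right by (subst sum.swap) (simp add: mult_ac)
    finally show "(\<Sum>i\<in>UNIV. \<Sum>l\<in>UNIV. h $ i * ((if i = l then 2 * ?q j else 0) + ?u j i * (\<Sum>m\<in>J - {j}. ?u m l * ?p j m)) * h $ l)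
       = 2 * (h \<bullet> h) * ?q j + 2 * ((x - w j) \<bullet> h) * (\<Sum>m\<in>J - {j}. 2 * ((x - w m) \<bullet> h) * ?p j m)"
      unfolding uh .
  qed
  finally show ?thesis .
qed

text \<open>At \<open>w j\<close> every product that keeps the factor of index \<open>j\<close>
  vanishes, and so does the vector \<open>x - w j\<close>; only the diagonal term of index
  \<open>j\<close> survives.\<close>

lemma hess_quadratic_form_at_point:
  fixes w :: "'i \<Rightarrow> real ^ 'n"
  assumes J: "finite J" "j \<in> J"
  shows "h \<bullet> (prod_hess w J (w j) *v h) = 2 * (h \<bullet> h) * (\<Prod>k\<in>J - {j}. sqd (w k) (w j))"
proof -
  have z: "sqd (w j) (w j) = (0::real)" by (simp add: sqd_real)
  let ?t = "\<lambda>i. 2 * (h \<bullet> h) * (\<Prod>k\<in>J - {i}. sqd (w k) (w j)) +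
     2 * ((w j - w i) \<bullet> h) * (\<Sum>m\<in>J - {i}. 2 * ((w j - w m) \<bullet> h) * (\<Prod>k\<in>J - {i} - {m}. sqd (w k) (w j)))"
  have "?t i = (if i = j then 2 * (h \<bullet> h) * (\<Prod>k\<in>J - {j}. sqd (w k) (w j)) else 0)" if "i \<in> J" for i
  proof (cases "i = j")
    case False
    have "(\<Prod>k\<in>J - {i}. sqd (w k) (w j)) = 0"
      using J False z by (auto intro!: prod_zero)
    moreover have "2 * ((w j - w m) \<bullet> h) * (\<Prod>k\<in>J - {i} - {m}. sqd (w k) (w j)) = 0" for m
    proof (cases "m = j")
      case False
      then have "(\<Prod>k\<in>J - {i} - {m}. sqd (w k) (w j)) = 0"
        using J \<open>i \<noteq> j\<close> z by (intro prod_zero) auto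
      then show ?thesis by simp
    qed simp
    ultimately show ?thesis using False by (simp only: sum.neutral_const) simp
  qed simp
  then show ?thesis
    unfolding hess_quadratic_form using J by (simp cong: sum.cong)
qed

text \<open>This is the identity D^2 F = F (D^2 f + (D f)^2) for F = exp f: the first sum is the
  second derivative of the logarithm in direction \<open>h\<close>, the squared sum its first
  derivative.\<close>

lemma hess_quadratic_form_off_points:
  fixes w :: "'i \<Rightarrow> real ^ 'n"
  assumes J: "finite J" and x: "x \<notin> w ` J"
  shows "h \<bullet> (prod_hess w J x *v h) = (\<Prod>j\<in>J. sqd (w j) x) *
     ((\<Sum>j\<in>J. 2 * (h \<bullet> h) / sqd (w j) x - (2 * ((x - w j) \<bullet> h) / sqd (w j) x)\<^sup>2)
      + (\<Sum>j\<in>J. 2 * ((x - w j) \<bullet> h) / sqd (w j) x)\<^sup>2)"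
proof -
  let ?Q = "\<Prod>j\<in>J. sqd (w j) x"
  let ?a = "\<lambda>j. 2 * ((x - w j) \<bullet> h) / sqd (w j) x"
  have nz: "sqd (w j) x \<noteq> 0" if "j \<in> J" for j
    using x that by (auto simp: sqd_real)
  have q1: "(\<Prod>k\<in>J - {j}. sqd (w k) x) = ?Q / sqd (w j) x" if "j \<in> J" for j
    using J that nz[OF that] by (subst prod.remove[of J j]) auto
  have q2: "(\<Prod>k\<in>J - {j} - {m}. sqd (w k) x) = ?Q / sqd (w j) x / sqd (w m) x" if "j \<in> J" "m \<in> J - {j}" for j m
  proof -
    have "sqd (w m) x * (\<Prod>k\<in>J - {j} - {m}. sqd (w k) x) = ?Q / sqd (w j) x"
      using J that q1[OF that(1)] prod.remove[of "J - {j}" m "\<lambda>k. sqd (w k) x"] by simp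
    then show ?thesis using nz[of m] that(2) by (metis Diff_iff nonzero_mult_div_cancel_left)
  qed
  have "h \<bullet> (prod_hess w J x *v h) = (\<Sum>j\<in>J. ?Q * (2 * (h \<bullet> h) / sqd (w j) x + ?a j * ((\<Sum>m\<in>J. ?a m) - ?a j)))"
    unfolding hess_quadratic_form
  proof (intro sum.cong refl)
    fix j assume j: "j \<in> J"
    have "(\<Sum>m\<in>J - {j}. 2 * ((x - w m) \<bullet> h) * (\<Prod>k\<in>J - {j} - {m}. sqd (w k) x))
      = (\<Sum>m\<in>J - {j}. ?Q / sqd (w j) x * ?a m)"
      by (intro sum.cong refl, subst q2[OF j]) (auto simp: field_simps)
    also have "\<dots> = ?Q / sqd (w j) x * (\<Sum>m\<in>J - {j}. ?a m)"
      by (rule sum_distrib_left[symmetric])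
    also have "(\<Sum>m\<in>J - {j}. ?a m) = (\<Sum>m\<in>J. ?a m) - ?a j"
      using J j by (simp add: sum_diff1)
    finally show "2 * (h \<bullet> h) * (\<Prod>k\<in>J - {j}. sqd (w k) x) +
      2 * ((x - w j) \<bullet> h) * (\<Sum>m\<in>J - {j}. 2 * ((x - w m) \<bullet> h) * (\<Prod>k\<in>J - {j} - {m}. sqd (w k) x))
      = ?Q * (2 * (h \<bullet> h) / sqd (w j) x + ?a j * ((\<Sum>m\<in>J. ?a m) - ?a j))"
      by (simp only: q1[OF j]) (simp add: distrib_left mult_ac)
  qed
  also have "\<dots> = ?Q * ((\<Sum>j\<in>J. 2 * (h \<bullet> h) / sqd (w j) x - (?a j)\<^sup>2) + (\<Sum>j\<in>J. ?a j)\<^sup>2)"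
    unfolding power2_eq_square[of "sum ?a J"]
    by (simp only: sum_distrib_left[symmetric] sum_distrib_right sum.distrib[symmetric])
       (intro arg_cong[where f="\<lambda>t. ?Q * t"] sum.cong refl, simp add: power2_eq_square right_diff_distrib)
  finally show ?thesis .
qed

lemma affine_plane_through:
  fixes x e f :: "real ^ 'n"
  assumes "norm e = 1" "norm f = 1" "e \<bullet> f = 0"
  shows "affine ((+) x ` span {e, f})" "aff_dim ((+) x ` span {e, f}) = 2"
proof -
  show "affine ((+) x ` span {e, f})"
    by (simp add: affine_translation[symmetric] subspace_imp_affine)
  have "e \<noteq> f" using assms by (auto simp: norm_eq_1)
  have "independent {e, f}"
    using assms by (intro pairwise_orthogonal_independent)
      (auto simp: pairwise_insert orthogonal_def inner_commute)
  then have "dim (span {e, f}) = 2"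
    using \<open>e \<noteq> f\<close> dim_span_eq_card_independent[of "{e, f}"] by simp
  then show "aff_dim ((+) x ` span {e, f}) = 2"
    by (simp add: aff_dim_translation_eq aff_dim_subspace)
qed

lemma hess_trace_pos:
  fixes w :: "'i \<Rightarrow> real ^ 'n" and x :: "real ^ 'n"
  assumes J: "finite J" "inj_on w J"
    and npl: "\<not> (\<exists>S. affine S \<and> aff_dim S = 2 \<and> w ` J \<subseteq> S)"
    and ef: "norm e = 1" "norm f = 1" "e \<bullet> f = 0"
  shows "0 < e \<bullet> (prod_hess w J x *v e) + f \<bullet> (prod_hess w J x *v f)"
proof (cases "x \<in> w ` J")
  case True
  then obtain j where j: "j \<in> J" "x = w j" by auto
  have "sqd (w k) (w j) > (0::real)" if "k \<in> J - {j}" for k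
    using that j J(2) by (auto simp: sqd_real inj_on_def)
  then have "(\<Prod>k\<in>J - {j}. sqd (w k) (w j)) > (0::real)" by (intro prod_pos) auto
  then show ?thesis using ef J j by (simp add: hess_quadratic_form_at_point norm_eq_1)
next
  case False
  let ?Q = "\<Prod>j\<in>J. sqd (w j) x"
  have qp: "sqd (w j) x > 0" if "j \<in> J" for j
    using False that by (auto simp: sqd_real)
  have Q: "?Q > 0" using qp by (intro prod_pos) auto
  \<comment> \<open>\<open>D j\<close> is the component of \<open>x - w j\<close> orthogonal to the
    plane spanned by \<open>e\<close> and \<open>f\<close>. If all of them vanished, the points
    would lie in the plane through \<open>x\<close>.\<close>
  define D where "D j = (x - w j) - ((x - w j) \<bullet> e) *\<^sub>R e - ((x - w j) \<bullet> f) *\<^sub>R f" for j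
  have DD: "D j \<bullet> D j = sqd (w j) x - ((x - w j) \<bullet> e)\<^sup>2 - ((x - w j) \<bullet> f)\<^sup>2" for j
    using ef unfolding D_def sqd_real power2_norm_eq_inner
    by (simp add: inner_diff_left inner_diff_right norm_eq_1 inner_commute power2_eq_square algebra_simps)
  have "\<exists>j\<in>J. D j \<noteq> 0"
  proof (rule ccontr)
    assume "\<not> (\<exists>j\<in>J. D j \<noteq> 0)"
    then have *: "w j = x + (- ((x - w j) \<bullet> e) *\<^sub>R e - ((x - w j) \<bullet> f) *\<^sub>R f)" if "j \<in> J" for j
      using that by (auto simp: D_def algebra_simps)
    have "w ` J \<subseteq> (+) x ` span {e, f}"
    proof
      fix y assume "y \<in> w ` J"
      then obtain j where "j \<in> J" "y = w j" by auto
      then show "y \<in> (+) x ` span {e, f}"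
        using *[of j] by (metis (no_types, lifting) imageI insertCI span_base span_diff span_scale)
    qed
    then show False using npl affine_plane_through[OF ef] by blast
  qed
  then obtain j0 where j0: "j0 \<in> J" "D j0 \<noteq> 0" by blast
  let ?b = "\<lambda>h j. 2 * (h \<bullet> h) / sqd (w j) x - (2 * ((x - w j) \<bullet> h) / sqd (w j) x)\<^sup>2"
  \<comment> \<open>With \<open>s = sqd (w j) x\<close> the two terms add up to \<open>4 / s\<close>
    minus \<open>4 / s^2\<close> times the squared length of the projection of
    \<open>x - w j\<close> to the plane. The squares of first derivatives, added below, only
    increase the trace.\<close>
  have b: "?b e j + ?b f j = 4 * (D j \<bullet> D j) / (sqd (w j) x)\<^sup>2" if "j \<in> J" for j
    using qp[OF that] ef unfolding DD by (simp add: norm_eq_1 power2_eq_square field_simps)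
  have "0 < (\<Sum>j\<in>J. ?b e j + ?b f j)"
  proof (rule sum_pos2[OF J(1) j0(1)])
    show "0 < ?b e j0 + ?b f j0" unfolding b[OF j0(1)] using j0 qp[of j0] by simp
    show "0 \<le> ?b e j + ?b f j" if "j \<in> J" for j unfolding b[OF that] by simp
  qed
  then have "0 < (sum (?b e) J + (\<Sum>j\<in>J. 2 * ((x - w j) \<bullet> e) / sqd (w j) x)\<^sup>2)
      + (sum (?b f) J + (\<Sum>j\<in>J. 2 * ((x - w j) \<bullet> f) / sqd (w j) x)\<^sup>2)"
    unfolding sum.distrib using zero_le_power2[of "\<Sum>j\<in>J. 2 * ((x - w j) \<bullet> e) / sqd (w j) x"]
      zero_le_power2[of "\<Sum>j\<in>J. 2 * ((x - w j) \<bullet> f) / sqd (w j) x"] by linarith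
  then show ?thesis
    unfolding hess_quadratic_form_off_points[OF J(1) False] distrib_left[symmetric]
    by (rule mult_pos_pos[OF Q])
qed

section \<open>Critical points and Hessians of \<open>F\<close> and \<open>f\<close>\<close>

lemma critical_point_prod_iff:
  fixes F :: "real ^ 'n \<Rightarrow> real"
  assumes "\<And>x. F x = (\<Prod>j\<in>J. (norm (x - w j))\<^sup>2)"
  shows "critical_point F UNIV x \<longleftrightarrow> prod_grad w J x = 0"
proof -
  have "F = (\<lambda>x. \<Prod>j\<in>J. sqd (w j) x)" using assms by (simp add: sqd_real fun_eq_iff)
  then have d: "(F has_derivative (\<lambda>h. prod_grad w J x \<bullet> h)) (at x)"
    using prod_sqd_has_derivative by simp
  show ?thesis
  proof
    assume "critical_point F UNIV x"
    then have "(\<lambda>h. prod_grad w J x \<bullet> h) = (\<lambda>h. 0)"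
      using d has_derivative_unique by (auto simp: critical_point_def)
    then show "prod_grad w J x = 0" by (metis inner_eq_zero_iff)
  qed (use d in \<open>simp add: critical_point_def\<close>)
qed

text \<open>\<open>A\<close> is the derivative of the gradient \<open>g\<close>, with components as
  rows, whereas \<open>hessian\<close> takes the direction of the outer derivative as row index;
  hence the transpose. Equality near \<open>x\<close> suffices, which matters for \<open>f\<close>,
  since it is prescribed only off the points \<open>w j\<close>.\<close>

lemma hessian_eqI:
  assumes "\<And>j. \<forall>\<^sub>F y in nhds x. frechet_derivative f (at y) (axis j 1) = g j y"
    and "\<And>j. (g j has_derivative (\<lambda>h. (A *v h) $ j)) (at x)"
  shows "hessian f x = transpose A"
proof -
  have "frechet_derivative (\<lambda>y. frechet_derivative f (at y) (axis j 1)) (at x) = (\<lambda>h. (A *v h) $ j)" for j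
  proof -
    obtain S where "open S" "x \<in> S" "\<And>y. y \<in> S \<Longrightarrow> frechet_derivative f (at y) (axis j 1) = g j y"
      using assms(1)[of j] unfolding eventually_nhds by blast
    then have "((\<lambda>y. frechet_derivative f (at y) (axis j 1)) has_derivative (\<lambda>h. (A *v h) $ j)) (at x)"
      by (intro has_derivative_transform_within_open[OF assms(2)[of j]]) auto
    then show ?thesis by (rule frechet_derivative_at[symmetric])
  qed
  then show ?thesis
    by (simp add: hessian_def transpose_def vec_eq_iff matrix_vector_mult_basis column_def)
qed

lemma hessian_prod:
  fixes F :: "real ^ 'n \<Rightarrow> real"
  assumes "\<And>x. F x = (\<Prod>j\<in>J. (norm (x - w j))\<^sup>2)"
  shows "hessian F x = prod_hess w J x"
proof -
  have "F = (\<lambda>x. \<Prod>j\<in>J. sqd (w j) x)" using assms by (simp add: sqd_real fun_eq_iff)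
  then have "frechet_derivative F (at y) (axis j 1) = prod_grad w J y $ j" for y j
    using prod_sqd_has_derivative[THEN frechet_derivative_at, of w J y, symmetric] by (simp add: inner_axis)
  then have "hessian F x = transpose (prod_hess w J x)"
    using bounded_linear.has_derivative[OF bounded_linear_vec_nth prod_grad_has_derivative]
    by (intro hessian_eqI[where g="\<lambda>j y. prod_grad w J y $ j"]) (auto simp: always_eventually)
  then show ?thesis by (simp add: transpose_prod_hess)
qed

lemma log_prod_has_derivative:
  fixes f :: "real ^ 'n \<Rightarrow> real"
  assumes J: "finite J" and f: "\<And>x. x \<notin> w ` J \<Longrightarrow> f x = (\<Sum>j\<in>J. ln ((norm (x - w j))\<^sup>2))"
    and y: "y \<notin> w ` J"
  shows "(f has_derivative (\<lambda>h. (prod_grad w J y \<bullet> h) / (\<Prod>j\<in>J. sqd (w j) y))) (at y)"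
proof -
  have p: "sqd (w j) z > (0::real)" if "j \<in> J" "z \<notin> w ` J" for j z
    using that by (auto simp: sqd_real)
  then have P: "(\<Prod>j\<in>J. sqd (w j) y) > 0" using y by (intro prod_pos) auto
  have "((\<lambda>z. ln (\<Prod>j\<in>J. sqd (w j) z)) has_derivative (\<lambda>h. (prod_grad w J y \<bullet> h) / (\<Prod>j\<in>J. sqd (w j) y))) (at y)"
    by (rule derivative_eq_intros prod_sqd_has_derivative P refl)+ (simp add: divide_inverse mult.commute)
  then show ?thesis
  proof (rule has_derivative_transform_within_open[where s="- w ` J"])
    show "open (- w ` J)" using J by (simp add: finite_imp_closed open_Compl)
    show "ln (\<Prod>j\<in>J. sqd (w j) z) = f z" if "z \<in> - w ` J" for z
      using that p[of _ z] J by (subst ln_prod) (auto simp: f sqd_real)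
  qed (use y in auto)
qed

lemma critical_point_log_prod_iff:
  fixes f :: "real ^ 'n \<Rightarrow> real"
  assumes J: "finite J" and f: "\<And>x. x \<notin> w ` J \<Longrightarrow> f x = (\<Sum>j\<in>J. ln ((norm (x - w j))\<^sup>2))"
  shows "critical_point f (- w ` J) x \<longleftrightarrow> x \<notin> w ` J \<and> prod_grad w J x = 0"
proof (cases "x \<in> w ` J")
  case False
  note d = log_prod_has_derivative[OF J f False]
  have "(\<Prod>j\<in>J. sqd (w j) x) \<noteq> 0" using False J by (auto simp: sqd_real)
  show ?thesis
  proof
    assume "critical_point f (- w ` J) x"
    then have "(\<lambda>h. (prod_grad w J x \<bullet> h) / (\<Prod>j\<in>J. sqd (w j) x)) = (\<lambda>h. 0)"
      using d has_derivative_unique by (auto simp: critical_point_def)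
    then have "prod_grad w J x \<bullet> prod_grad w J x = 0"
      using \<open>(\<Prod>j\<in>J. sqd (w j) x) \<noteq> 0\<close> by (metis divide_eq_0_iff)
    then show "x \<notin> w ` J \<and> prod_grad w J x = 0" using False by simp
  qed (use d False in \<open>simp add: critical_point_def\<close>)
qed (simp add: critical_point_def)

text \<open>The gradient of \<open>f\<close> is that of \<open>F\<close> divided by
  \<open>F\<close>. At a critical point the term from differentiating the denominator carries the
  factor \<open>prod_grad w J x = 0\<close>.\<close>

lemma hessian_log_prod:
  fixes f :: "real ^ 'n \<Rightarrow> real"
  assumes J: "finite J" and f: "\<And>x. x \<notin> w ` J \<Longrightarrow> f x = (\<Sum>j\<in>J. ln ((norm (x - w j))\<^sup>2))"
    and x: "x \<notin> w ` J" and crit: "prod_grad w J x = 0"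
  shows "hessian f x = (1 / (\<Prod>j\<in>J. sqd (w j) x)) *\<^sub>R prod_hess w J x"
proof -
  let ?F = "\<lambda>x. \<Prod>j\<in>J. sqd (w j) x"
  have nz: "?F x \<noteq> 0" using x J by (auto simp: sqd_real)
  have "open (- w ` J)" using J by (simp add: finite_imp_closed open_Compl)
  then have ev: "\<forall>\<^sub>F y in nhds x. y \<notin> w ` J"
    using x unfolding eventually_nhds by blast
  have "hessian f x = transpose ((1 / ?F x) *\<^sub>R prod_hess w J x)"
  proof (rule hessian_eqI[where g="\<lambda>j y. prod_grad w J y $ j / ?F y"])
    show "\<forall>\<^sub>F y in nhds x. frechet_derivative f (at y) (axis j 1) = prod_grad w J y $ j / ?F y" for j
      using ev
    proof eventually_elim
      case (elim y)
      show ?case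
        using frechet_derivative_at[OF log_prod_has_derivative[OF J f elim], symmetric] by (simp add: inner_axis)
    qed
    show "((\<lambda>y. prod_grad w J y $ j / ?F y) has_derivative (\<lambda>h. (((1 / ?F x) *\<^sub>R prod_hess w J x) *v h) $ j)) (at x)" for j
    proof -
      have 1: "((\<lambda>y. prod_grad w J y $ j) has_derivative (\<lambda>h. (prod_hess w J x *v h) $ j)) (at x)"
        using bounded_linear.has_derivative[OF bounded_linear_vec_nth prod_grad_has_derivative] .
      show ?thesis
        by (rule has_derivative_eq_rhs[OF has_derivative_divide'[OF 1 prod_sqd_has_derivative nz]])
           (use nz in \<open>simp add: crit fun_eq_iff scaleR_matrix_vector_assoc[symmetric]\<close>)
    qed
  qed
  then show ?thesis
    using transpose_prod_hess[of w J x] by (simp add: transpose_def vec_eq_iff)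
qed

section \<open>Almost exactness of 1-forms under area contraction\<close>

lemma bounded_linear_Basis_sum:
  fixes L :: "'a::euclidean_space \<Rightarrow> real"
  assumes "bounded_linear L"
  shows "L h = (\<Sum>b\<in>Basis. (h \<bullet> b) * L b)"
proof -
  interpret bounded_linear L by fact
  have "L h = L (\<Sum>b\<in>Basis. (h \<bullet> b) *\<^sub>R b)" by (simp add: euclidean_representation)
  then show ?thesis by (simp add: sum scale)
qed

text \<open>Differentiating the radial primitive under the integral needs second derivatives, their
  symmetry and their continuity. Induction over polynomials yields all of this, with polynomial
  coefficients.\<close>

lemma real_polynomial_function_second_derivative:
  fixes f :: "'a::euclidean_space \<Rightarrow> real"
  assumes "real_polynomial_function f"
  obtains f' f'' where "\<And>x. (f has_derivative f' x) (at x)"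
    "\<And>x h. ((\<lambda>x. f' x h) has_derivative (\<lambda>k. f'' x k h)) (at x)"
    "\<And>x h k. f'' x h k = f'' x k h"
    "\<And>h. real_polynomial_function (\<lambda>x. f' x h)"
    "\<And>k h. real_polynomial_function (\<lambda>x. f'' x k h)"
proof -
  have "\<exists>f' f''. (\<forall>x. (f has_derivative f' x) (at x)) \<and>
    (\<forall>x h. ((\<lambda>x. f' x h) has_derivative (\<lambda>k. f'' x k h)) (at x)) \<and>
    (\<forall>x h k. f'' x h k = f'' x k h) \<and> (\<forall>h. real_polynomial_function (\<lambda>x. f' x h)) \<and>
    (\<forall>k h. real_polynomial_function (\<lambda>x. f'' x k h))"
    using assms
  proof (induction f rule: real_polynomial_function.induct)
    case (linear f)
    then show ?case
      by (intro exI[of _ "\<lambda>x. f"] exI[of _ "\<lambda>x k h. 0"])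
         (auto simp: bounded_linear_imp_has_derivative)
  next
    case (const c)
    then show ?case
      by (intro exI[of _ "\<lambda>x h. 0"] exI[of _ "\<lambda>x k h. 0"]) auto
  next
    case (add f g)
    from add.IH(1) obtain f' f'' where
      "\<And>x. (f has_derivative f' x) (at x)" "\<And>x h. ((\<lambda>x. f' x h) has_derivative (\<lambda>k. f'' x k h)) (at x)"
      "\<And>x h k. f'' x h k = f'' x k h" "\<And>h. real_polynomial_function (\<lambda>x. f' x h)"
      "\<And>k h. real_polynomial_function (\<lambda>x. f'' x k h)" by blast
    moreover from add.IH(2) obtain g' g'' where
      "\<And>x. (g has_derivative g' x) (at x)" "\<And>x h. ((\<lambda>x. g' x h) has_derivative (\<lambda>k. g'' x k h)) (at x)"
      "\<And>x h k. g'' x h k = g'' x k h" "\<And>h. real_polynomial_function (\<lambda>x. g' x h)"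
      "\<And>k h. real_polynomial_function (\<lambda>x. g'' x k h)" by blast
    ultimately show ?case
      by (intro exI[of _ "\<lambda>x h. f' x h + g' x h"] exI[of _ "\<lambda>x k h. f'' x k h + g'' x k h"])
         (auto intro!: has_derivative_add)
  next
    case (mult f g)
    from mult.IH(1) obtain f' f'' where
      f: "\<And>x. (f has_derivative f' x) (at x)" "\<And>x h. ((\<lambda>x. f' x h) has_derivative (\<lambda>k. f'' x k h)) (at x)"
      "\<And>x h k. f'' x h k = f'' x k h" "\<And>h. real_polynomial_function (\<lambda>x. f' x h)"
      "\<And>k h. real_polynomial_function (\<lambda>x. f'' x k h)" by blast
    from mult.IH(2) obtain g' g'' where
      g: "\<And>x. (g has_derivative g' x) (at x)" "\<And>x h. ((\<lambda>x. g' x h) has_derivative (\<lambda>k. g'' x k h)) (at x)"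
      "\<And>x h k. g'' x h k = g'' x k h" "\<And>h. real_polynomial_function (\<lambda>x. g' x h)"
      "\<And>k h. real_polynomial_function (\<lambda>x. g'' x k h)" by blast
    show ?case
    proof (intro exI[of _ "\<lambda>x h. f x * g' x h + f' x h * g x"]
        exI[of _ "\<lambda>x k h. (f x * g'' x k h + f' x k * g' x h) + (f' x h * g' x k + f'' x k h * g x)"] conjI allI)
      show "((\<lambda>x. f x * g x) has_derivative (\<lambda>h. f x * g' x h + f' x h * g x)) (at x)" for x
        by (intro has_derivative_mult f g)
      show "((\<lambda>x. f x * g' x h + f' x h * g x) has_derivative
          (\<lambda>k. (f x * g'' x k h + f' x k * g' x h) + (f' x h * g' x k + f'' x k h * g x))) (at x)" for x h
        by (intro has_derivative_mult has_derivative_add f g)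
      show "real_polynomial_function (\<lambda>x. f x * g' x h + f' x h * g x)" for h
        by (intro real_polynomial_function.intros(3,4) f g mult.hyps)
      show "real_polynomial_function (\<lambda>x. (f x * g'' x k h + f' x k * g' x h) + (f' x h * g' x k + f'' x k h * g x))" for k h
        by (intro real_polynomial_function.intros(3,4) f g mult.hyps)
      show "(f x * g'' x h k + f' x h * g' x k) + (f' x k * g' x h + f'' x h k * g x) =
        (f x * g'' x k h + f' x k * g' x h) + (f' x h * g' x k + f'' x k h * g x)" for x h k
        by (simp add: f(3)[of x h k] g(3)[of x h k])
    qed
  qed
  then show thesis using that by blast
qed

lemma real_polynomial_function_derivative:
  fixes f :: "'a::euclidean_space \<Rightarrow> real"
  assumes "real_polynomial_function f"
  obtains f' where "\<And>x. (f has_derivative f' x) (at x)" "\<And>h. real_polynomial_function (\<lambda>x. f' x h)"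
  by (rule real_polynomial_function_second_derivative[OF assms]) (rule that)

lemma real_polynomial_function_continuous_on:
  fixes f :: "'a::euclidean_space \<Rightarrow> real"
  assumes "real_polynomial_function f" "continuous_on S g"
  shows "continuous_on S (\<lambda>x. f (g x))"
proof -
  have "continuous_on UNIV f"
    using assms(1) continuous_on_polymonial_function real_polynomial_function_eq by blast
  then show ?thesis using assms(2) continuous_on_compose2 by blast
qed

text \<open>The Poincare lemma with an error term: the radial primitive of the 1-form
  \<open>A dQ\<close> fails to be a primitive only by the integral of \<open>dA \<and> dQ\<close> along the ray.\<close>

lemma radial_primitive_derivative_along_curve:
  fixes A Q :: "'a::euclidean_space \<Rightarrow> real"
  assumes A: "real_polynomial_function A" and Q: "real_polynomial_function Q"
    and A': "\<And>x. (A has_derivative A' x) (at x)" and Q': "\<And>x. (Q has_derivative Q' x) (at x)"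
    and c: "open S" "t \<in> S" "\<And>s. s \<in> S \<Longrightarrow> (c has_vector_derivative c' s) (at s)" "continuous_on S c'"
    and M: "\<And>s. 0 \<le> s \<Longrightarrow> s \<le> 1 \<Longrightarrow>
      \<bar>A' (s *\<^sub>R c t) (c' t) * Q' (s *\<^sub>R c t) (c t) - A' (s *\<^sub>R c t) (c t) * Q' (s *\<^sub>R c t) (c' t)\<bar> \<le> M"
  shows "\<exists>k. ((\<lambda>t. integral {0..1} (\<lambda>s. A (s *\<^sub>R c t) * Q' (s *\<^sub>R c t) (c t))) has_real_derivative k) (at t)
     \<and> \<bar>k - A (c t) * Q' (c t) (c' t)\<bar> \<le> M"
proof -
  obtain A1 where A1: "\<And>x. (A has_derivative A1 x) (at x)"
    "\<And>h. real_polynomial_function (\<lambda>x. A1 x h)"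
    by (rule real_polynomial_function_derivative[OF A]) (rule that)
  have [simp]: "A1 = A'" using A1(1) A' has_derivative_unique by blast
  obtain Q1 Q2 where Q1: "\<And>x. (Q has_derivative Q1 x) (at x)"
    "\<And>x h. ((\<lambda>x. Q1 x h) has_derivative (\<lambda>k. Q2 x k h)) (at x)"
    "\<And>x h k. Q2 x h k = Q2 x k h"
    "\<And>h. real_polynomial_function (\<lambda>x. Q1 x h)"
    "\<And>k h. real_polynomial_function (\<lambda>x. Q2 x k h)"
    by (rule real_polynomial_function_second_derivative[OF Q]) (rule that)
  have [simp]: "Q1 = Q'" using Q1(1) Q' has_derivative_unique by blast
  note Q2 = Q1(2-5)[simplified] and A2 = A1(2)[simplified]
  have bA: "bounded_linear (A' x)" for x using A' by (auto simp: has_derivative_def)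
  have bQ: "bounded_linear (Q' x)" for x using Q' by (auto simp: has_derivative_def)
  have bQ2: "bounded_linear (\<lambda>k. Q2 x k h)" for x h using Q2(1)[of h x] by (auto simp: has_derivative_def)
  have bQ2': "bounded_linear (Q2 x k)" for x k using bQ2[of x k] Q2(2)[of x _ k] by simp
  have cA': "continuous_on X (\<lambda>x. A' (g x) (h x))" if "continuous_on X g" "continuous_on X h"
    for X :: "'p::topological_space set" and g h
  proof -
    have eq: "(\<lambda>x. A' (g x) (h x)) = (\<lambda>x. \<Sum>b\<in>Basis. (h x \<bullet> b) * A' (g x) b)"
      by (rule ext, rule bounded_linear_Basis_sum[OF bA])
    show ?thesis unfolding eq
      by (intro continuous_intros that real_polynomial_function_continuous_on[OF A2])
  qed
  have cQ': "continuous_on X (\<lambda>x. Q' (g x) (h x))" if "continuous_on X g" "continuous_on X h"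
    for X :: "'q::topological_space set" and g h
  proof -
    have eq: "(\<lambda>x. Q' (g x) (h x)) = (\<lambda>x. \<Sum>b\<in>Basis. (h x \<bullet> b) * Q' (g x) b)"
      by (rule ext, rule bounded_linear_Basis_sum[OF bQ])
    show ?thesis unfolding eq
      by (intro continuous_intros that real_polynomial_function_continuous_on[OF Q2(3)])
  qed
  have cQ2: "continuous_on X (\<lambda>x. Q2 (g x) (k x) (h x))"
    if "continuous_on X g" "continuous_on X h" "continuous_on X k"
    for X :: "'r::topological_space set" and g h k
  proof -
    have eq: "(\<lambda>x. Q2 (g x) (k x) (h x)) =
        (\<lambda>x. \<Sum>b\<in>Basis. (h x \<bullet> b) * (\<Sum>b'\<in>Basis. (k x \<bullet> b') * Q2 (g x) b' b))"
      by (rule ext, subst bounded_linear_Basis_sum[OF bQ2'])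
         (intro sum.cong refl arg_cong2[where f="(*)"] bounded_linear_Basis_sum[OF bQ2])
    show ?thesis unfolding eq
      by (intro continuous_intros that real_polynomial_function_continuous_on[OF Q2(4)])
  qed
  \<comment> \<open>The Leibniz rule is applied on a convex neighbourhood of \<open>t\<close>, and
    \<open>S\<close> itself need not be convex.\<close>
  obtain r where r: "r > 0" "ball t r \<subseteq> S" using c(1,2) openE by blast
  define U where "U = ball t r"
  have tU: "t \<in> U" and US: "U \<subseteq> S" using r by (auto simp: U_def)
  have cc: "continuous_on U c"
    using c(3) US by (meson continuous_at_imp_continuous_on has_vector_derivative_continuous subsetD)
  have cc': "continuous_on U c'" using c(4) US continuous_on_subset by blast
  define ft where "ft t s = A' (s *\<^sub>R c t) (s *\<^sub>R c' t) * Q' (s *\<^sub>R c t) (c t)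
     + A (s *\<^sub>R c t) * (Q2 (s *\<^sub>R c t) (s *\<^sub>R c' t) (c t) + Q' (s *\<^sub>R c t) (c' t))" for t s
  have cd: "(c has_derivative (\<lambda>h. h *\<^sub>R c' t)) (at t)" if "t \<in> U" for t
    using c(3) that US by (auto simp: has_vector_derivative_def)
  have dA: "((\<lambda>t. A (s *\<^sub>R c t)) has_real_derivative A' (s *\<^sub>R c t) (s *\<^sub>R c' t)) (at t)" if "t \<in> U" for t s
  proof -
    have "((\<lambda>t. s *\<^sub>R c t) has_derivative (\<lambda>h. s *\<^sub>R (h *\<^sub>R c' t))) (at t)"
      by (intro derivative_intros cd that)
    from has_derivative_compose[OF this A'] have "((\<lambda>t. A (s *\<^sub>R c t)) has_derivative (\<lambda>h. A' (s *\<^sub>R c t) (s *\<^sub>R (h *\<^sub>R c' t)))) (at t)" .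
    then show ?thesis unfolding has_field_derivative_def
      by (elim has_derivative_eq_rhs) (simp add: fun_eq_iff linear_scale[OF bounded_linear.linear[OF bA]])
  qed
  have dQ: "((\<lambda>t. Q' (s *\<^sub>R c t) (c t)) has_real_derivative (Q2 (s *\<^sub>R c t) (s *\<^sub>R c' t) (c t) + Q' (s *\<^sub>R c t) (c' t))) (at t)"
    if "t \<in> U" for t s
  proof -
    have 1: "((\<lambda>t. s *\<^sub>R c t) has_derivative (\<lambda>h. s *\<^sub>R (h *\<^sub>R c' t))) (at t)"
      by (intro derivative_intros cd that)
    have 2: "((\<lambda>t. Q' (s *\<^sub>R c t) b) has_real_derivative Q2 (s *\<^sub>R c t) (s *\<^sub>R c' t) b) (at t)" for b
      using has_derivative_compose[OF 1 Q2(1)[of b]] unfolding has_field_derivative_def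
      by (elim has_derivative_eq_rhs) (simp add: fun_eq_iff linear_scale[OF bounded_linear.linear[OF bQ2]])
    have 3: "((\<lambda>t. c t \<bullet> b) has_real_derivative c' t \<bullet> b) (at t)" for b
      unfolding has_field_derivative_def
      by (rule has_derivative_eq_rhs[OF has_derivative_inner_left[OF cd[OF that]]]) (simp add: fun_eq_iff)
    \<comment> \<open>Here \<open>t\<close> enters through the base point and through the direction.
      Linearity in the direction separates the two into products of scalar functions.\<close>
    have "((\<lambda>t. \<Sum>b\<in>Basis. (c t \<bullet> b) * Q' (s *\<^sub>R c t) b) has_real_derivative
      (\<Sum>b\<in>Basis. (c' t \<bullet> b) * Q' (s *\<^sub>R c t) b + Q2 (s *\<^sub>R c t) (s *\<^sub>R c' t) b * (c t \<bullet> b))) (at t)"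
      by (intro DERIV_sum DERIV_mult 2 3)
    moreover have "(\<lambda>t. \<Sum>b\<in>Basis. (c t \<bullet> b) * Q' (s *\<^sub>R c t) b) = (\<lambda>t. Q' (s *\<^sub>R c t) (c t))"
      by (rule ext, rule bounded_linear_Basis_sum[OF bQ, symmetric])
    moreover have "(\<Sum>b\<in>Basis. (c' t \<bullet> b) * Q' (s *\<^sub>R c t) b + Q2 (s *\<^sub>R c t) (s *\<^sub>R c' t) b * (c t \<bullet> b))
      = Q2 (s *\<^sub>R c t) (s *\<^sub>R c' t) (c t) + Q' (s *\<^sub>R c t) (c' t)"
      by (subst bounded_linear_Basis_sum[OF bQ2', of _ _ "c t"], subst bounded_linear_Basis_sum[OF bQ, of _ "c' t"])
        (simp add: sum.distrib mult.commute add.commute)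
    ultimately show ?thesis by simp
  qed
  have "((\<lambda>t. integral (cbox 0 1) (\<lambda>s. A (s *\<^sub>R c t) * Q' (s *\<^sub>R c t) (c t))) has_field_derivative
     integral (cbox 0 1) (ft t)) (at t within U)"
  proof (rule leibniz_rule_field_derivative)
    show "((\<lambda>t. A (s *\<^sub>R c t) * Q' (s *\<^sub>R c t) (c t)) has_real_derivative ft t s) (at t within U)" if "t \<in> U" for t s
      unfolding ft_def using DERIV_mult[OF dA[OF that] dQ[OF that]]
      by (subst has_field_derivative_at_within) (simp_all add: mult.commute)
    show "(\<lambda>s. A (s *\<^sub>R c t) * Q' (s *\<^sub>R c t) (c t)) integrable_on cbox 0 1" for t
      by (intro integrable_continuous continuous_intros cQ' real_polynomial_function_continuous_on[OF A])
    have 1: "continuous_on (U \<times> X) (\<lambda>z. c (fst z))" "continuous_on (U \<times> X) (\<lambda>z. c' (fst z))" for X :: "real set"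
      by (rule continuous_on_compose2[OF cc] continuous_on_compose2[OF cc'],
          auto intro!: continuous_intros)+
    show "continuous_on (U \<times> cbox 0 1) (\<lambda>(t, s). ft t s)"
      unfolding ft_def case_prod_unfold
      by (intro continuous_intros cQ' cA' cQ2 1 real_polynomial_function_continuous_on[OF A])
  qed (use tU in \<open>auto simp: U_def\<close>)
  then have D: "((\<lambda>t. integral {0..1} (\<lambda>s. A (s *\<^sub>R c t) * Q' (s *\<^sub>R c t) (c t))) has_real_derivative
     integral {0..1} (ft t)) (at t)"
    using tU at_within_open[of t U] by (simp add: U_def)
  let ?x = "c t" and ?h = "c' t"
  \<comment> \<open>\<open>g\<close> is the derivative in \<open>s\<close> of
    \<open>s * A (s *\<^sub>R ?x) * Q' (s *\<^sub>R ?x) ?h\<close>, so it integrates to the desired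
    value. The symmetry of \<open>Q2\<close> leaves only \<open>j\<close>, which is \<open>s\<close>
    times the 2-form dA dQ evaluated on \<open>?h\<close> and \<open>?x\<close>.\<close>
  define g where "g s = A (s *\<^sub>R ?x) * Q' (s *\<^sub>R ?x) ?h + s * (A' (s *\<^sub>R ?x) ?x * Q' (s *\<^sub>R ?x) ?h
     + A (s *\<^sub>R ?x) * Q2 (s *\<^sub>R ?x) ?x ?h)" for s
  define j where "j s = s * (A' (s *\<^sub>R ?x) ?h * Q' (s *\<^sub>R ?x) ?x - A' (s *\<^sub>R ?x) ?x * Q' (s *\<^sub>R ?x) ?h)" for s
  have ftgj: "ft t s = g s + j s" for s
    unfolding ft_def g_def j_def
    by (simp add: linear_scale[OF bounded_linear.linear[OF bA]] linear_scale[OF bounded_linear.linear[OF bQ2]]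
        Q2(2)[of _ ?h ?x] algebra_simps)
  have gi: "(g has_integral A ?x * Q' ?x ?h) {0..1}"
  proof -
    have "(g has_integral (1 * (A (1 *\<^sub>R ?x) * Q' (1 *\<^sub>R ?x) ?h)) - (0 * (A (0 *\<^sub>R ?x) * Q' (0 *\<^sub>R ?x) ?h))) {0..1}"
    proof (rule fundamental_theorem_of_calculus)
      fix s :: real
      have s: "((\<lambda>s. s *\<^sub>R ?x) has_derivative (\<lambda>h. h *\<^sub>R ?x)) (at s)"
        by (auto intro!: derivative_eq_intros)
      have 1: "((\<lambda>s. A (s *\<^sub>R ?x)) has_real_derivative A' (s *\<^sub>R ?x) ?x) (at s)"
        using has_derivative_compose[OF s A'] unfolding has_field_derivative_def
        by (elim has_derivative_eq_rhs) (simp add: fun_eq_iff linear_scale[OF bounded_linear.linear[OF bA]])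
      have 2: "((\<lambda>s. Q' (s *\<^sub>R ?x) ?h) has_real_derivative Q2 (s *\<^sub>R ?x) ?x ?h) (at s)"
        using has_derivative_compose[OF s Q2(1)[of ?h]] unfolding has_field_derivative_def
        by (elim has_derivative_eq_rhs) (simp add: fun_eq_iff linear_scale[OF bounded_linear.linear[OF bQ2]])
      have "((\<lambda>s. s * (A (s *\<^sub>R ?x) * Q' (s *\<^sub>R ?x) ?h)) has_real_derivative g s) (at s)"
        using DERIV_mult[OF DERIV_ident DERIV_mult[OF 1 2]] unfolding g_def by (simp add: algebra_simps)
      then show "((\<lambda>s. s * (A (s *\<^sub>R ?x) * Q' (s *\<^sub>R ?x) ?h)) has_vector_derivative g s) (at s within {0..1})"
        by (simp add: has_real_derivative_iff_has_vector_derivative has_vector_derivative_at_within)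
    qed simp
    then show ?thesis by simp
  qed
  have ji: "j integrable_on {0..1}"
    unfolding j_def by (intro integrable_continuous_interval continuous_intros cA' cQ')
  have "\<bar>integral {0..1} j\<bar> \<le> M"
  proof -
    have "norm (integral {0..1} j) \<le> integral {0..1} (\<lambda>s::real. M)"
    proof (rule integral_norm_bound_integral[OF ji])
      show "(\<lambda>s::real. M) integrable_on {0..1}" by auto
      fix s :: real assume s: "s \<in> {0..1}"
      have M0: "0 \<le> M" using M[of 0] by simp
      have "norm (j s) \<le> 1 * M"
        unfolding j_def real_norm_def abs_mult using s M[of s] by (intro mult_mono) auto
      then show "norm (j s) \<le> M" by simp
    qed
    then show ?thesis by simp
  qed
  moreover have "integral {0..1} (ft t) = A ?x * Q' ?x ?h + integral {0..1} j"
    unfolding ftgj[abs_def] using integral_add[OF has_integral_integrable[OF gi] ji] integral_unique[OF gi] by simp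
  ultimately show ?thesis using D by (intro exI[of _ "integral {0..1} (ft t)"]) simp
qed

section \<open>Gram determinants, area contraction under iteration, almost primitives\<close>

definition sq_area :: "'a::real_inner \<Rightarrow> 'a \<Rightarrow> real" where
  "sq_area a b = (a \<bullet> a) * (b \<bullet> b) - (a \<bullet> b)\<^sup>2"

lemma sq_area_nonneg: "0 \<le> sq_area a b"
  unfolding sq_area_def using Cauchy_Schwarz_ineq[of a b] by simp

lemma sq_area_le: "sq_area a b \<le> (norm a * norm b)\<^sup>2"
  unfolding sq_area_def by (simp add: power_mult_distrib power2_norm_eq_inner)

text \<open>A 2-form does not change when \<open>b\<close> is replaced by its part orthogonal to
  \<open>a\<close>, and then the area is a product of lengths. The vector \<open>d\<close> is this
  part multiplied by \<open>a \<bullet> a\<close>, which avoids a division.\<close>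

lemma abs_minor_le_area:
  fixes L :: "'a::real_inner \<Rightarrow> real"
  assumes L: "bounded_linear L" and C: "\<And>h. \<bar>L h\<bar> \<le> C * norm h"
  shows "\<bar>L a * (v \<bullet> b) - L b * (v \<bullet> a)\<bar> \<le> 2 * C * norm v * sqrt (sq_area a b)"
proof (cases "a = 0")
  case True
  then show ?thesis using linear_0[OF bounded_linear.linear[OF L]] by (simp add: sq_area_def)
next
  case False
  define d where "d = (a \<bullet> a) *\<^sub>R b - (a \<bullet> b) *\<^sub>R a"
  have "d \<bullet> d = (a \<bullet> a) * sq_area a b"
    unfolding d_def sq_area_def by (simp add: inner_diff_left inner_diff_right inner_commute power2_eq_square algebra_simps)
  then have nd: "norm d = norm a * sqrt (sq_area a b)"
    by (simp add: norm_eq_sqrt_inner real_sqrt_mult)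
  have "(a \<bullet> a) * (L a * (v \<bullet> b) - L b * (v \<bullet> a)) = L a * (v \<bullet> d) - L d * (v \<bullet> a)"
    unfolding d_def using L by (simp add: linear_diff[OF bounded_linear.linear] linear_scale[OF bounded_linear.linear]
        inner_diff_right algebra_simps)
  then have "(norm a)\<^sup>2 * \<bar>L a * (v \<bullet> b) - L b * (v \<bullet> a)\<bar> = \<bar>L a * (v \<bullet> d) - L d * (v \<bullet> a)\<bar>"
    by (metis abs_mult abs_power2 power2_norm_eq_inner)
  also have "\<dots> \<le> \<bar>L a\<bar> * \<bar>v \<bullet> d\<bar> + \<bar>L d\<bar> * \<bar>v \<bullet> a\<bar>"
    by (metis abs_mult abs_triangle_ineq4)
  also have "\<dots> \<le> (C * norm a) * (norm v * norm d) + (C * norm d) * (norm v * norm a)"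
    by (intro add_mono mult_mono C Cauchy_Schwarz_ineq2) (use C order_trans[OF abs_ge_zero] in auto)
  also have "\<dots> = (norm a)\<^sup>2 * (2 * C * norm v * sqrt (sq_area a b))"
    unfolding nd by (simp add: power2_eq_square)
  finally show ?thesis using False by simp
qed

lemma funpow_sq_area_contraction:
  assumes D: "\<And>x. (\<phi> has_derivative D\<phi> x) (at x)" and B: "\<phi> ` B \<subseteq> B" and q: "0 \<le> q"
    and area: "\<And>x a b. x \<in> B \<Longrightarrow> sq_area (D\<phi> x a) (D\<phi> x b) \<le> q * sq_area a b"
    and x: "x \<in> B"
  shows "(\<phi> ^^ n) x \<in> B \<and> (\<exists>L. ((\<phi> ^^ n) has_derivative L) (at x) \<and> (\<forall>a b. sq_area (L a) (L b) \<le> q ^ n * sq_area a b))"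
proof (induction n)
  case 0
  show ?case using x by (auto intro!: exI[of _ "\<lambda>h. h"] simp: id_def)
next
  case (Suc n)
  then obtain L where L: "((\<phi> ^^ n) has_derivative L) (at x)" "\<And>a b. sq_area (L a) (L b) \<le> q ^ n * sq_area a b"
    and xn: "(\<phi> ^^ n) x \<in> B" by blast
  have "((\<phi> ^^ Suc n) has_derivative (\<lambda>h. D\<phi> ((\<phi> ^^ n) x) (L h))) (at x)"
    using has_derivative_compose[OF L(1) D] by (simp add: o_def)
  moreover have "sq_area (D\<phi> ((\<phi> ^^ n) x) (L a)) (D\<phi> ((\<phi> ^^ n) x) (L b)) \<le> q ^ Suc n * sq_area a b" for a b
  proof -
    have "q * sq_area (L a) (L b) \<le> q * (q ^ n * sq_area a b)" using L(2) q by (intro mult_left_mono)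
    then show ?thesis using area[OF xn, of "L a" "L b"] by simp
  qed
  moreover have "(\<phi> ^^ Suc n) x \<in> B" using xn B by auto
  ultimately show ?case by blast
qed

lemma polynomial_function_funpow:
  fixes \<phi> :: "'a::real_normed_vector \<Rightarrow> 'a"
  shows "polynomial_function \<phi> \<Longrightarrow> polynomial_function (\<phi> ^^ n)"
proof (induction n)
  case 0
  have "(\<phi> ^^ 0) = (\<lambda>x. x)" by (rule ext) simp
  then show ?case by (simp only: polynomial_function_id)
next
  case (Suc n)
  then show ?case using polynomial_function_compose using polynomial_function_compose[of "\<phi> ^^ n" \<phi>] by (simp add: o_def)
qed

definition C1_curve_in :: "'a::real_normed_vector set \<Rightarrow> real set \<Rightarrow> (real \<Rightarrow> 'a) \<Rightarrow> (real \<Rightarrow> 'a) \<Rightarrow> bool" where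
  "C1_curve_in Z S c c' \<longleftrightarrow> open S \<and> (\<forall>s\<in>S. (c has_vector_derivative c' s) (at s)) \<and>
     continuous_on S c' \<and> c ` S \<subseteq> Z"

text \<open>\<open>K\<close> is the radial primitive of the form pulled back by a high iterate of
  \<open>\<phi>\<close>. One half of \<open>e\<close> pays for replacing \<open>\<psi>\<close> by a
  polynomial, the other for the failure of the pulled back form to be closed.\<close>

lemma almost_primitive_on_fixed_curves:
  fixes \<phi> :: "'a::euclidean_space \<Rightarrow> 'a" and \<psi> :: "'a \<Rightarrow> real"
  assumes poly: "polynomial_function \<phi>" and D: "\<And>x. (\<phi> has_derivative D\<phi> x) (at x)"
    and B: "\<phi> ` cball 0 R \<subseteq> cball 0 R" and q: "0 \<le> q" "q < 1"
    and area: "\<And>x a b. x \<in> cball 0 R \<Longrightarrow> sq_area (D\<phi> x a) (D\<phi> x b) \<le> q * sq_area a b"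
    and Z: "Z \<subseteq> cball 0 R" "\<And>x. x \<in> Z \<Longrightarrow> \<phi> x = x"
    and \<psi>: "continuous_on (cball 0 R) \<psi>" and e: "e > 0"
  shows "\<exists>K. \<forall>S c c'. C1_curve_in Z S c c' \<longrightarrow> (\<forall>t\<in>S. \<exists>k. ((\<lambda>s. K (c s)) has_real_derivative k) (at t) \<and>
      \<bar>k - \<psi> (c t) * (v \<bullet> c' t)\<bar> \<le> e * norm (c' t))"
proof -
  \<comment> \<open>The approximation error of \<open>\<psi>\<close> gets multiplied by
    \<open>norm v\<close>; adding 1 covers \<open>v = 0\<close>.\<close>
  define e1 where "e1 = e / (2 * (norm v + 1))"
  have e1: "e1 > 0" "e1 * norm v \<le> e / 2"
    using e unfolding e1_def by (auto simp: field_simps add_pos_nonneg)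
  obtain P where P: "real_polynomial_function P" "\<And>x. x \<in> cball 0 R \<Longrightarrow> \<bar>\<psi> x - P x\<bar> < e1"
    by (rule Stone_Weierstrass_real_polynomial_function[OF compact_cball \<psi> e1(1)]) (rule that)
  obtain P' where P': "\<And>x. (P has_derivative P' x) (at x)" "\<And>h. real_polynomial_function (\<lambda>x. P' x h)"
    by (rule real_polynomial_function_derivative[OF P(1)]) (rule that)
  have bP: "bounded_linear (P' x)" for x using P'(1) by (auto simp: has_derivative_def)
  obtain C where C: "C \<ge> 0" "\<And>x h. x \<in> cball 0 R \<Longrightarrow> \<bar>P' x h\<bar> \<le> C * norm h"
  proof -
    have "\<exists>M. \<forall>x\<in>cball 0 R. norm (P' x b) \<le> M" for b
    proof -
      have "compact ((\<lambda>x. P' x b) ` cball 0 R)"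
        by (intro compact_continuous_image real_polynomial_function_continuous_on[OF P'(2)] continuous_on_id compact_cball)
      then show ?thesis using compact_imp_bounded bounded_iff by (metis (no_types, lifting) imageI)
    qed
    then obtain M where M: "\<And>b x. x \<in> cball 0 R \<Longrightarrow> norm (P' x b) \<le> M b" by metis
    show thesis
    proof (rule that[of "\<Sum>b\<in>Basis. \<bar>M b\<bar>"])
      fix x h assume x: "x \<in> cball (0::'a) R"
      have "\<bar>P' x h\<bar> = \<bar>\<Sum>b\<in>Basis. (h \<bullet> b) * P' x b\<bar>"
        by (subst bounded_linear_Basis_sum[OF bP]) simp
      also have "\<dots> \<le> (\<Sum>b\<in>Basis. \<bar>(h \<bullet> b) * P' x b\<bar>)" by (rule sum_abs)
      also have "\<dots> \<le> (\<Sum>b\<in>Basis. norm h * \<bar>M b\<bar>)"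
        unfolding abs_mult
      proof (intro sum_mono mult_mono)
        fix b :: 'a assume "b \<in> Basis"
        then show "\<bar>h \<bullet> b\<bar> \<le> norm h" by (rule Basis_le_norm)
        show "\<bar>P' x b\<bar> \<le> \<bar>M b\<bar>" using M[OF x, of b] by simp
      qed auto
      finally show "\<bar>P' x h\<bar> \<le> (\<Sum>b\<in>Basis. \<bar>M b\<bar>) * norm h"
        by (simp add: sum_distrib_left mult.commute)
    qed (simp add: sum_nonneg)
  qed
  \<comment> \<open>Squared areas shrink by \<open>q\<close> in each step, hence areas by
    \<open>sqrt q\<close>. The factor \<open>\<bar>R\<bar>\<close> bounds the length of the ray from
    0 to a point of the curve.\<close>
  have "(\<lambda>n. 2 * C * norm v * (sqrt q ^ n * \<bar>R\<bar>)) \<longlonglongrightarrow> 2 * C * norm v * (0 * \<bar>R\<bar>)"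
    using q by (intro tendsto_intros LIMSEQ_power_zero) auto
  then have "\<forall>\<^sub>F n in sequentially. 2 * C * norm v * (sqrt q ^ n * \<bar>R\<bar>) < e / 2"
    using e by (intro order_tendstoD(2)) auto
  then obtain n where n: "2 * C * norm v * (sqrt q ^ n * \<bar>R\<bar>) < e / 2"
    by (auto simp: eventually_sequentially)
  define \<Phi> where "\<Phi> = \<phi> ^^ n"
  have poly\<Phi>: "polynomial_function \<Phi>" unfolding \<Phi>_def by (rule polynomial_function_funpow[OF poly])
  have fix\<Phi>: "\<Phi> x = x" if "x \<in> Z" for x
    unfolding \<Phi>_def by (induction n) (use Z(2)[OF that] in auto)
  have \<Phi>: "\<Phi> x \<in> cball 0 R \<and> (\<exists>L. (\<Phi> has_derivative L) (at x) \<and> (\<forall>a b. sq_area (L a) (L b) \<le> q ^ n * sq_area a b))"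
    if "x \<in> cball 0 R" for x
    unfolding \<Phi>_def by (rule funpow_sq_area_contraction[OF D B q(1) area that])
  define A where "A x = P (\<Phi> x)" for x
  define Q where "Q x = v \<bullet> \<Phi> x" for x
  have pA: "real_polynomial_function A"
    using real_polynomial_function_compose[OF poly\<Phi> P(1)] by (simp add: A_def[abs_def] o_def)
  have pQ: "real_polynomial_function Q"
    using poly\<Phi> bounded_linear_inner_right[of v] unfolding polynomial_function_def by (auto simp: Q_def[abs_def] o_def)
  obtain A' where A': "\<And>x. (A has_derivative A' x) (at x)"
    by (rule real_polynomial_function_derivative[OF pA]) (rule that)
  obtain Q' where Q': "\<And>x. (Q has_derivative Q' x) (at x)"
    by (rule real_polynomial_function_derivative[OF pQ]) (rule that)
  have minor: "\<bar>A' x b * Q' x a - A' x a * Q' x b\<bar> \<le> 2 * C * norm v * (sqrt q ^ n * (norm a * norm b))"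
    if x: "x \<in> cball 0 R" for x a b
  proof -
    obtain L where L: "(\<Phi> has_derivative L) (at x)" "\<And>a b. sq_area (L a) (L b) \<le> q ^ n * sq_area a b"
      and xn: "\<Phi> x \<in> cball 0 R"
      using \<Phi>[OF x] by blast
    have "(A has_derivative (\<lambda>h. P' (\<Phi> x) (L h))) (at x)"
      unfolding A_def[abs_def] by (rule has_derivative_compose[OF L(1) P'(1)])
    then have A'x: "A' x = (\<lambda>h. P' (\<Phi> x) (L h))" using A' has_derivative_unique by blast
    have "(Q has_derivative (\<lambda>h. v \<bullet> L h)) (at x)"
      unfolding Q_def[abs_def] by (rule has_derivative_inner_right[OF L(1)])
    then have Q'x: "Q' x = (\<lambda>h. v \<bullet> L h)" using Q' has_derivative_unique by blast
    have "\<bar>A' x b * Q' x a - A' x a * Q' x b\<bar> \<le> 2 * C * norm v * sqrt (sq_area (L b) (L a))"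
      unfolding A'x Q'x by (rule abs_minor_le_area[OF bP C(2)[OF xn]])
    also have "\<dots> \<le> 2 * C * norm v * (sqrt q ^ n * (norm a * norm b))"
    proof (intro mult_left_mono)
      have "sq_area (L b) (L a) \<le> q ^ n * (norm b * norm a)\<^sup>2"
        using L(2)[of b a] sq_area_le[of b a] q(1) by (meson mult_left_mono order_trans zero_le_power)
      then have "sqrt (sq_area (L b) (L a)) \<le> sqrt (q ^ n * (norm b * norm a)\<^sup>2)" by simp
      also have "\<dots> = sqrt q ^ n * (norm a * norm b)"
        by (simp add: real_sqrt_mult[of "q ^ n"] real_sqrt_power mult.commute)
      finally show "sqrt (sq_area (L b) (L a)) \<le> sqrt q ^ n * (norm a * norm b)" .
    qed (use C(1) in auto)
    finally show ?thesis .
  qed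
  show ?thesis
  proof (intro exI[of _ "\<lambda>x. integral {0..1} (\<lambda>r. A (r *\<^sub>R x) * Q' (r *\<^sub>R x) x)"] allI impI ballI)
    fix S c c' t
    assume "C1_curve_in Z S c c'" and tS: "t \<in> S"
    then have S: "open S" "t \<in> S" and c: "\<And>s. s \<in> S \<Longrightarrow> (c has_vector_derivative c' s) (at s)"
      "continuous_on S c'" and cZ: "c ` S \<subseteq> Z"
      by (auto simp: C1_curve_in_def)
    have ct: "c t \<in> Z" using S cZ by auto
    have cR: "norm (c t) \<le> R" using ct Z(1) by auto
    have M: "\<bar>A' (s *\<^sub>R c t) (c' t) * Q' (s *\<^sub>R c t) (c t) - A' (s *\<^sub>R c t) (c t) * Q' (s *\<^sub>R c t) (c' t)\<bar>
       \<le> e / 2 * norm (c' t)" if s: "0 \<le> s" "s \<le> 1" for s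
    proof -
      have "s * norm (c t) \<le> 1 * norm (c t)" using s by (intro mult_right_mono) auto
      then have "s *\<^sub>R c t \<in> cball 0 R" using cR s by simp
      from minor[OF this] have "\<bar>A' (s *\<^sub>R c t) (c' t) * Q' (s *\<^sub>R c t) (c t) - A' (s *\<^sub>R c t) (c t) * Q' (s *\<^sub>R c t) (c' t)\<bar>
        \<le> 2 * C * norm v * (sqrt q ^ n * (norm (c t) * norm (c' t)))" .
      also have "\<dots> \<le> 2 * C * norm v * (sqrt q ^ n * (\<bar>R\<bar> * norm (c' t)))"
        using cR C(1) q(1) by (intro mult_left_mono mult_right_mono) auto
      also have "\<dots> = (2 * C * norm v * (sqrt q ^ n * \<bar>R\<bar>)) * norm (c' t)" by simp
      also have "\<dots> \<le> e / 2 * norm (c' t)" using n by (intro mult_right_mono) auto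
      finally show ?thesis .
    qed
    obtain k where k: "((\<lambda>t. integral {0..1} (\<lambda>s. A (s *\<^sub>R c t) * Q' (s *\<^sub>R c t) (c t))) has_real_derivative k) (at t)"
      and ke: "\<bar>k - A (c t) * Q' (c t) (c' t)\<bar> \<le> e / 2 * norm (c' t)"
      using radial_primitive_derivative_along_curve[OF pA pQ A' Q' S c M] by blast
    have A_ct: "A (c t) = P (c t)" using fix\<Phi>[OF ct] by (simp add: A_def)
    have "Q' (c t) (c' t) = v \<bullet> c' t"
    proof -
      have cd: "(c has_derivative (\<lambda>h. h *\<^sub>R c' t)) (at t)" using c(1)[OF S(2)] by (simp add: has_vector_derivative_def)
      have "((\<lambda>t. Q (c t)) has_derivative (\<lambda>h. Q' (c t) (h *\<^sub>R c' t))) (at t)"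
        by (rule has_derivative_compose[OF cd Q'])
      \<comment> \<open>Off the curve \<open>Q\<close> may differ from the linear function
        \<open>v \<bullet> x\<close>. On the curve they agree, since \<open>\<Phi>\<close> fixes
        \<open>Z\<close>, and this determines the derivative in the tangent direction.\<close>
      moreover have "((\<lambda>t. Q (c t)) has_derivative (\<lambda>h. v \<bullet> (h *\<^sub>R c' t))) (at t)"
        by (rule has_derivative_transform_within_open[OF has_derivative_inner_right[OF cd] S])
           (use fix\<Phi> cZ in \<open>auto simp: Q_def\<close>)
      ultimately have "(\<lambda>h. Q' (c t) (h *\<^sub>R c' t)) = (\<lambda>h. v \<bullet> (h *\<^sub>R c' t))"
        by (rule has_derivative_unique)
      from fun_cong[OF this, of 1] show ?thesis by simp
    qed
    then have k1: "\<bar>k - P (c t) * (v \<bullet> c' t)\<bar> \<le> e / 2 * norm (c' t)" using ke A_ct by simp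
    have "\<bar>\<psi> (c t) * (v \<bullet> c' t) - P (c t) * (v \<bullet> c' t)\<bar> = \<bar>\<psi> (c t) - P (c t)\<bar> * \<bar>v \<bullet> c' t\<bar>"
      by (simp add: left_diff_distrib[symmetric] abs_mult)
    also have "\<dots> \<le> e1 * (norm v * norm (c' t))"
      using P(2)[of "c t"] cR e1 by (intro mult_mono Cauchy_Schwarz_ineq2) auto
    also have "\<dots> \<le> e / 2 * norm (c' t)"
      unfolding mult.assoc[symmetric] by (rule mult_right_mono[OF e1(2)]) simp
    finally have "\<bar>k - \<psi> (c t) * (v \<bullet> c' t)\<bar> \<le> e * norm (c' t)" using k1 by linarith
    with k show "\<exists>k. ((\<lambda>s. integral {0..1} (\<lambda>r. A (r *\<^sub>R c s) * Q' (r *\<^sub>R c s) (c s))) has_real_derivative k) (at t) \<and>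
        \<bar>k - \<psi> (c t) * (v \<bullet> c' t)\<bar> \<le> e * norm (c' t)" by blast
  qed
qed

section \<open>Area contraction of the gradient step\<close>

lemma sq_area_shear: "sq_area (s *\<^sub>R e) (t *\<^sub>R e + u *\<^sub>R f) = (s * u)\<^sup>2 * sq_area e f"
  unfolding sq_area_def
  by (simp add: inner_add_left inner_add_right inner_commute power2_eq_square algebra_simps)

text \<open>By Gram-Schmidt the pair is a triangular combination of orthonormal vectors. The squared
  determinant of this combination multiplies the squared area both before and after applying
  \<open>M\<close>, so it cancels from the comparison.\<close>

lemma sq_area_contraction_from_orthonormal:
  fixes M :: "'a::real_inner \<Rightarrow> 'b::real_inner"
  assumes M: "linear M" and q: "0 \<le> q"
    and orth: "\<And>e f. norm e = 1 \<Longrightarrow> norm f = 1 \<Longrightarrow> e \<bullet> f = 0 \<Longrightarrow> sq_area (M e) (M f) \<le> q"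
  shows "sq_area (M a) (M b) \<le> q * sq_area a b"
proof (cases "a = 0")
  case True
  then show ?thesis using linear_0[OF M] by (simp add: sq_area_def)
next
  case False
  define e where "e = a /\<^sub>R norm a"
  define d where "d = b - (e \<bullet> b) *\<^sub>R e"
  have e: "norm e = 1" using False by (simp add: e_def)
  then have ee: "e \<bullet> e = 1" by (simp add: norm_eq_1)
  have a: "a = norm a *\<^sub>R e" using False by (simp add: e_def)
  have ed: "e \<bullet> d = 0" by (simp add: d_def inner_diff_right ee)
  show ?thesis
  proof (cases "d = 0")
    case True
    then have b: "b = (e \<bullet> b) *\<^sub>R e + 0 *\<^sub>R e" by (simp add: d_def)
    have "M b = (e \<bullet> b) *\<^sub>R M e + 0 *\<^sub>R M e" by (subst b) (simp add: linear_scale[OF M])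
    moreover have "M a = norm a *\<^sub>R M e" by (subst a) (simp add: linear_scale[OF M])
    ultimately have "sq_area (M a) (M b) = 0" by (simp only: sq_area_shear) simp
    then show ?thesis using sq_area_nonneg[of a b] q by simp
  next
    case False
    define f where "f = d /\<^sub>R norm d"
    have f: "norm f = 1" "e \<bullet> f = 0" using False ed by (auto simp: f_def)
    have b: "b = (e \<bullet> b) *\<^sub>R e + norm d *\<^sub>R f" using False by (simp add: d_def f_def)
    have "M b = (e \<bullet> b) *\<^sub>R M e + norm d *\<^sub>R M f"
      by (subst b) (simp add: linear_scale[OF M] linear_add[OF M])
    moreover have "M a = norm a *\<^sub>R M e" by (subst a) (simp add: linear_scale[OF M])
    ultimately have 1: "sq_area (M a) (M b) = (norm a * norm d)\<^sup>2 * sq_area (M e) (M f)" by (simp only: sq_area_shear)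
    have "sq_area a b = sq_area (norm a *\<^sub>R e) ((e \<bullet> b) *\<^sub>R e + norm d *\<^sub>R f)"
      using a b by simp
    also have "\<dots> = (norm a * norm d)\<^sup>2" using e f by (simp only: sq_area_shear) (simp add: sq_area_def norm_eq_1)
    finally have 2: "sq_area a b = (norm a * norm d)\<^sup>2" .
    show ?thesis unfolding 1 2 using mult_left_mono[OF orth[OF e f], of "(norm a * norm d)\<^sup>2"]
      by (simp add: mult.commute[of q])
  qed
qed

text \<open>Discarding the square of the mixed product and expanding in \<open>\<eta>\<close> gives
  the first-order term \<open>-2 * \<eta>\<close> times the plane trace. The rest is
  \<open>\<eta>^2\<close> times at most \<open>6 * C^2 + 4 * C^3 + C^4\<close>:
  \<open>6 * C^2\<close> bounds \<open>4 * \<alpha> * \<beta> + A + B\<close>, the others the terms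
  with further powers of \<open>\<eta>\<close>. The last condition on \<open>\<eta>\<close> lets
  this consume at most half of the gain.\<close>

lemma sq_area_descent_step:
  fixes Ha Hb :: "'a::real_inner"
  assumes ab: "norm a = 1" "norm b = 1" "a \<bullet> b = 0"
    and C: "norm Ha \<le> C" "norm Hb \<le> C" and \<delta>: "\<delta> \<le> a \<bullet> Ha + b \<bullet> Hb"
    and \<eta>: "0 < \<eta>" "\<eta> \<le> 1" "\<eta> * (6 * C^2 + 4 * C^3 + C^4) \<le> \<delta>"
  shows "sq_area (a - \<eta> *\<^sub>R Ha) (b - \<eta> *\<^sub>R Hb) \<le> 1 - \<eta> * \<delta>"
proof -
  define \<alpha> \<beta> A B where "\<alpha> = a \<bullet> Ha" and "\<beta> = b \<bullet> Hb" and "A = Ha \<bullet> Ha" and "B = Hb \<bullet> Hb"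
  have C0: "0 \<le> C" using C(1) norm_ge_zero order_trans by blast
  have \<alpha>: "\<bar>\<alpha>\<bar> \<le> C" and \<beta>: "\<bar>\<beta>\<bar> \<le> C"
    using Cauchy_Schwarz_ineq2[of a Ha] Cauchy_Schwarz_ineq2[of b Hb] ab C by (auto simp: \<alpha>_def \<beta>_def)
  have A: "0 \<le> A" "A \<le> C^2" and B: "0 \<le> B" "B \<le> C^2"
    unfolding A_def B_def power2_norm_eq_inner[symmetric]
    using power_mono[OF C(1) norm_ge_zero, of 2] power_mono[OF C(2) norm_ge_zero, of 2] by simp_all
  have "sq_area (a - \<eta> *\<^sub>R Ha) (b - \<eta> *\<^sub>R Hb) \<le> (1 - 2 * \<eta> * \<alpha> + \<eta>^2 * A) * (1 - 2 * \<eta> * \<beta> + \<eta>^2 * B)"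
  proof -
    have "(x - \<eta> *\<^sub>R y) \<bullet> (x - \<eta> *\<^sub>R y) = 1 - 2 * \<eta> * (x \<bullet> y) + \<eta>^2 * (y \<bullet> y)" if "norm x = 1" for x y :: 'a
      using that unfolding norm_eq_1
      by (simp add: inner_diff_left inner_diff_right inner_commute power2_eq_square algebra_simps)
    then show ?thesis using ab unfolding sq_area_def \<alpha>_def \<beta>_def A_def B_def by simp
  qed
  also have "\<dots> = 1 - 2 * \<eta> * (\<alpha> + \<beta>) + \<eta>^2 * (4 * (\<alpha> * \<beta>) + A + B + \<eta> * (- 2 * (\<alpha> * B) - 2 * (\<beta> * A)) + \<eta>^2 * (A * B))"
    by (simp add: power2_eq_square algebra_simps)
  also have "\<dots> \<le> 1 - 2 * \<eta> * \<delta> + \<eta>^2 * (6 * C^2 + 4 * C^3 + C^4)"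
  proof -
    have 1: "\<alpha> * \<beta> \<le> C^2"
      using mult_mono[OF \<alpha> \<beta> C0 abs_ge_zero] by (simp add: power2_eq_square flip: abs_mult)
    have 2: "- (\<alpha> * B) \<le> C^3"
    proof -
      have "\<bar>\<alpha>\<bar> * B \<le> C * C^2" by (rule mult_mono[OF \<alpha> B(2) C0 B(1)])
      moreover have "- (\<alpha> * B) \<le> \<bar>\<alpha>\<bar> * B" using B(1) by (metis abs_ge_minus_self mult_minus_left mult_right_mono)
      ultimately show ?thesis by (simp add: power3_eq_cube power2_eq_square)
    qed
    have 3: "- (\<beta> * A) \<le> C^3"
    proof -
      have "\<bar>\<beta>\<bar> * A \<le> C * C^2" by (rule mult_mono[OF \<beta> A(2) C0 A(1)])
      moreover have "- (\<beta> * A) \<le> \<bar>\<beta>\<bar> * A" using A(1) by (metis abs_ge_minus_self mult_minus_left mult_right_mono)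
      ultimately show ?thesis by (simp add: power3_eq_cube power2_eq_square)
    qed
    have 4: "\<eta> * (- 2 * (\<alpha> * B) - 2 * (\<beta> * A)) \<le> 4 * C^3"
    proof -
      have "\<eta> * (- 2 * (\<alpha> * B) - 2 * (\<beta> * A)) \<le> \<eta> * (4 * C^3)"
        using 2 3 \<eta> by (intro mult_left_mono) auto
      also have "\<dots> \<le> 1 * (4 * C^3)" using \<eta> C0 by (intro mult_right_mono) auto
      finally show ?thesis by simp
    qed
    have 5: "\<eta>^2 * (A * B) \<le> C^4"
    proof -
      have "\<eta>^2 * (A * B) \<le> 1 * (C^2 * C^2)"
        using \<eta> A B by (intro mult_mono) (auto intro: power_le_one)
      then show ?thesis by (simp flip: power_add)
    qed
    have "\<eta>^2 * (4 * (\<alpha> * \<beta>) + A + B + \<eta> * (- 2 * (\<alpha> * B) - 2 * (\<beta> * A)) + \<eta>^2 * (A * B))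
      \<le> \<eta>^2 * (6 * C^2 + 4 * C^3 + C^4)"
      by (rule mult_left_mono) (use 1 4 5 A B in linarith, simp)
    moreover have "2 * \<eta> * \<delta> \<le> 2 * \<eta> * (\<alpha> + \<beta>)"
      using \<delta> \<eta> by (intro mult_left_mono) (auto simp: \<alpha>_def \<beta>_def)
    ultimately show ?thesis by linarith
  qed
  also have "\<dots> = 1 - 2 * \<eta> * \<delta> + \<eta> * (\<eta> * (6 * C^2 + 4 * C^3 + C^4))" by (simp add: power2_eq_square mult.assoc)
  also have "\<dots> \<le> 1 - 2 * \<eta> * \<delta> + \<eta> * \<delta>"
    using \<eta> by (intro add_left_mono mult_left_mono) auto
  finally show ?thesis by (simp add: mult.commute)
qed

section \<open>The gradient step on a large ball\<close>

lemma prod_grad_polynomial_function: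
  fixes w :: "'i \<Rightarrow> real ^ 'n"
  assumes "finite J"
  shows "polynomial_function (prod_grad w J :: real ^ 'n \<Rightarrow> real ^ 'n)"
proof -
  have comp: "real_polynomial_function (\<lambda>x :: real ^ 'n. x $ i)" for i
    by (rule real_polynomial_function.intros(1)) (rule bounded_linear_vec_nth)
  have lin: "real_polynomial_function (\<lambda>x :: real ^ 'n. x $ i - c)" for i c
    using real_polynomial_function.intros(3)[OF comp real_polynomial_function.intros(2)[of "- c"]] by simp
  have sq: "real_polynomial_function (\<lambda>x. sqd a x)" for a :: "real ^ 'n"
    unfolding sqd_def power2_eq_square
    by (intro real_polynomial_function_sum real_polynomial_function.intros(4)) (simp_all add: lin)
  have "real_polynomial_function (\<lambda>x. prod_grad w J x $ i)" for i
    unfolding prod_grad_def vec_lambda_beta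
    by (intro real_polynomial_function_sum real_polynomial_function.intros(2,4) real_polynomial_function_prod sq assms finite_Diff)
       (simp_all add: lin)
  then show ?thesis
    by (auto simp: polynomial_function_iff_Basis_inner Basis_vec_def inner_axis)
qed

lemma continuous_on_prod_hess_mult_vec:
  fixes w :: "'i \<Rightarrow> real ^ 'n" and g h :: "'b::topological_space \<Rightarrow> real ^ 'n"
  assumes "continuous_on S g" "continuous_on S h"
  shows "continuous_on S (\<lambda>x. prod_hess w J (g x) *v h x)"
  unfolding matrix_vector_mult_def
  by (intro continuous_intros continuous_on_prod_hess_component assms)

text \<open>Farther out than all the points \<open>w j\<close>, each factor
  \<open>|x - w j|^2\<close> grows in the radial direction. This both bounds the critical set and
  keeps the gradient step inside a large ball.\<close>

lemma inner_prod_grad_pos: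
  fixes w :: "'i \<Rightarrow> real ^ 'n" and x :: "real ^ 'n"
  assumes J: "finite J" "J \<noteq> {}" and m: "\<And>j. j \<in> J \<Longrightarrow> norm (w j) < norm x"
  shows "0 < x \<bullet> prod_grad w J x"
proof -
  have "x \<bullet> prod_grad w J x = (\<Sum>j\<in>J. 2 * (x \<bullet> (x - w j)) * (\<Prod>k\<in>J - {j}. sqd (w k) x))"
    unfolding inner_vec_def prod_grad_def
    by (simp add: sum_distrib_left sum_distrib_right) (subst sum.swap, simp add: mult_ac)
  also have "\<dots> > 0"
  proof (rule sum_pos[OF J])
    fix j assume j: "j \<in> J"
    have "x \<bullet> w j \<le> norm x * norm (w j)" by (rule norm_cauchy_schwarz)
    also have "\<dots> < norm x * norm x" using m[OF j] by (intro mult_strict_left_mono) (auto intro: le_less_trans)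
    finally have "0 < x \<bullet> (x - w j)" by (simp add: inner_diff_right norm_eq_sqrt_inner)
    moreover have "0 < (\<Prod>k\<in>J - {j}. sqd (w k) x)"
      using m by (intro prod_pos) (auto simp: sqd_real)
    ultimately show "0 < 2 * (x \<bullet> (x - w j)) * (\<Prod>k\<in>J - {j}. sqd (w k) x)" by simp
  qed
  finally show ?thesis .
qed

lemma prod_grad_zeros_bounded:
  fixes w :: "'i \<Rightarrow> real ^ 'n"
  assumes J: "finite J" "J \<noteq> {}"
  obtains R where "R > 0" "\<And>j. j \<in> J \<Longrightarrow> norm (w j) < R / 2" "\<And>x. prod_grad w J x = 0 \<Longrightarrow> norm (x :: real ^ 'n) < R / 2"
proof -
  define m where "m = (\<Sum>j\<in>J. norm (w j)) + 1"
  have m: "norm (w j) < m" if "j \<in> J" for j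
    using member_le_sum[OF that, of "\<lambda>j. norm (w j)"] J by (simp add: m_def)
  have m0: "m > 0" unfolding m_def by (simp add: add_nonneg_pos sum_nonneg)
  show thesis
  proof (rule that[of "2 * m"])
    show "norm x < 2 * m / 2" if "prod_grad w J x = 0" for x :: "real ^ 'n"
    proof (rule ccontr)
      assume "\<not> norm x < 2 * m / 2"
      then have "norm (w j) < norm x" if "j \<in> J" for j using m[OF that] by simp
      from inner_prod_grad_pos[of J w x, OF J this] show False using that by simp
    qed
  qed (use m m0 in auto)
qed

text \<open>From within radius \<open>R / 2\<close> a short step cannot leave the ball. In the shell
  beyond, the gradient has a radial component bounded below by compactness, so a small step does not
  carry the point outside.\<close>

lemma gradient_step_preserves_ball:
  fixes w :: "'i \<Rightarrow> real ^ 'n"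
  assumes J: "finite J" "J \<noteq> {}" and R: "R > 0" "\<And>j. j \<in> J \<Longrightarrow> norm (w j) < R / 2"
  obtains \<eta>0 where "\<eta>0 > 0" "\<And>\<eta> x. 0 < \<eta> \<Longrightarrow> \<eta> \<le> \<eta>0 \<Longrightarrow> norm (x :: real ^ 'n) \<le> R \<Longrightarrow> norm (x - \<eta> *\<^sub>R prod_grad w J x) \<le> R"
proof -
  have "compact ((prod_grad w J :: real ^ 'n \<Rightarrow> real ^ 'n) ` cball 0 R)"
    by (intro compact_continuous_image continuous_on_prod_grad compact_cball)
  from compact_imp_bounded[OF this, unfolded bounded_pos]
  obtain C where C0: "C > 0" and "\<forall>y\<in>(prod_grad w J :: real ^ 'n \<Rightarrow> real ^ 'n) ` cball 0 R. norm y \<le> C"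
    by blast
  then have C: "C > 0" "\<And>x. norm (x :: real ^ 'n) \<le> R \<Longrightarrow> norm (prod_grad w J x) \<le> C"
    by auto
  define S where "S = cball (0 :: real ^ 'n) R - ball 0 (R / 2)"
  have "compact S" unfolding S_def by (simp add: compact_diff)
  moreover have "R *\<^sub>R axis i 1 \<in> S" for i using R by (simp add: S_def)
  then have "S \<noteq> {}" by blast
  moreover have "continuous_on S (\<lambda>x. x \<bullet> prod_grad w J x)"
    by (intro continuous_on_inner continuous_on_id continuous_on_prod_grad)
  ultimately obtain x0 where x0: "x0 \<in> S" "\<And>x. x \<in> S \<Longrightarrow> x0 \<bullet> prod_grad w J x0 \<le> x \<bullet> prod_grad w J x"
    using continuous_attains_inf[of S "\<lambda>x. x \<bullet> prod_grad w J x"] by blast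
  define \<mu> where "\<mu> = x0 \<bullet> prod_grad w J x0"
  have "\<mu> > 0" unfolding \<mu>_def
  proof (rule inner_prod_grad_pos[OF J])
    fix j assume "j \<in> J"
    then show "norm (w j) < norm x0" using x0(1) R(2)[of j] by (simp add: S_def)
  qed
  \<comment> \<open>\<open>R / (2 * C)\<close> keeps the length of a step below
    \<open>R / 2\<close>, and \<open>2 * \<mu> / C^2\<close> lets the first-order decrease
    \<open>2 * \<eta> * \<mu>\<close> of the squared norm outweigh the increase
    \<open>\<eta>^2 * C^2\<close>.\<close>
  show thesis
  proof (rule that[of "min (R / (2 * C)) (2 * \<mu> / C^2)"])
    show "min (R / (2 * C)) (2 * \<mu> / C^2) > 0" using R C \<open>\<mu> > 0\<close> by simp
    fix \<eta> and x :: "real ^ 'n" assume \<eta>: "0 < \<eta>" "\<eta> \<le> min (R / (2 * C)) (2 * \<mu> / C^2)" and x: "norm x \<le> R"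
    show "norm (x - \<eta> *\<^sub>R prod_grad w J x) \<le> R"
    proof (cases "norm x < R / 2")
      case True
      have "norm (x - \<eta> *\<^sub>R prod_grad w J x) \<le> norm x + norm (\<eta> *\<^sub>R prod_grad w J x)" by (rule norm_triangle_ineq4)
      also have "norm (\<eta> *\<^sub>R prod_grad w J x) \<le> \<eta> * C" using C(2)[OF x] \<eta> by (simp add: mult_left_mono)
      also have "\<eta> * C \<le> R / 2"
      proof -
        have "\<eta> \<le> (R / 2) / C" using \<eta>(2) by simp
        then show ?thesis using C(1) by (simp only: pos_le_divide_eq)
      qed
      finally show ?thesis using True by simp
    next
      case False
      then have "x \<in> S" using x by (simp add: S_def)
      then have "\<mu> \<le> x \<bullet> prod_grad w J x" using x0 by (simp add: \<mu>_def)
      have "(norm (x - \<eta> *\<^sub>R prod_grad w J x))\<^sup>2 = (norm x)\<^sup>2 - 2 * \<eta> * (x \<bullet> prod_grad w J x) + \<eta>^2 * (norm (prod_grad w J x))\<^sup>2"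
        unfolding power2_norm_eq_inner
        by (simp add: inner_diff_left inner_diff_right inner_commute power2_eq_square algebra_simps)
      also have "\<dots> \<le> R\<^sup>2 - 2 * \<eta> * \<mu> + \<eta>^2 * C^2"
      proof (intro add_mono diff_mono)
        show "(norm x)\<^sup>2 \<le> R\<^sup>2" by (rule power_mono[OF x]) simp
        show "2 * \<eta> * \<mu> \<le> 2 * \<eta> * (x \<bullet> prod_grad w J x)"
          by (rule mult_left_mono[OF \<open>\<mu> \<le> _\<close>]) (use \<eta>(1) in simp)
        show "\<eta>^2 * (norm (prod_grad w J x))\<^sup>2 \<le> \<eta>^2 * C^2"
          by (intro mult_left_mono power_mono C(2)[OF x]) simp_all
      qed
      also have "\<dots> = R\<^sup>2 - \<eta> * (2 * \<mu> - \<eta> * C^2)" by (simp add: power2_eq_square algebra_simps)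
      also have "\<dots> \<le> R\<^sup>2"
      proof -
        have "\<eta> \<le> 2 * \<mu> / C^2" using \<eta>(2) by simp
        then have "\<eta> * C^2 \<le> 2 * \<mu>" using C(1) by (simp only: pos_le_divide_eq zero_less_power)
        then show ?thesis using \<eta>(1) by simp
      qed
      finally show ?thesis by (rule power2_le_imp_le) (use R(1) in simp)
    qed
  qed
qed

text \<open>The ball and the orthonormal pairs form a compact set, so the plane traces have a
  uniform positive lower bound \<open>\<delta>\<close> and one step size works everywhere.\<close>

lemma gradient_step_contracts_area:
  fixes w :: "'i \<Rightarrow> real ^ 'n"
  assumes tr: "\<And>(x :: real ^ 'n) e f. norm e = 1 \<Longrightarrow> norm f = 1 \<Longrightarrow> e \<bullet> f = 0 \<Longrightarrow>
      0 < e \<bullet> (prod_hess w J x *v e) + f \<bullet> (prod_hess w J x *v f)"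
  obtains \<eta>1 :: real where "\<eta>1 > 0" "\<And>\<eta>. 0 < \<eta> \<Longrightarrow> \<eta> \<le> \<eta>1 \<Longrightarrow>
    \<exists>q. 0 \<le> q \<and> q < 1 \<and> (\<forall>x a b. norm (x :: real ^ 'n) \<le> R \<longrightarrow>
      sq_area (a - \<eta> *\<^sub>R (prod_hess w J x *v a)) (b - \<eta> *\<^sub>R (prod_hess w J x *v b)) \<le> q * sq_area a b)"
proof -
  let ?H = "\<lambda>x. prod_hess w J x :: real ^ 'n ^ 'n"
  obtain \<delta> :: real where \<delta>: "\<delta> > 0" "\<And>x e f. norm x \<le> R \<Longrightarrow> norm e = 1 \<Longrightarrow> norm f = 1 \<Longrightarrow> e \<bullet> f = 0 \<Longrightarrow>
      \<delta> \<le> e \<bullet> (?H x *v e) + f \<bullet> (?H x *v f)"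
  proof -
    define T where "T = cball (0 :: real ^ 'n) R \<times> (sphere (0 :: real ^ 'n) 1 \<times> sphere (0 :: real ^ 'n) 1) \<inter> {z. fst (snd z) \<bullet> snd (snd z) = 0}"
    have "closed {z :: (real ^ 'n) \<times> ((real ^ 'n) \<times> (real ^ 'n)). fst (snd z) \<bullet> snd (snd z) = 0}"
      by (intro closed_Collect_eq continuous_intros)
    then have "compact T" unfolding T_def by (intro compact_Int_closed compact_Times compact_cball compact_sphere)
    show thesis
    proof (cases "T = {}")
      \<comment> \<open>There may be nothing to bound, for instance when \<open>R\<close> is
        negative; then any positive \<open>\<delta>\<close> will do.\<close>
      case True
      show thesis
      proof (rule that[of 1])
        fix x e f :: "real ^ 'n" assume "norm x \<le> R" "norm e = 1" "norm f = 1" "e \<bullet> f = 0"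
        then have "(x, e, f) \<in> T" by (simp add: T_def)
        then show "1 \<le> e \<bullet> (?H x *v e) + f \<bullet> (?H x *v f)" using True by blast
      qed simp
    next
      case False
      have "continuous_on T (\<lambda>z. fst (snd z) \<bullet> (?H (fst z) *v fst (snd z)) + snd (snd z) \<bullet> (?H (fst z) *v snd (snd z)))"
        by (intro continuous_on_add continuous_on_inner continuous_on_prod_hess_mult_vec
            continuous_on_fst continuous_on_snd continuous_on_id)
      from continuous_attains_inf[OF \<open>compact T\<close> False this]
      obtain z where z: "z \<in> T" and mn: "\<And>y. y \<in> T \<Longrightarrow> fst (snd z) \<bullet> (?H (fst z) *v fst (snd z)) + snd (snd z) \<bullet> (?H (fst z) *v snd (snd z))
         \<le> fst (snd y) \<bullet> (?H (fst y) *v fst (snd y)) + snd (snd y) \<bullet> (?H (fst y) *v snd (snd y))" by blast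
      show thesis
      proof (rule that)
        show "0 < fst (snd z) \<bullet> (?H (fst z) *v fst (snd z)) + snd (snd z) \<bullet> (?H (fst z) *v snd (snd z))"
          using z by (intro tr) (auto simp: T_def)
        show "fst (snd z) \<bullet> (?H (fst z) *v fst (snd z)) + snd (snd z) \<bullet> (?H (fst z) *v snd (snd z))
          \<le> e \<bullet> (?H x *v e) + f \<bullet> (?H x *v f)" if "norm x \<le> R" "norm e = 1" "norm f = 1" "e \<bullet> f = 0" for x e f
          using mn[of "(x, e, f)"] that by (simp add: T_def)
      qed
    qed
  qed
  have "compact ((\<lambda>z. ?H (fst z) *v snd z) ` (cball 0 R \<times> sphere 0 1))"
    by (intro compact_continuous_image continuous_on_prod_hess_mult_vec continuous_on_fst continuous_on_snd
        continuous_on_id compact_Times compact_cball compact_sphere)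
  from compact_imp_bounded[OF this, unfolded bounded_pos]
  obtain C where C: "C > 0" and "\<forall>y\<in>(\<lambda>z. ?H (fst z) *v snd z) ` (cball 0 R \<times> sphere 0 1). norm y \<le> C"
    by blast
  have Cb: "norm (?H x *v e) \<le> C" if "norm x \<le> R" "norm e = 1" for x e
  proof -
    have "?H x *v e \<in> (\<lambda>z. ?H (fst z) *v snd z) ` (cball 0 R \<times> sphere 0 1)"
      by (rule image_eqI[of _ _ "(x, e)"]) (use that in auto)
    then show ?thesis using \<open>\<forall>y\<in>_. norm y \<le> C\<close> by blast
  qed
  define P where "P = 6 * C^2 + 4 * C^3 + C^4"
  have P: "P > 0" using C unfolding P_def by (intro add_pos_pos) auto
  \<comment> \<open>The bounds 1 and \<open>\<delta> / P\<close> are the conditions of the descent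
    estimate; \<open>1 / \<delta>\<close> keeps the factor \<open>1 - \<eta> * \<delta>\<close>
    nonnegative.\<close>
  show thesis
  proof (rule that[of "min 1 (min (\<delta> / P) (1 / \<delta>))"])
    show "min 1 (min (\<delta> / P) (1 / \<delta>)) > 0" using P \<delta>(1) by simp
    fix \<eta> assume \<eta>: "0 < \<eta>" "\<eta> \<le> min 1 (min (\<delta> / P) (1 / \<delta>))"
    have "\<eta> \<le> \<delta> / P" "\<eta> \<le> 1 / \<delta>" using \<eta>(2) by auto
    then have \<eta>P: "\<eta> * P \<le> \<delta>" and \<eta>\<delta>: "\<eta> * \<delta> \<le> 1"
      using P \<delta>(1) by (simp_all add: pos_le_divide_eq)
    show "\<exists>q. 0 \<le> q \<and> q < 1 \<and> (\<forall>x a b. norm (x :: real ^ 'n) \<le> R \<longrightarrow>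
      sq_area (a - \<eta> *\<^sub>R (?H x *v a)) (b - \<eta> *\<^sub>R (?H x *v b)) \<le> q * sq_area a b)"
    proof (intro exI[of _ "1 - \<eta> * \<delta>"] conjI allI impI)
      fix x a b :: "real ^ 'n" assume x: "norm x \<le> R"
      show "sq_area (a - \<eta> *\<^sub>R (?H x *v a)) (b - \<eta> *\<^sub>R (?H x *v b)) \<le> (1 - \<eta> * \<delta>) * sq_area a b"
      proof (rule sq_area_contraction_from_orthonormal[where M="\<lambda>a. a - \<eta> *\<^sub>R (?H x *v a)"])
        show "linear (\<lambda>a. a - \<eta> *\<^sub>R (?H x *v a))"
          by (intro linear_compose_sub linear_ident linear_compose_scale_right matrix_vector_mul_linear)
        fix e f :: "real ^ 'n" assume ef: "norm e = 1" "norm f = 1" "e \<bullet> f = 0"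
        show "sq_area (e - \<eta> *\<^sub>R (?H x *v e)) (f - \<eta> *\<^sub>R (?H x *v f)) \<le> 1 - \<eta> * \<delta>"
          by (rule sq_area_descent_step[OF ef Cb[OF x ef(1)] Cb[OF x ef(2)] \<delta>(2)[OF x ef]])
             (use \<eta> \<eta>P in \<open>simp_all only: P_def min.bounded_iff\<close>)
      qed (use \<eta>\<delta> in simp)
    qed (use \<eta>\<delta> mult_pos_pos[OF \<eta>(1) \<delta>(1)] in simp_all)
  qed
qed

lemma almost_primitive_on_critical_curves:
  fixes w :: "'i \<Rightarrow> real ^ 'n" and \<psi> :: "real ^ 'n \<Rightarrow> real" and v :: "real ^ 'n"
  assumes J: "finite J" "J \<noteq> {}"
    and tr: "\<And>(x :: real ^ 'n) e f. norm e = 1 \<Longrightarrow> norm f = 1 \<Longrightarrow> e \<bullet> f = 0 \<Longrightarrow>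
      0 < e \<bullet> (prod_hess w J x *v e) + f \<bullet> (prod_hess w J x *v f)"
    and \<psi>: "continuous_on UNIV \<psi>" and e: "e > 0"
  shows "\<exists>K. \<forall>S c c'. C1_curve_in {x. prod_grad w J x = 0} S c c' \<longrightarrow> (\<forall>t\<in>S. \<exists>k.
      ((\<lambda>s. K (c s)) has_real_derivative k) (at t) \<and> \<bar>k - \<psi> (c t) * (v \<bullet> c' t)\<bar> \<le> e * norm (c' t))"
proof -
  obtain R where R: "R > 0" "\<And>j. j \<in> J \<Longrightarrow> norm (w j) < R / 2" "\<And>x. prod_grad w J x = 0 \<Longrightarrow> norm (x :: real ^ 'n) < R / 2"
    using prod_grad_zeros_bounded[of J w, OF J] by blast
  obtain \<eta>0 where \<eta>0: "\<eta>0 > 0" "\<And>\<eta> x. 0 < \<eta> \<Longrightarrow> \<eta> \<le> \<eta>0 \<Longrightarrow> norm (x :: real ^ 'n) \<le> R \<Longrightarrow> norm (x - \<eta> *\<^sub>R prod_grad w J x) \<le> R"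
    using gradient_step_preserves_ball[of J R w, OF J R(1,2)] by blast
  obtain \<eta>1 where \<eta>1: "\<eta>1 > 0" "\<And>\<eta>. 0 < \<eta> \<Longrightarrow> \<eta> \<le> \<eta>1 \<Longrightarrow>
    \<exists>q. 0 \<le> q \<and> q < 1 \<and> (\<forall>x a b. norm (x :: real ^ 'n) \<le> R \<longrightarrow>
      sq_area (a - \<eta> *\<^sub>R (prod_hess w J x *v a)) (b - \<eta> *\<^sub>R (prod_hess w J x *v b)) \<le> q * sq_area a b)"
    using gradient_step_contracts_area[of w J R] tr by blast
  define \<eta> where "\<eta> = min \<eta>0 \<eta>1"
  have \<eta>: "0 < \<eta>" "\<eta> \<le> \<eta>0" "\<eta> \<le> \<eta>1" using \<eta>0(1) \<eta>1(1) by (auto simp: \<eta>_def)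
  obtain q where q: "0 \<le> q" "q < 1" and area: "\<And>x a b. norm (x :: real ^ 'n) \<le> R \<Longrightarrow>
      sq_area (a - \<eta> *\<^sub>R (prod_hess w J x *v a)) (b - \<eta> *\<^sub>R (prod_hess w J x *v b)) \<le> q * sq_area a b"
    using \<eta>1(2)[OF \<eta>(1,3)] by blast
  define \<phi> where "\<phi> x = x - \<eta> *\<^sub>R prod_grad w J x" for x :: "real ^ 'n"
  define D\<phi> where "D\<phi> x h = h - \<eta> *\<^sub>R (prod_hess w J x *v h)" for x h :: "real ^ 'n"
  define Z where "Z = {x :: real ^ 'n. prod_grad w J x = 0}"
  have poly: "polynomial_function \<phi>"
    unfolding \<phi>_def by (intro polynomial_function_diff polynomial_function_cmul polynomial_function_id prod_grad_polynomial_function J)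
  have D: "(\<phi> has_derivative D\<phi> x) (at x)" for x
    unfolding \<phi>_def D\<phi>_def by (intro derivative_intros prod_grad_has_derivative)
  have B: "\<phi> ` cball 0 R \<subseteq> cball 0 R" using \<eta>0(2)[OF \<eta>(1,2)] by (auto simp: \<phi>_def)
  have area': "sq_area (D\<phi> x a) (D\<phi> x b) \<le> q * sq_area a b" if "x \<in> cball 0 R" for x a b
    using area[of x a b] that by (simp add: D\<phi>_def)
  have ZR: "Z \<subseteq> cball 0 R" 
  proof
    fix x assume "x \<in> Z"
    then show "x \<in> cball 0 R" using R(3)[of x] R(1) by (simp add: Z_def)
  qed
  have fix\<phi>: "\<phi> x = x" if "x \<in> Z" for x using that by (simp add: Z_def \<phi>_def)
  show ?thesis
    unfolding Z_def[symmetric]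
    by (rule almost_primitive_on_fixed_curves[OF poly D B q area' ZR fix\<phi> continuous_on_subset[OF \<psi> subset_UNIV] e])
qed

section \<open>Compact sets with arc charts\<close>

definition lip_path :: "'a::metric_space set \<Rightarrow> 'a \<Rightarrow> 'a \<Rightarrow> real \<Rightarrow> (real \<Rightarrow> 'a) \<Rightarrow> bool" where
  "lip_path W x y T g \<longleftrightarrow> 0 \<le> T \<and> g ` {0..T} \<subseteq> W \<and> g 0 = x \<and> g T = y \<and>
     (\<forall>s\<in>{0..T}. \<forall>t\<in>{0..T}. dist (g s) (g t) \<le> \<bar>s - t\<bar>)"

lemma lip_path_join:
  assumes g: "lip_path W x y T g" and h: "lip_path W y z U h"
  shows "lip_path W x z (T + U) (\<lambda>s. if s \<le> T then g s else h (s - T))"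
proof -
  have TU: "0 \<le> T" "0 \<le> U" and yT: "g T = y" "h 0 = y" using g h by (auto simp: lip_path_def)
  have gL: "dist (g s) (g t) \<le> \<bar>s - t\<bar>" if "s \<in> {0..T}" "t \<in> {0..T}" for s t
    using g that by (simp add: lip_path_def)
  have hL: "dist (h s) (h t) \<le> \<bar>s - t\<bar>" if "s \<in> {0..U}" "t \<in> {0..U}" for s t
    using h that by (simp add: lip_path_def)
  have mixed: "dist (g s) (h (t - T)) \<le> t - s" if "0 \<le> s" "s \<le> T" "T < t" "t \<le> T + U" for s t
  proof -
    have "dist (g s) (h (t - T)) \<le> dist (g s) (g T) + dist (h 0) (h (t - T))"
      using yT dist_triangle by metis
    also have "\<dots> \<le> \<bar>s - T\<bar> + \<bar>0 - (t - T)\<bar>"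
      by (intro add_mono gL hL) (use that TU in auto)
    finally show ?thesis using that by simp
  qed
  let ?k = "\<lambda>s. if s \<le> T then g s else h (s - T)"
  have L: "dist (?k s) (?k t) \<le> \<bar>s - t\<bar>" if st: "s \<in> {0..T + U}" "t \<in> {0..T + U}" for s t
  proof -
    consider "s \<le> T" "t \<le> T" | "s \<le> T" "T < t" | "T < s" "t \<le> T" | "T < s" "T < t" by linarith
    then show ?thesis
    proof cases
      case 1
      then show ?thesis using gL[of s t] st by simp
    next
      case 2
      then show ?thesis using mixed[of s t] st by simp
    next
      case 3
      then show ?thesis using mixed[of t s] st by (simp add: dist_commute)
    next
      case 4
      then show ?thesis using hL[of "s - T" "t - T"] st by simp
    qed
  qed
  have im: "?k ` {0..T + U} \<subseteq> W"
  proof (rule image_subsetI)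
    fix s assume "s \<in> {0..T + U}"
    then have "s \<le> T \<longrightarrow> s \<in> {0..T}" "\<not> s \<le> T \<longrightarrow> s - T \<in> {0..U}" by auto
    then show "?k s \<in> W" using g h unfolding lip_path_def by (metis image_subset_iff)
  qed
  have ends: "?k 0 = x" "?k (T + U) = z"
    using g h TU yT by (auto simp: lip_path_def)
  show ?thesis unfolding lip_path_def using L im ends TU by auto
qed

lemma lip_path_restrict:
  assumes "lip_path W x y T g" "0 \<le> s" "s \<le> T"
  shows "lip_path W x (g s) s g"
  using assms unfolding lip_path_def by auto

text \<open>The parameter is the coordinate along the unit vector \<open>v\<close>; this makes
  \<open>c\<close> injective and gives \<open>\<bar>t\<bar> \<le> dist (c t) p\<close>. The bound 2
  leaves room above the speed 1 that the critical curves have at their centre.\<close>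

definition arc_chart :: "'a::real_inner set \<Rightarrow> 'a \<Rightarrow> 'a \<Rightarrow> real \<Rightarrow> (real \<Rightarrow> 'a) \<Rightarrow> (real \<Rightarrow> 'a) \<Rightarrow> bool" where
  "arc_chart W p v \<epsilon> c c' \<longleftrightarrow> 0 < \<epsilon> \<and> norm v = 1 \<and> c 0 = p \<and> C1_curve_in W {-\<epsilon><..<\<epsilon>} c c' \<and>
     (\<forall>t\<in>{-\<epsilon><..<\<epsilon>}. v \<bullet> (c t - p) = t \<and> norm (c' t) \<le> 2) \<and>
     (\<exists>\<rho>>0. \<forall>y\<in>W. dist y p < \<rho> \<longrightarrow> (\<exists>t\<in>{-\<epsilon><..<\<epsilon>}. y = c t))"

lemma arc_chart_lipschitz:
  assumes "arc_chart W p v \<epsilon> c c'" "s \<in> {-\<epsilon><..<\<epsilon>}" "t \<in> {-\<epsilon><..<\<epsilon>}"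
  shows "dist (c s) (c t) \<le> 2 * \<bar>s - t\<bar>"
proof -
  have "norm (c s - c t) \<le> 2 * norm (s - t)"
  proof (rule differentiable_bound[where S="{-\<epsilon><..<\<epsilon>}" and f'="\<lambda>t h. h *\<^sub>R c' t"])
    fix r assume r: "r \<in> {-\<epsilon><..<\<epsilon>}"
    then show "(c has_derivative (\<lambda>h. h *\<^sub>R c' r)) (at r within {-\<epsilon><..<\<epsilon>})"
      using assms(1) by (auto simp: arc_chart_def C1_curve_in_def has_vector_derivative_def has_derivative_at_withinI)
    have "norm (c' r) \<le> 2" using assms(1) r by (simp add: arc_chart_def)
    then show "onorm (\<lambda>h. h *\<^sub>R c' r) \<le> 2"
      by (intro onorm_le) (simp add: mult.commute mult_left_mono)
  qed (use assms in auto)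
  then show ?thesis by (simp add: dist_norm)
qed

lemma arc_chart_lip_path:
  assumes ch: "arc_chart W p v \<epsilon> c c'" and st: "s \<in> {-\<epsilon><..<\<epsilon>}" "t \<in> {-\<epsilon><..<\<epsilon>}"
  shows "\<exists>g. lip_path W (c s) (c t) (2 * \<bar>s - t\<bar>) g"
proof (intro exI)
  \<comment> \<open>Running through the parameter interval at half speed turns the Lipschitz
    constant 2 into 1; \<open>sgn 0 = 0\<close> covers the case \<open>s = t\<close>.\<close>
  define \<sigma> :: real where "\<sigma> = sgn (t - s)"
  have in_I: "s + \<sigma> * u / 2 \<in> {-\<epsilon><..<\<epsilon>}" if "u \<in> {0..2 * \<bar>s - t\<bar>}" for u
    using that st unfolding \<sigma>_def by (cases "t < s"; cases "t = s") auto
  have \<sigma>: "\<bar>\<sigma>\<bar> \<le> 1" by (simp add: \<sigma>_def abs_sgn_eq)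
  have L: "dist (c (s + \<sigma> * u / 2)) (c (s + \<sigma> * u' / 2)) \<le> \<bar>u - u'\<bar>"
    if "u \<in> {0..2 * \<bar>s - t\<bar>}" "u' \<in> {0..2 * \<bar>s - t\<bar>}" for u u'
  proof -
    have "dist (c (s + \<sigma> * u / 2)) (c (s + \<sigma> * u' / 2)) \<le> 2 * \<bar>(s + \<sigma> * u / 2) - (s + \<sigma> * u' / 2)\<bar>"
      by (rule arc_chart_lipschitz[OF ch in_I[OF that(1)] in_I[OF that(2)]])
    also have "(s + \<sigma> * u / 2) - (s + \<sigma> * u' / 2) = \<sigma> * ((u - u') / 2)" by (simp add: field_simps)
    also have "2 * \<bar>\<sigma> * ((u - u') / 2)\<bar> = \<bar>\<sigma>\<bar> * \<bar>u - u'\<bar>" by (simp add: abs_mult)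
    also have "\<dots> \<le> 1 * \<bar>u - u'\<bar>" by (rule mult_right_mono[OF \<sigma>]) simp
    finally show ?thesis by simp
  qed
  have im: "(\<lambda>u. c (s + \<sigma> * u / 2)) ` {0..2 * \<bar>s - t\<bar>} \<subseteq> W"
    using ch in_I by (fastforce simp: arc_chart_def C1_curve_in_def)
  have "\<sigma> * \<bar>s - t\<bar> = t - s" unfolding \<sigma>_def by (simp add: sgn_if)
  then show "lip_path W (c s) (c t) (2 * \<bar>s - t\<bar>) (\<lambda>u. c (s + \<sigma> * u / 2))"
    unfolding lip_path_def using L im by auto
qed

lemma arc_chart_local_paths:
  assumes ch: "arc_chart W p v \<epsilon> c c'"
  obtains \<rho> where "\<rho> > 0" "\<And>y. y \<in> W \<Longrightarrow> dist y p < \<rho> \<Longrightarrow>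
     \<exists>T g h. T \<le> 2 * dist y p \<and> lip_path W p y T g \<and> lip_path W y p T h"
proof -
  obtain \<rho> where \<rho>: "\<rho> > 0" "\<And>y. y \<in> W \<Longrightarrow> dist y p < \<rho> \<Longrightarrow> \<exists>t\<in>{-\<epsilon><..<\<epsilon>}. y = c t"
    using ch unfolding arc_chart_def by blast
  show thesis
  proof (rule that[OF \<rho>(1)])
    fix y assume "y \<in> W" "dist y p < \<rho>"
    then obtain t where t: "t \<in> {-\<epsilon><..<\<epsilon>}" "y = c t" using \<rho>(2) by blast
    have z: "0 \<in> {-\<epsilon><..<\<epsilon>}" "c 0 = p" using ch by (auto simp: arc_chart_def)
    have "\<bar>t\<bar> = \<bar>v \<bullet> (y - p)\<bar>" using ch t by (simp add: arc_chart_def)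
    also have "\<dots> \<le> norm v * norm (y - p)" by (rule Cauchy_Schwarz_ineq2)
    finally have "2 * \<bar>t\<bar> \<le> 2 * dist y p" using ch by (simp add: arc_chart_def dist_norm)
    moreover obtain g where "lip_path W p y (2 * \<bar>t\<bar>) g"
      using arc_chart_lip_path[OF ch z(1) t(1)] z(2) t(2) by auto
    moreover obtain h where "lip_path W y p (2 * \<bar>t\<bar>) h"
      using arc_chart_lip_path[OF ch t(1) z(1)] z(2) t(2) by auto
    ultimately show "\<exists>T g h. T \<le> 2 * dist y p \<and> lip_path W p y T g \<and> lip_path W y p T h" by blast
  qed
qed

text \<open>\<open>loc\<close> makes \<open>K\<close> closed in \<open>W\<close>. Without a maximum
  every point of \<open>W\<close> would have a neighbourhood where \<open>d\<close> stays below
  \<open>d (z x)\<close> for some \<open>z x\<close> in \<open>K\<close>. In a finite subcover the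
  largest of these values would lie strictly below another one.\<close>

lemma upper_semicontinuous_attains_max:
  fixes d :: "'a::metric_space \<Rightarrow> real"
  assumes W: "compact W" and K: "K \<subseteq> W" "K \<noteq> {}"
    and loc: "\<And>x. x \<in> W \<Longrightarrow> x \<notin> K \<Longrightarrow> \<exists>\<rho>>0. \<forall>y\<in>K. \<rho> \<le> dist y x"
    and usc: "\<And>x b. x \<in> K \<Longrightarrow> d x < b \<Longrightarrow> \<exists>\<rho>>0. \<forall>y\<in>K. dist y x < \<rho> \<longrightarrow> d y < b"
  shows "\<exists>q\<in>K. \<forall>y\<in>K. d y \<le> d q"
proof (rule ccontr)
  assume no: "\<not> (\<exists>q\<in>K. \<forall>y\<in>K. d y \<le> d q)"
  obtain p0 where p0: "p0 \<in> K" using K by blast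
  have "\<forall>x\<in>W. \<exists>\<rho> z. \<rho> > 0 \<and> z \<in> K \<and> (\<forall>y\<in>K. dist y x < \<rho> \<longrightarrow> d y < d z)"
  proof
    fix x assume x: "x \<in> W"
    show "\<exists>\<rho> z. \<rho> > 0 \<and> z \<in> K \<and> (\<forall>y\<in>K. dist y x < \<rho> \<longrightarrow> d y < d z)"
    proof (cases "x \<in> K")
      case True
      then obtain z where "z \<in> K" "d x < d z" using no by force
      then show ?thesis using usc[OF True] by blast
    next
      case False
      then show ?thesis using loc[OF x False] p0 by (meson not_le)
    qed
  qed
  then obtain \<rho> z where \<rho>: "\<And>x. x \<in> W \<Longrightarrow> \<rho> x > 0" and z: "\<And>x. x \<in> W \<Longrightarrow> z x \<in> K"
    and dz: "\<And>x y. x \<in> W \<Longrightarrow> y \<in> K \<Longrightarrow> dist y x < \<rho> x \<Longrightarrow> d y < d (z x)"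
    by metis
  obtain F where F: "F \<subseteq> W" "finite F" "W \<subseteq> (\<Union>x\<in>F. ball x (\<rho> x))"
    using compactE_image[OF W, of W "\<lambda>x. ball x (\<rho> x)"] \<rho> by (metis (no_types, lifting) UN_iff centre_in_ball open_ball subsetI)
  have "F \<noteq> {}" using F p0 K by auto
  define m where "m = Max ((\<lambda>x. d (z x)) ` F)"
  obtain x where x: "x \<in> F" "d (z x) = m"
  proof -
    have "m \<in> (\<lambda>x. d (z x)) ` F" unfolding m_def using F \<open>F \<noteq> {}\<close> by (intro Max_in) auto
    then show thesis using that by blast
  qed
  have "z x \<in> K" using z x F by blast
  then obtain x' where x': "x' \<in> F" "z x \<in> ball x' (\<rho> x')" using F K by blast
  have "d (z x) < d (z x')"
    using dz[of x' "z x"] x' F \<open>z x \<in> K\<close> by (auto simp: dist_commute)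
  moreover have "d (z x') \<le> m" unfolding m_def using F x' by (intro Max_ge) auto
  ultimately show False using x by simp
qed

text \<open>A point at maximal intrinsic distance from \<open>p\<close> does not separate its neighbours from \<open>p\<close>:
  nearly shortest paths from \<open>p\<close> to the neighbours cannot run through it.\<close>

lemma non_cut_point_exists:
  fixes W :: "'a::real_inner set"
  assumes W: "compact W" "p0 \<in> W" and charts: "\<And>p. p \<in> W \<Longrightarrow> \<exists>v \<epsilon> c c'. arc_chart W p v \<epsilon> c c'"
  obtains q where "q \<in> W" "\<And>v \<epsilon> c c' t. arc_chart W q v \<epsilon> c c' \<Longrightarrow> t \<in> {-\<epsilon><..<\<epsilon>} \<Longrightarrow> t \<noteq> 0 \<Longrightarrow>
     \<exists>T g. lip_path W p0 (c t) T g \<and> q \<notin> g ` {0..T}"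
proof -
  define K where "K = {x. \<exists>T g. lip_path W p0 x T g}"
  define d where "d x = Inf {T. \<exists>g. lip_path W p0 x T g}" for x
  have bdd: "bdd_below {T. \<exists>g. lip_path W p0 x T g}" for x
    by (rule bdd_belowI[of _ 0]) (auto simp: lip_path_def)
  have d_le: "d x \<le> T" if "lip_path W p0 x T g" for x T g
    unfolding d_def using that by (intro cInf_lower bdd) auto
  have d_less: "\<exists>T g. T < b \<and> lip_path W p0 x T g" if "x \<in> K" "d x < b" for x b
    using that cInf_less_iff[OF _ bdd, of x b] unfolding d_def K_def by blast
  have KW: "K \<subseteq> W" unfolding K_def lip_path_def by auto
  have p0K: "p0 \<in> K" unfolding K_def
    by (intro CollectI exI[of _ 0] exI[of _ "\<lambda>_. p0"]) (use W in \<open>simp add: lip_path_def\<close>)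
  have near: "\<exists>\<rho>>0. \<forall>y\<in>W. dist y x < \<rho> \<longrightarrow> (\<exists>T g h. T \<le> 2 * dist y x \<and> lip_path W x y T g \<and> lip_path W y x T h)"
    if x: "x \<in> W" for x
    using charts[OF x] arc_chart_local_paths by metis
  have "\<exists>q\<in>K. \<forall>y\<in>K. d y \<le> d q"
  proof (rule upper_semicontinuous_attains_max[OF W(1) KW])
    show "K \<noteq> {}" using p0K by blast
    fix x assume x: "x \<in> W" "x \<notin> K"
    obtain \<rho> where \<rho>: "\<rho> > 0" "\<And>y. y \<in> W \<Longrightarrow> dist y x < \<rho> \<Longrightarrow> \<exists>T h. lip_path W y x T h"
      using near[OF x(1)] by blast
    show "\<exists>\<rho>>0. \<forall>y\<in>K. \<rho> \<le> dist y x"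
    proof (intro exI[of _ \<rho>] conjI ballI \<rho>(1))
      fix y assume y: "y \<in> K"
      show "\<rho> \<le> dist y x"
      proof (rule ccontr)
        assume "\<not> \<rho> \<le> dist y x"
        then obtain T h where "lip_path W y x T h" using \<rho>(2)[of y] y KW by force
        moreover obtain U g where "lip_path W p0 y U g" using y by (auto simp: K_def)
        ultimately have "x \<in> K" using lip_path_join unfolding K_def by blast
        then show False using x by simp
      qed
    qed
  next
    fix x b assume x: "x \<in> K" "d x < b"
    obtain \<rho> where \<rho>: "\<rho> > 0" "\<And>y. y \<in> W \<Longrightarrow> dist y x < \<rho> \<Longrightarrow> \<exists>T g. T \<le> 2 * dist y x \<and> lip_path W x y T g"
      using near[of x] x KW by blast
    obtain U g where U: "U < b" "lip_path W p0 x U g" using d_less[OF x] by blast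
    \<comment> \<open>Prolonging a path to \<open>x\<close> of length \<open>U < b\<close> to a
      nearby \<open>y\<close> costs at most \<open>2 * dist y x\<close>, which must fit into the
      slack \<open>b - U\<close>.\<close>
    show "\<exists>\<rho>>0. \<forall>y\<in>K. dist y x < \<rho> \<longrightarrow> d y < b"
    proof (intro exI[of _ "min \<rho> ((b - U) / 2)"] conjI ballI impI)
      show "min \<rho> ((b - U) / 2) > 0" using \<rho> U by simp
      fix y assume y: "y \<in> K" "dist y x < min \<rho> ((b - U) / 2)"
      then obtain T h where T: "T \<le> 2 * dist y x" "lip_path W x y T h" using \<rho>(2)[of y] KW by auto
      have "d y \<le> U + T" by (rule d_le[OF lip_path_join[OF U(2) T(2)]])
      then show "d y < b" using T(1) y(2) by simp
    qed
  qed
  then obtain q where q: "q \<in> K" "\<And>y. y \<in> K \<Longrightarrow> d y \<le> d q" by blast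
  show thesis
  proof (rule that)
    show "q \<in> W" using q KW by blast
    fix v \<epsilon> c c' and t :: real
    assume ch: "arc_chart W q v \<epsilon> c c'" and t: "t \<in> {-\<epsilon><..<\<epsilon>}" "t \<noteq> 0"
    have z: "0 \<in> {-\<epsilon><..<\<epsilon>}" "c 0 = q" using ch by (auto simp: arc_chart_def)
    obtain U h where "lip_path W q (c t) U h" using arc_chart_lip_path[OF ch z(1) t(1)] z(2) by auto
    moreover obtain V k where "lip_path W p0 q V k" using q(1) by (auto simp: K_def)
    ultimately have ctK: "c t \<in> K" using lip_path_join unfolding K_def by blast
    \<comment> \<open>A path through \<open>q\<close> needs at least \<open>d q\<close> to reach
      \<open>q\<close> and at least \<open>\<bar>t\<bar>\<close> from there to \<open>c t\<close>.
      As \<open>d\<close> is maximal at \<open>q\<close>, some path to \<open>c t\<close> is shorter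
      than this.\<close>
    have "d (c t) < d q + \<bar>t\<bar>" using q(2)[OF ctK] t(2) by simp
    then obtain T g where T: "T < d q + \<bar>t\<bar>" and g: "lip_path W p0 (c t) T g" using d_less[OF ctK] by blast
    have "q \<notin> g ` {0..T}"
    proof
      assume "q \<in> g ` {0..T}"
      then obtain s where s: "0 \<le> s" "s \<le> T" "g s = q" by auto
      have "d q \<le> s" using d_le[OF lip_path_restrict[OF g s(1,2)]] s(3) by simp
      have "\<bar>t\<bar> = \<bar>v \<bullet> (c t - q)\<bar>" using ch t by (simp add: arc_chart_def)
      also have "\<dots> \<le> norm v * norm (c t - q)" by (rule Cauchy_Schwarz_ineq2)
      also have "\<dots> = dist (g T) (g s)" using ch g s by (simp add: arc_chart_def lip_path_def dist_norm)
      also have "\<dots> \<le> \<bar>T - s\<bar>" 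
      proof -
        have "s \<in> {0..T}" "T \<in> {0..T}" using s by auto
        then show ?thesis using g unfolding lip_path_def by blast
      qed
      finally show False using T \<open>d q \<le> s\<close> s by simp
    qed
    then show "\<exists>T g. lip_path W p0 (c t) T g \<and> q \<notin> g ` {0..T}" using g by blast
  qed
qed

text \<open>Bolzano bisection: increments over adjacent intervals add up. The local estimate
  compares with the value at \<open>s\<close> only, which fits the intervals around a point that
  bisection produces.\<close>

lemma lipschitz_from_local:
  fixes h :: "real \<Rightarrow> real"
  assumes T: "0 \<le> T"
    and loc: "\<And>s. 0 \<le> s \<Longrightarrow> s \<le> T \<Longrightarrow> \<exists>d>0. \<forall>t. 0 \<le> t \<and> t \<le> T \<and> \<bar>t - s\<bar> < d \<longrightarrow> \<bar>h t - h s\<bar> \<le> L * \<bar>t - s\<bar>"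
  shows "\<bar>h T - h 0\<bar> \<le> L * T"
proof -
  define P where "P a b \<longleftrightarrow> (0 \<le> a \<longrightarrow> b \<le> T \<longrightarrow> \<bar>h b - h a\<bar> \<le> L * (b - a))" for a b
  from T have "P 0 T"
  proof (induction rule: Bolzano)
    case (trans a b c)
    show ?case unfolding P_def
    proof (intro impI)
      assume "0 \<le> a" "c \<le> T"
      then have "\<bar>h b - h a\<bar> \<le> L * (b - a)" "\<bar>h c - h b\<bar> \<le> L * (c - b)" using trans by (auto simp: P_def)
      then show "\<bar>h c - h a\<bar> \<le> L * (c - a)" by (simp add: right_diff_distrib)
    qed
  next
    case (local x)
    obtain d where d: "d > 0" "\<And>t. 0 \<le> t \<Longrightarrow> t \<le> T \<Longrightarrow> \<bar>t - x\<bar> < d \<Longrightarrow> \<bar>h t - h x\<bar> \<le> L * \<bar>t - x\<bar>"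
      using loc[OF local] by blast
    show ?case
    proof (intro exI[of _ d] conjI allI impI d(1))
      fix a b assume ab: "a \<le> x \<and> x \<le> b \<and> b - a < d"
      show "P a b" unfolding P_def
      proof (intro impI)
        assume "0 \<le> a" "b \<le> T"
        then have "\<bar>h a - h x\<bar> \<le> L * \<bar>a - x\<bar>" "\<bar>h b - h x\<bar> \<le> L * \<bar>b - x\<bar>"
          using ab local by (intro d(2); linarith)+
        moreover have "\<bar>a - x\<bar> = x - a" "\<bar>b - x\<bar> = b - x" using ab by auto
        ultimately have "\<bar>h a - h x\<bar> \<le> L * (x - a)" "\<bar>h b - h x\<bar> \<le> L * (b - x)" by simp_all
        then show "\<bar>h b - h a\<bar> \<le> L * (b - a)" by (simp add: right_diff_distrib)
      qed
    qed
  qed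
  then show ?thesis using T by (simp add: P_def)
qed

text \<open>The 1-forms are functions times a constant covector. That a single \<open>K\<close>
  serves all curves in the set replaces the statement that integrals around closed curves
  vanish.\<close>

definition all_forms_almost_exact :: "'a::real_inner set \<Rightarrow> bool" where
  "all_forms_almost_exact W \<longleftrightarrow> (\<forall>\<psi> v e. continuous_on UNIV \<psi> \<longrightarrow> e > 0 \<longrightarrow>
     (\<exists>K. \<forall>S c c'. C1_curve_in W S c c' \<longrightarrow> (\<forall>t\<in>S. \<exists>k.
      ((\<lambda>s. K (c s)) has_real_derivative k) (at t) \<and> \<bar>k - \<psi> (c t) * (v \<bullet> c' t)\<bar> \<le> e * norm (c' t))))"

section \<open>The jump of an almost primitive at a non-cut point\<close>

lemma DERIV_increment_ge:
  fixes h :: "real \<Rightarrow> real"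
  assumes "a \<le> b" and "\<And>t. a \<le> t \<Longrightarrow> t \<le> b \<Longrightarrow> \<exists>k. (h has_real_derivative k) (at t) \<and> m \<le> k"
  shows "m * (b - a) \<le> h b - h a"
proof -
  have "((\<lambda>t. h t - m * t) has_real_derivative k - m) (at t)" if "(h has_real_derivative k) (at t)" for k t
    using that by (auto intro!: derivative_eq_intros)
  then have "h a - m * a \<le> h b - m * b"
    using assms by (intro DERIV_nonneg_imp_nondecreasing[of a b "\<lambda>t. h t - m * t"]) (force simp: le_diff_eq)+
  then show ?thesis by (simp add: right_diff_distrib)
qed

lemma abs_increment_le:
  fixes h :: "real \<Rightarrow> real"
  assumes "\<And>t. \<bar>t\<bar> \<le> \<bar>b\<bar> \<Longrightarrow> \<exists>k. (h has_real_derivative k) (at t) \<and> \<bar>k\<bar> \<le> L"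
  shows "\<bar>h b - h 0\<bar> \<le> L * \<bar>b\<bar>"
proof (cases "0 \<le> b")
  case True
  have "-L * (b - 0) \<le> h b - h 0"
    by (rule DERIV_increment_ge[OF True]) (use assms True in \<open>force simp: abs_le_iff\<close>)
  moreover have "-L * (b - 0) \<le> (\<lambda>t. - h t) b - (\<lambda>t. - h t) 0"
  proof (rule DERIV_increment_ge[OF True])
    fix t assume "0 \<le> t" "t \<le> b"
    then obtain k where "(h has_real_derivative k) (at t)" "\<bar>k\<bar> \<le> L" using assms[of t] by auto
    then show "\<exists>k. ((\<lambda>t. - h t) has_real_derivative k) (at t) \<and> -L \<le> k"
      by (intro exI[of _ "- k"]) (auto intro: DERIV_minus)
  qed
  ultimately show ?thesis using True by simp
next
  case False
  then have b: "b \<le> 0" by simp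
  have "-L * (0 - b) \<le> h 0 - h b"
  proof (rule DERIV_increment_ge[OF b])
    fix t assume "b \<le> t" "t \<le> 0"
    then obtain k where "(h has_real_derivative k) (at t)" "\<bar>k\<bar> \<le> L" using assms[of t] by auto
    then show "\<exists>k. (h has_real_derivative k) (at t) \<and> -L \<le> k" by auto
  qed
  moreover have "-L * (0 - b) \<le> (\<lambda>t. - h t) 0 - (\<lambda>t. - h t) b"
  proof (rule DERIV_increment_ge[OF b])
    fix t assume "b \<le> t" "t \<le> 0"
    then obtain k where "(h has_real_derivative k) (at t)" "\<bar>k\<bar> \<le> L" using assms[of t] by auto
    then show "\<exists>k. ((\<lambda>t. - h t) has_real_derivative k) (at t) \<and> -L \<le> k"
      by (intro exI[of _ "- k"]) (auto intro: DERIV_minus)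
  qed
  ultimately show ?thesis using b by simp
qed

text \<open>Chaining local estimates along Lipschitz paths replaces the integral around a closed curve:
  the almost primitive of a bump form at a non-cut point \<open>q\<close> jumps across \<open>q\<close> but hardly changes along
  paths that avoid \<open>q\<close>.\<close>

lemma no_compact_arcwise_charted_set:
  fixes W :: "'a::real_inner set"
  assumes W: "compact W" "W \<noteq> {}" and charts: "\<And>p. p \<in> W \<Longrightarrow> \<exists>v \<epsilon> c c'. arc_chart W p v \<epsilon> c c'"
    and exact: "all_forms_almost_exact W"
  shows False
proof -
  obtain p0 where p0: "p0 \<in> W" using W by blast
  obtain q where q: "q \<in> W" and noncut: "\<And>v \<epsilon> c c' t. arc_chart W q v \<epsilon> c c' \<Longrightarrow> t \<in> {-\<epsilon><..<\<epsilon>} \<Longrightarrow> t \<noteq> 0 \<Longrightarrow>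
     \<exists>T g. lip_path W p0 (c t) T g \<and> q \<notin> g ` {0..T}"
    using non_cut_point_exists[OF W(1) p0 charts] by blast
  obtain v \<epsilon> c c' where ch: "arc_chart W q v \<epsilon> c c'" using charts[OF q] by blast
  have \<epsilon>: "\<epsilon> > 0" and c0: "c 0 = q" and curve: "C1_curve_in W {-\<epsilon><..<\<epsilon>} c c'"
    using ch by (auto simp: arc_chart_def)
  define a where "a = \<epsilon> / 2"
  have a: "a > 0" "a < \<epsilon>" using \<epsilon> by (auto simp: a_def)
  obtain T1 g1 where g1: "lip_path W p0 (c a) T1 g1" "q \<notin> g1 ` {0..T1}"
    using noncut[OF ch, of a] a by auto
  obtain T2 g2 where g2: "lip_path W p0 (c (-a)) T2 g2" "q \<notin> g2 ` {0..T2}"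
    using noncut[OF ch, of "-a"] a by auto
  have clo: "closed (g ` {0..T})" if g: "lip_path W x y T g" for x y T g
  proof -
    have "continuous_on {0..T} g"
    proof (rule continuous_onI)
      fix s e :: real assume s: "s \<in> {0..T}" "e > 0"
      show "\<exists>d>0. \<forall>t\<in>{0..T}. dist t s < d \<longrightarrow> dist (g t) (g s) \<le> e"
      proof (intro exI[of _ e] conjI ballI impI s(2))
        fix t assume t: "t \<in> {0..T}" "dist t s < e"
        then have "dist (g t) (g s) \<le> \<bar>t - s\<bar>" using g s unfolding lip_path_def by blast
        then show "dist (g t) (g s) \<le> e" using t by (simp add: dist_real_def)
      qed
    qed
    then show ?thesis by (intro compact_imp_closed compact_continuous_image) auto
  qed
  have "closed (g1 ` {0..T1} \<union> g2 ` {0..T2})" using clo[OF g1(1)] clo[OF g2(1)] by (rule closed_Un)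
  moreover have "q \<notin> g1 ` {0..T1} \<union> g2 ` {0..T2}" using g1 g2 by blast
  ultimately obtain \<sigma> where \<sigma>: "\<sigma> > 0" and "ball q \<sigma> \<subseteq> - (g1 ` {0..T1} \<union> g2 ` {0..T2})"
    by (metis ComplI open_Compl open_contains_ball)
  then have far1: "\<sigma> \<le> dist (g1 s) q" if "s \<in> {0..T1}" for s
    using that by (force simp: subset_iff dist_commute not_le[symmetric])
  have far2: "\<sigma> \<le> dist (g2 s) q" if "s \<in> {0..T2}" for s
    using that \<open>ball q \<sigma> \<subseteq> _\<close> by (force simp: subset_iff dist_commute not_le[symmetric])
  \<comment> \<open>The bump lives within distance \<open>\<sigma> / 2\<close> of \<open>q\<close>,
    while both paths stay at distance at least \<open>\<sigma>\<close>. The gap leaves room for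
    chart segments around the points of the paths.\<close>
  define \<psi> where "\<psi> x = max 0 (\<sigma> / 2 - dist x q)" for x
  have \<psi>c: "continuous_on UNIV \<psi>" unfolding \<psi>_def by (intro continuous_intros)
  have \<psi>0: "\<psi> x \<ge> 0" for x by (simp add: \<psi>_def)
  \<comment> \<open>At speed at most 2, parameters up to \<open>\<sigma> / 8\<close> stay within
    \<open>\<sigma> / 4\<close> of \<open>q\<close>, where the bump is at least
    \<open>\<sigma> / 4\<close>. This yields a jump of \<open>b * \<sigma> / 2\<close> before
    errors.\<close>
  define b where "b = min a (\<sigma> / 8)"
  have b: "b > 0" "b \<le> a" "b \<le> \<sigma> / 8" using a \<sigma> by (auto simp: b_def)
  have T0: "0 \<le> T1" "0 \<le> T2" using g1 g2 by (auto simp: lip_path_def)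
  \<comment> \<open>\<open>e * M\<close> collects all errors: \<open>2 * e\<close> per unit of
    length on the two paths, and \<open>2 * e\<close> per unit of parameter on the chart from
    \<open>-a\<close> to \<open>a\<close>. The choice of \<open>e\<close> makes it half of the
    jump.\<close>
  define M where "M = 2 * T1 + 2 * T2 + 4 * a"
  have M: "M > 0" using T0 a by (simp add: M_def)
  define e where "e = b * \<sigma> / 4 / M"
  have e: "e > 0" "e * M < b * \<sigma> / 2" using b \<sigma> M by (auto simp: e_def)
  obtain K where K: "\<And>S c c' t. C1_curve_in W S c c' \<Longrightarrow> t \<in> S \<Longrightarrow> \<exists>k.
      ((\<lambda>s. K (c s)) has_real_derivative k) (at t) \<and> \<bar>k - \<psi> (c t) * (v \<bullet> c' t)\<bar> \<le> e * norm (c' t)"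
    using exact \<psi>c e(1) unfolding all_forms_almost_exact_def by metis
  \<comment> \<open>As the chart is parametrised by the coordinate along \<open>v\<close>, the form
    \<open>v \<bullet> dx\<close> takes the value 1 on its tangent, so the bump contributes with a
    fixed sign.\<close>
  have vc': "v \<bullet> c' t = 1" if t: "t \<in> {-\<epsilon><..<\<epsilon>}" for t
  proof -
    have "(c has_vector_derivative c' t) (at t)" using curve t by (simp add: C1_curve_in_def)
    then have "(c has_derivative (\<lambda>h. h *\<^sub>R c' t)) (at t)" by (simp add: has_vector_derivative_def)
    from has_derivative_inner_right[OF has_derivative_diff[OF this has_derivative_const[of q]], of v]
    have 1: "((\<lambda>s. v \<bullet> (c s - q)) has_derivative (\<lambda>h. h * (v \<bullet> c' t))) (at t)" by simp
    have "((\<lambda>s. s) has_derivative (\<lambda>h. h * (v \<bullet> c' t))) (at t)"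
      by (rule has_derivative_transform_within_open[OF 1 open_greaterThanLessThan t])
         (use ch in \<open>auto simp: arc_chart_def\<close>)
    then have "(\<lambda>h. h) = (\<lambda>h. h * (v \<bullet> c' t))" using has_derivative_ident has_derivative_unique by blast
    from fun_cong[OF this, of 1] show ?thesis by simp
  qed
  have lower: "\<exists>k. ((\<lambda>s. K (c s)) has_real_derivative k) (at t) \<and> \<psi> (c t) - 2 * e \<le> k" if t: "\<bar>t\<bar> \<le> a" for t
  proof -
    have tI: "t \<in> {-\<epsilon><..<\<epsilon>}" using t a by auto
    obtain k where k: "((\<lambda>s. K (c s)) has_real_derivative k) (at t)" "\<bar>k - \<psi> (c t) * (v \<bullet> c' t)\<bar> \<le> e * norm (c' t)"
      using K[OF curve tI] by blast
    have "e * norm (c' t) \<le> e * 2" using ch tI e by (intro mult_left_mono) (auto simp: arc_chart_def)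
    then have "\<psi> (c t) - 2 * e \<le> k" using k(2) unfolding vc'[OF tI] by linarith
    then show ?thesis using k(1) by blast
  qed
  have outer: "\<exists>k. ((\<lambda>s. K (c s)) has_real_derivative k) (at t) \<and> - 2 * e \<le> k" if t: "\<bar>t\<bar> \<le> a" for t
    using lower[OF t] \<psi>0[of "c t"] by force
  have inner: "\<exists>k. ((\<lambda>s. K (c s)) has_real_derivative k) (at t) \<and> \<sigma> / 4 - 2 * e \<le> k" if t: "\<bar>t\<bar> \<le> b" for t
  proof -
    have "dist (c t) (c 0) \<le> 2 * \<bar>t - 0\<bar>" using t b a by (intro arc_chart_lipschitz[OF ch]) auto
    then have "\<psi> (c t) \<ge> \<sigma> / 4" using t b(3) c0 by (simp add: \<psi>_def)
    then show ?thesis using lower[of t] t b(2) by force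
  qed
  have "- 2 * e * (- b - - a) \<le> K (c (- b)) - K (c (- a))"
    by (rule DERIV_increment_ge[of "-a" "-b" "\<lambda>t. K (c t)"]) (use b outer in auto)
  moreover have "(\<sigma> / 4 - 2 * e) * (b - - b) \<le> K (c b) - K (c (- b))"
    by (rule DERIV_increment_ge[of "-b" b "\<lambda>t. K (c t)"]) (use b inner in auto)
  moreover have "- 2 * e * (a - b) \<le> K (c a) - K (c b)"
    by (rule DERIV_increment_ge[of b a "\<lambda>t. K (c t)"]) (use b outer in auto)
  ultimately have jump: "b * \<sigma> / 2 - 4 * e * a \<le> K (c a) - K (c (- a))"
    by (simp add: algebra_simps)
  have loc: "\<exists>\<rho>>0. \<forall>y\<in>W. dist y x < \<rho> \<longrightarrow> \<bar>K y - K x\<bar> \<le> 2 * e * dist y x"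
    if x: "x \<in> W" "\<sigma> \<le> dist x q" for x
  proof -
    obtain u \<delta> d d' where chx: "arc_chart W x u \<delta> d d'" using charts[OF x(1)] by blast
    obtain \<rho> where \<rho>: "\<rho> > 0" "\<And>y. y \<in> W \<Longrightarrow> dist y x < \<rho> \<Longrightarrow> \<exists>t\<in>{-\<delta><..<\<delta>}. y = d t"
      using chx unfolding arc_chart_def by blast
    have d0: "d 0 = x" "0 \<in> {-\<delta><..<\<delta>}" and dcurve: "C1_curve_in W {-\<delta><..<\<delta>} d d'" using chx by (auto simp: arc_chart_def)
    show ?thesis
    proof (intro exI[of _ "min \<rho> (\<sigma> / 4)"] conjI ballI impI)
      show "min \<rho> (\<sigma> / 4) > 0" using \<rho> \<sigma> by simp
      fix y assume y: "y \<in> W" "dist y x < min \<rho> (\<sigma> / 4)"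
      then obtain t where t: "t \<in> {-\<delta><..<\<delta>}" "y = d t" using \<rho>(2)[of y] by auto
      have "\<bar>t\<bar> = \<bar>u \<bullet> (y - x)\<bar>" using chx t by (simp add: arc_chart_def)
      also have "\<dots> \<le> norm u * norm (y - x)" by (rule Cauchy_Schwarz_ineq2)
      finally have ty: "\<bar>t\<bar> \<le> dist y x" using chx by (simp add: arc_chart_def dist_norm)
      have "\<bar>K (d t) - K (d 0)\<bar> \<le> 2 * e * \<bar>t\<bar>"
      proof (rule abs_increment_le[of t "\<lambda>s. K (d s)"])
        fix s assume s: "\<bar>s\<bar> \<le> \<bar>t\<bar>"
        then have sI: "s \<in> {-\<delta><..<\<delta>}" using t by auto
        have "dist (d s) (d 0) \<le> 2 * \<bar>s - 0\<bar>" by (rule arc_chart_lipschitz[OF chx sI d0(2)])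
        then have "dist (d s) x \<le> \<sigma> / 2" using s ty y d0 by simp
        then have "\<sigma> / 2 \<le> dist (d s) q" using x(2) dist_triangle[of x q "d s"] by (simp add: dist_commute)
        then have \<psi>s: "\<psi> (d s) = 0" by (simp add: \<psi>_def)
        obtain k where k: "((\<lambda>s. K (d s)) has_real_derivative k) (at s)" "\<bar>k - \<psi> (d s) * (v \<bullet> d' s)\<bar> \<le> e * norm (d' s)"
          using K[OF dcurve sI] by blast
        have "e * norm (d' s) \<le> e * 2" using chx sI e by (intro mult_left_mono) (auto simp: arc_chart_def)
        then have "\<bar>k\<bar> \<le> 2 * e" using k(2) \<psi>s by simp
        then show "\<exists>k. ((\<lambda>s. K (d s)) has_real_derivative k) (at s) \<and> \<bar>k\<bar> \<le> 2 * e" using k(1) by blast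
      qed
      also have "\<dots> \<le> 2 * e * dist y x" using ty e by (intro mult_left_mono) auto
      finally show "\<bar>K y - K x\<bar> \<le> 2 * e * dist y x" using t d0 by simp
    qed
  qed
  \<comment> \<open>The paths are only Lipschitz, so \<open>K\<close> cannot be differentiated along
    them. The estimate \<open>loc\<close>, obtained by moving within charts, is chained
    instead.\<close>
  have path: "\<bar>K y - K x\<bar> \<le> 2 * e * T" if g: "lip_path W x y T g" and far: "\<And>s. s \<in> {0..T} \<Longrightarrow> \<sigma> \<le> dist (g s) q" for x y T g
  proof -
    have "\<bar>K (g T) - K (g 0)\<bar> \<le> 2 * e * T"
    proof (rule lipschitz_from_local[of T "\<lambda>s. K (g s)"])
      show "0 \<le> T" using g by (simp add: lip_path_def)
      fix s assume s: "0 \<le> s" "s \<le> T"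
      then have sT: "s \<in> {0..T}" by simp
      have gW: "g t \<in> W" if "t \<in> {0..T}" for t using g that by (auto simp: lip_path_def)
      obtain \<rho> where \<rho>: "\<rho> > 0" "\<And>y. y \<in> W \<Longrightarrow> dist y (g s) < \<rho> \<Longrightarrow> \<bar>K y - K (g s)\<bar> \<le> 2 * e * dist y (g s)"
        using loc[OF gW[OF sT] far[OF sT]] by blast
      show "\<exists>d>0. \<forall>t. 0 \<le> t \<and> t \<le> T \<and> \<bar>t - s\<bar> < d \<longrightarrow> \<bar>K (g t) - K (g s)\<bar> \<le> 2 * e * \<bar>t - s\<bar>"
      proof (intro exI[of _ \<rho>] conjI allI impI \<rho>(1))
        fix t assume t: "0 \<le> t \<and> t \<le> T \<and> \<bar>t - s\<bar> < \<rho>"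
        then have tT: "t \<in> {0..T}" by simp
        have gst: "dist (g t) (g s) \<le> \<bar>t - s\<bar>" using g sT tT unfolding lip_path_def by blast
        then have "\<bar>K (g t) - K (g s)\<bar> \<le> 2 * e * dist (g t) (g s)"
          using t by (intro \<rho>(2) gW[OF tT]) simp
        also have "\<dots> \<le> 2 * e * \<bar>t - s\<bar>" using gst e by (intro mult_left_mono) auto
        finally show "\<bar>K (g t) - K (g s)\<bar> \<le> 2 * e * \<bar>t - s\<bar>" .
      qed
    qed
    then show ?thesis using g by (simp add: lip_path_def)
  qed
  have "\<bar>K (c a) - K p0\<bar> \<le> 2 * e * T1" "\<bar>K (c (- a)) - K p0\<bar> \<le> 2 * e * T2"
    using path[OF g1(1) far1] path[OF g2(1) far2] by auto
  then have "b * \<sigma> / 2 \<le> e * M" using jump by (simp add: M_def distrib_left abs_le_iff)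
  then show False using e by simp
qed

section \<open>Analyticity of the critical set\<close>

text \<open>The real inverse function theorem is applied to complex space. The inverse of a complex
  linear derivative commutes with complex scalars, so the preimage of the line through 0 in
  direction \<open>V\<close> depends holomorphically on \<open>t\<close>. One complex variable is
  enough for the identity theorem later.\<close>

lemma holomorphic_inverse_along_line:
  fixes \<Phi> :: "complex ^ 'n \<Rightarrow> complex ^ 'n" and M :: "complex ^ 'n \<Rightarrow> complex ^ 'n ^ 'n"
  assumes D: "\<And>z. (\<Phi> has_derivative (\<lambda>h. M z *v h)) (at z)"
    and cM: "\<And>i l. continuous_on UNIV (\<lambda>z. M z $ i $ l)"
    and inj: "inj ((*v) (M z0))" and z0: "\<Phi> z0 = 0"
  obtains U \<epsilon> \<gamma> where "open U" "z0 \<in> U" "inj_on \<Phi> U" "\<epsilon> > 0" "\<gamma> 0 = z0"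
    "\<And>t. t \<in> ball 0 \<epsilon> \<Longrightarrow> \<gamma> t \<in> U \<and> \<Phi> (\<gamma> t) = t *s V"
    "\<And>i. (\<lambda>t. \<gamma> t $ i) holomorphic_on ball 0 \<epsilon>"
proof -
  define f' where "f' z = Blinfun (\<lambda>h. M z *v h)" for z
  have f': "blinfun_apply (f' z) = (\<lambda>h. M z *v h)" for z
    unfolding f'_def by (rule bounded_linear_Blinfun_apply) (rule matrix_vector_mul_bounded_linear)
  have cf': "continuous_on UNIV f'"
  proof (rule continuous_on_blinfun_componentwise)
    fix b :: "complex ^ 'n"
    show "continuous_on UNIV (\<lambda>z. blinfun_apply (f' z) b)"
      unfolding f' matrix_vector_mult_def
      by (intro continuous_on_vec_lambda continuous_on_sum continuous_on_mult continuous_on_const cM)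
  qed
  obtain B where B: "B ** M z0 = mat 1" using inj matrix_left_invertible_injective by blast
  define invf where "invf = Blinfun ((*v) B)"
  have invf: "blinfun_apply invf = (*v) B"
    unfolding invf_def by (rule bounded_linear_Blinfun_apply) (rule matrix_vector_mul_bounded_linear)
  have inv1: "invf o\<^sub>L f' z0 = id_blinfun"
    by (rule blinfun_eqI) (simp add: invf f' matrix_vector_mul_assoc B)
  have Df: "(\<Phi> has_derivative blinfun_apply (f' z)) (at z)" for z unfolding f' by (rule D)
  obtain U T g g' where U: "open U" "z0 \<in> U" and T: "open T" "\<Phi> z0 \<in> T" and hom: "homeomorphism U T \<Phi> g"
    and g: "\<And>y. y \<in> T \<Longrightarrow> (g has_derivative (g' y)) (at y)"
    and g'inv: "\<And>y. y \<in> T \<Longrightarrow> g' y = inv (blinfun_apply (f' (g y)))"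
    and bij: "\<And>y. y \<in> T \<Longrightarrow> bij (blinfun_apply (f' (g y)))"
    using inverse_function_theorem[OF open_UNIV Df cf' UNIV_I inv1] by metis
  have g'scale: "g' y (s *s h) = s *s g' y h" if "y \<in> T" for y s h
  proof -
    have "M (g y) *v (s *s g' y h) = s *s (M (g y) *v g' y h)" by (rule vector_scalar_commute)
    also have "M (g y) *v g' y h = h"
      using bij[OF that] g'inv[OF that] surj_f_inv_f[OF bij_is_surj] by (metis f')
    finally have "inv (blinfun_apply (f' (g y))) (s *s h) = s *s g' y h"
      using bij[OF that] inv_f_f[OF bij_is_inj] by (metis f')
    then show ?thesis using g'inv[OF that] by simp
  qed
  define \<gamma> where "\<gamma> t = g (t *s V)" for t :: complex
  have line: "bounded_linear (\<lambda>t :: complex. t *s V)"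
    unfolding vector_scalar_mult_def
    by (rule bounded_linear_vec_lambda) (rule bounded_linear_mult_left)
  have "open ((\<lambda>t :: complex. t *s V) -` T)"
    using T(1) by (intro open_vimage linear_continuous_on[OF line] continuous_at_imp_continuous_on) (auto simp: linear_continuous_at[OF line])
  moreover have "0 \<in> (\<lambda>t :: complex. t *s V) -` T" using T(2) z0 by simp
  ultimately obtain \<epsilon> where \<epsilon>: "\<epsilon> > 0" "ball 0 \<epsilon> \<subseteq> (\<lambda>t :: complex. t *s V) -` T"
    using open_contains_ball by blast
  have tT: "t *s V \<in> T" if "t \<in> ball 0 \<epsilon>" for t using \<epsilon>(2) that by blast
  show thesis
  proof (rule that[OF U _ \<epsilon>(1), of \<gamma>])
    show "inj_on \<Phi> U" using hom homeomorphism_apply1 inj_on_inverseI by metis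
    show "\<gamma> 0 = z0" unfolding \<gamma>_def using hom U(2) z0 homeomorphism_apply1 by fastforce
    show "\<gamma> t \<in> U \<and> \<Phi> (\<gamma> t) = t *s V" if "t \<in> ball 0 \<epsilon>" for t
      unfolding \<gamma>_def using homeomorphism_apply2[OF hom tT[OF that]] tT[OF that] hom
      by (auto simp: homeomorphism_def)
    show "(\<lambda>t. \<gamma> t $ i) holomorphic_on ball 0 \<epsilon>" for i
    proof (rule holomorphic_onI)
      fix t :: complex assume t: "t \<in> ball 0 \<epsilon>"
      have "(\<gamma> has_derivative (\<lambda>h. g' (t *s V) (h *s V))) (at t)"
        unfolding \<gamma>_def
        by (rule has_derivative_compose[OF bounded_linear_imp_has_derivative[OF line] g[OF tT[OF t]]])
      then have "((\<lambda>t. \<gamma> t $ i) has_derivative (\<lambda>h. g' (t *s V) (h *s V) $ i)) (at t)"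
        by (rule bounded_linear.has_derivative[OF bounded_linear_vec_nth])
      then have "((\<lambda>t. \<gamma> t $ i) has_field_derivative (g' (t *s V) V $ i)) (at t)"
        unfolding has_field_derivative_def
        by (rule has_derivative_eq_rhs) (simp add: fun_eq_iff g'scale[OF tT[OF t]] mult.commute)
      then show "(\<lambda>t. \<gamma> t $ i) field_differentiable at t within ball 0 \<epsilon>"
        using field_differentiable_at_within field_differentiable_def by blast
    qed
  qed
qed

text \<open>An injective \<open>D\<close> would be bounded below, its linear growth would dominate
  the remainder, and \<open>p\<close> would be an isolated zero.\<close>

lemma kernel_at_limit_of_zeros:
  fixes f :: "'a::euclidean_space \<Rightarrow> 'b::euclidean_space"
  assumes D: "(f has_derivative D) (at p)" and p: "f p = 0" "p islimpt {x. f x = 0}"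
  obtains v where "norm v = 1" "D v = 0"
proof -
  have bl: "bounded_linear D" using D by (rule has_derivative_bounded_linear)
  have "\<exists>v. v \<noteq> 0 \<and> D v = 0"
  proof (rule ccontr)
    assume "\<nexists>v. v \<noteq> 0 \<and> D v = 0"
    then have "inj D" using linear_injective_0[OF bounded_linear.linear[OF bl]] by blast
    then obtain B where B: "B > 0" "\<And>x. B * norm x \<le> norm (D x)"
      using linear_inj_bounded_below_pos[OF bounded_linear.linear[OF bl]] by blast
    obtain d where d: "d > 0" "\<And>y. norm (y - p) < d \<Longrightarrow> norm (f y - f p - D (y - p)) \<le> B / 2 * norm (y - p)"
      using D B(1) unfolding has_derivative_at_alt by (meson half_gt_zero)
    obtain y where y: "f y = 0" "y \<noteq> p" "dist y p < d"
      using p(2) d(1) unfolding islimpt_approachable by blast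
    have "norm (D (y - p)) \<le> B / 2 * norm (y - p)" using d(2)[of y] y p(1) by (simp add: dist_norm)
    then have "B * norm (y - p) \<le> B / 2 * norm (y - p)" using B(2)[of "y - p"] by linarith
    then show False using B(1) y(2) by simp
  qed
  then obtain v where v: "v \<noteq> 0" "D v = 0" by blast
  show thesis
    by (rule that[of "v /\<^sub>R norm v"]) (use v in \<open>simp_all add: linear_scale[OF bounded_linear.linear[OF bl]]\<close>)
qed

text \<open>A real matrix acts separately on real and imaginary parts.\<close>

lemma complex_matrix_of_real_inj:
  fixes A :: "real ^ 'n ^ 'n"
  assumes "\<And>h. A *v h = 0 \<Longrightarrow> h = 0"
  shows "inj ((*v) (\<chi> i l. complex_of_real (A $ i $ l)))"
proof -
  let ?A = "(\<chi> i l. complex_of_real (A $ i $ l)) :: complex ^ 'n ^ 'n"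
  have "h = 0" if h: "?A *v h = 0" for h
  proof -
    have "(A *v (\<chi> l. Re (h $ l))) $ i = Re ((?A *v h) $ i)" "(A *v (\<chi> l. Im (h $ l))) $ i = Im ((?A *v h) $ i)" for i
      by (simp_all add: matrix_vector_mult_def)
    then have "A *v (\<chi> l. Re (h $ l)) = 0" "A *v (\<chi> l. Im (h $ l)) = 0"
      using h by (simp_all add: vec_eq_iff)
    then have "(\<chi> l. Re (h $ l)) = 0" "(\<chi> l. Im (h $ l)) = 0" using assms by auto
    then show "h = 0" by (simp add: vec_eq_iff complex_eq_iff)
  qed
  moreover have "linear ((*v) ?A)" by simp
  ultimately show ?thesis using linear_injective_0 by blast
qed

section \<open>Real points of complex space and the critical curve\<close>

definition of_real_vec :: "real ^ 'n \<Rightarrow> complex ^ 'n" where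
  "of_real_vec x = (\<chi> i. complex_of_real (x $ i))"

definition cnj_vec :: "complex ^ 'n \<Rightarrow> complex ^ 'n" where
  "cnj_vec z = (\<chi> i. cnj (z $ i))"

lemma continuous_on_of_real_vec: "continuous_on S of_real_vec"
  unfolding of_real_vec_def by (intro continuous_intros)

lemma continuous_on_cnj_vec: "continuous_on S cnj_vec"
  unfolding cnj_vec_def by (intro continuous_intros)

lemma cnj_vec_eq_iff: "cnj_vec z = z \<longleftrightarrow> z = of_real_vec (\<chi> i. Re (z $ i))"
  by (auto simp: cnj_vec_def of_real_vec_def vec_eq_iff complex_eq_iff)

lemma of_real_vec_inject [simp]: "of_real_vec x = of_real_vec y \<longleftrightarrow> x = y"
  by (simp add: of_real_vec_def vec_eq_iff)

lemma prod_grad_cnj: "prod_grad w J (cnj_vec z) = cnj_vec (prod_grad w J z)"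
  by (simp add: prod_grad_def cnj_vec_def sqd_def vec_eq_iff)

text \<open>The zero set of the gradient near \<open>p\<close> is contained in the analytic curve on which
  the components of the gradient orthogonal to the kernel direction \<open>v\<close> vanish; the remaining component
  is analytic along this curve and has non-isolated zeros.\<close>

lemma critical_curve_through_limit_point:
  fixes w :: "'i \<Rightarrow> real ^ 'n" and p v :: "real ^ 'n"
  assumes p: "prod_grad w J p = 0" "p islimpt {x. prod_grad w J x = 0}"
    and v: "norm v = 1" "prod_hess w J p *v v = 0"
    and ker: "\<And>h. prod_hess w J p *v h = 0 \<Longrightarrow> v \<bullet> h = 0 \<Longrightarrow> h = 0"
  obtains \<epsilon> c c' where "\<epsilon> > 0" "c 0 = p"
    "\<And>t. t \<in> {-\<epsilon><..<\<epsilon>} \<Longrightarrow> (c has_vector_derivative c' t) (at t)" "continuous_on {-\<epsilon><..<\<epsilon>} c'"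
    "\<And>t. t \<in> {-\<epsilon><..<\<epsilon>} \<Longrightarrow> prod_grad w J (c t) = 0 \<and> v \<bullet> (c t - p) = t"
    "\<exists>\<rho>>0. \<forall>y. prod_grad w J y = 0 \<longrightarrow> dist y p < \<rho> \<longrightarrow> (\<exists>t\<in>{-\<epsilon><..<\<epsilon>}. y = c t)"
proof -
  let ?G = "prod_grad w J :: complex ^ 'n \<Rightarrow> complex ^ 'n"
  define L :: "complex ^ 'n \<Rightarrow> complex" where "L z = (\<Sum>i\<in>UNIV. of_real (v $ i) * (z $ i - of_real (p $ i)))" for z
  \<comment> \<open>The rank-one term makes the derivative at \<open>p\<close> invertible: the
    Hessian is symmetric and kills \<open>v\<close>, so its image is orthogonal to \<open>v\<close>,
    and its kernel meets the complement of \<open>v\<close> only in 0.\<close>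
  define \<Phi> where "\<Phi> z = ?G z + L z *s of_real_vec v" for z
  define M where "M z = prod_hess w J z + (\<chi> i l. of_real (v $ i * v $ l))" for z :: "complex ^ 'n"
  have LD: "(L has_derivative (\<lambda>h. \<Sum>i\<in>UNIV. of_real (v $ i) * h $ i)) (at z)" for z
    unfolding L_def
    by (rule derivative_eq_intros bounded_linear.has_derivative[OF bounded_linear_vec_nth] refl)+ simp
  have D: "(\<Phi> has_derivative (\<lambda>h. M z *v h)) (at z)" for z
  proof -
    have "((\<lambda>z. \<chi> i. L z * of_real (v $ i)) has_derivative (\<lambda>h. \<chi> i. (\<Sum>l\<in>UNIV. of_real (v $ l) * h $ l) * of_real (v $ i))) (at z)"
      by (intro has_derivative_vec_lambda has_derivative_mult_left LD)
    moreover have "(\<lambda>z. \<chi> i. L z * of_real (v $ i)) = (\<lambda>z. L z *s of_real_vec v)"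
      by (simp add: of_real_vec_def vector_scalar_mult_def)
    ultimately have "(\<Phi> has_derivative (\<lambda>h. prod_hess w J z *v h + (\<chi> i. (\<Sum>l\<in>UNIV. of_real (v $ l) * h $ l) * of_real (v $ i)))) (at z)"
      unfolding \<Phi>_def by (intro has_derivative_add prod_grad_has_derivative) simp
    moreover have "prod_hess w J z *v h + (\<chi> i. (\<Sum>l\<in>UNIV. of_real (v $ l) * h $ l) * of_real (v $ i)) = M z *v h" for h
      unfolding M_def by (simp add: matrix_vector_mult_def vec_eq_iff ring_distribs sum.distrib sum_distrib_left mult_ac)
    ultimately show ?thesis by simp
  qed
  have cM: "continuous_on UNIV (\<lambda>z. M z $ i $ l)" for i l
    unfolding M_def by (simp, intro continuous_on_add continuous_on_prod_hess_component continuous_on_id continuous_on_const)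
  have injM: "inj ((*v) (M (of_real_vec p)))"
  proof -
    have "M (of_real_vec p) = (\<chi> i l. complex_of_real ((prod_hess w J p + (\<chi> i l. v $ i * v $ l)) $ i $ l))"
      unfolding M_def of_real_vec_def prod_hess_of_real by (simp add: vec_eq_iff)
    moreover have "h = 0" if h: "(prod_hess w J p + (\<chi> i l. v $ i * v $ l)) *v h = 0" for h :: "real ^ 'n"
    proof -
      have "(\<chi> i l. v $ i * v $ l) *v h = (v \<bullet> h) *\<^sub>R v"
        by (simp add: matrix_vector_mult_def vec_eq_iff inner_vec_def sum_distrib_left sum_distrib_right mult_ac)
      then have 1: "prod_hess w J p *v h + (v \<bullet> h) *\<^sub>R v = 0"
        using h by (simp add: matrix_vector_mult_add_rdistrib)
      have "v \<bullet> (prod_hess w J p *v h) = (v v* prod_hess w J p) \<bullet> h" by (simp add: dot_lmul_matrix)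
      also have "v v* prod_hess w J p = prod_hess w J p *v v"
        by (metis transpose_matrix_vector transpose_prod_hess)
      finally have 2: "v \<bullet> (prod_hess w J p *v h) = 0" using v(2) by simp
      have "v \<bullet> (prod_hess w J p *v h + (v \<bullet> h) *\<^sub>R v) = v \<bullet> h"
        using v(1) by (simp add: inner_add_right 2 norm_eq_1)
      then have "v \<bullet> h = 0" using 1 by simp
      then show "h = 0" using ker 1 by simp
    qed
    ultimately show ?thesis
      using complex_matrix_of_real_inj[of "prod_hess w J p + (\<chi> i l. v $ i * v $ l)"] by simp
  qed
  have LvR: "L (of_real_vec x) = of_real (v \<bullet> (x - p))" for x
    unfolding L_def of_real_vec_def by (simp add: inner_vec_def)
  have \<Phi>R: "\<Phi> (of_real_vec x) = of_real_vec (prod_grad w J x + (v \<bullet> (x - p)) *\<^sub>R v)" for x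
    unfolding \<Phi>_def LvR unfolding of_real_vec_def prod_grad_of_real by (simp add: vec_eq_iff)
  have \<Phi>p: "\<Phi> (of_real_vec p) = 0" unfolding \<Phi>R by (simp add: p(1) of_real_vec_def vec_eq_iff)
  obtain U \<epsilon>1 \<gamma> where U: "open U" "of_real_vec p \<in> U" "inj_on \<Phi> U" and \<epsilon>1: "\<epsilon>1 > 0" and \<gamma>0: "\<gamma> 0 = of_real_vec p"
    and \<gamma>: "\<And>t. t \<in> ball 0 \<epsilon>1 \<Longrightarrow> \<gamma> t \<in> U \<and> \<Phi> (\<gamma> t) = t *s of_real_vec v"
    and hol: "\<And>i. (\<lambda>t. \<gamma> t $ i) holomorphic_on ball 0 \<epsilon>1"
    by (rule holomorphic_inverse_along_line[where \<Phi>=\<Phi> and M=M and V="of_real_vec v", OF D cM injM \<Phi>p]) (rule that)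
  \<comment> \<open>\<open>\<Phi>\<close> has real coefficients. For real \<open>t\<close> the
    points \<open>\<gamma> t\<close> and its conjugate therefore have the same image, and
    injectivity on \<open>U\<close> makes \<open>\<gamma> t\<close> real; \<open>\<epsilon>2\<close>
    below keeps the conjugate inside \<open>U\<close>.\<close>
  have \<Phi>cnj: "\<Phi> (cnj_vec z) = cnj_vec (\<Phi> z)" for z
    unfolding \<Phi>_def prod_grad_cnj by (simp add: cnj_vec_def of_real_vec_def L_def vec_eq_iff)
  have cont\<gamma>: "continuous_on (ball 0 \<epsilon>1) \<gamma>"
  proof -
    have "continuous_on (ball 0 \<epsilon>1) (\<lambda>t. \<chi> i. \<gamma> t $ i)"
      by (intro continuous_on_vec_lambda holomorphic_on_imp_continuous_on hol)
    then show ?thesis by simp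
  qed
  obtain \<epsilon>2 where \<epsilon>2: "\<epsilon>2 > 0" "\<epsilon>2 \<le> \<epsilon>1" "\<And>t. t \<in> ball 0 \<epsilon>2 \<Longrightarrow> cnj_vec (\<gamma> t) \<in> U"
  proof -
    have "continuous_on (ball 0 \<epsilon>1) (\<lambda>t. cnj_vec (\<gamma> t))"
      by (rule continuous_on_compose2[OF continuous_on_cnj_vec cont\<gamma> subset_UNIV])
    then have "open ((\<lambda>t. cnj_vec (\<gamma> t)) -` U \<inter> ball 0 \<epsilon>1)"
      using U(1) continuous_on_open_vimage[OF open_ball] by blast
    moreover have "cnj_vec (of_real_vec p) = of_real_vec p" by (simp add: cnj_vec_def of_real_vec_def)
    then have "0 \<in> (\<lambda>t. cnj_vec (\<gamma> t)) -` U \<inter> ball 0 \<epsilon>1" using U(2) \<epsilon>1 \<gamma>0 by simp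
    ultimately obtain \<epsilon>2 where "\<epsilon>2 > 0" "ball 0 \<epsilon>2 \<subseteq> (\<lambda>t. cnj_vec (\<gamma> t)) -` U \<inter> ball 0 \<epsilon>1"
      using open_contains_ball by blast
    then show thesis by (intro that[of "min \<epsilon>2 \<epsilon>1"]) (use \<epsilon>1 in auto)
  qed
  define c where "c t = (\<chi> i. Re (\<gamma> (of_real t) $ i))" for t :: real
  define c' where "c' t = (\<chi> i. Re (deriv (\<lambda>t. \<gamma> t $ i) (of_real t)))" for t :: real
  have tb: "of_real t \<in> ball (0::complex) \<epsilon>2 \<and> of_real t \<in> ball (0::complex) \<epsilon>1" if "\<bar>t\<bar> < \<epsilon>2" for t :: real
    using that \<epsilon>2(2) by simp
  have \<gamma>real: "\<gamma> (of_real t) = of_real_vec (c t)" if t: "\<bar>t\<bar> < \<epsilon>2" for t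
  proof -
    have "\<Phi> (cnj_vec (\<gamma> (of_real t))) = cnj_vec (of_real t *s of_real_vec v)"
      unfolding \<Phi>cnj using \<gamma>[of "of_real t"] tb[OF t] by simp
    also have "\<dots> = of_real t *s of_real_vec v" by (simp add: cnj_vec_def of_real_vec_def vec_eq_iff)
    also have "\<dots> = \<Phi> (\<gamma> (of_real t))" using \<gamma>[of "of_real t"] tb[OF t] by simp
    finally have "cnj_vec (\<gamma> (of_real t)) = \<gamma> (of_real t)"
      using U(3) \<epsilon>2(3)[of "of_real t"] \<gamma>[of "of_real t"] tb[OF t] unfolding inj_on_def by blast
    then show ?thesis unfolding c_def by (simp only: cnj_vec_eq_iff)
  qed
  \<comment> \<open>At a zero \<open>y\<close> of the gradient \<open>\<Phi>\<close> equals
    \<open>v \<bullet> (y - p)\<close> times \<open>v\<close>, so near \<open>p\<close> injectivity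
    places \<open>y\<close> on the curve at this parameter.\<close>
  have near: "\<exists>\<rho>>0. \<forall>y. prod_grad w J y = 0 \<longrightarrow> dist y p < \<rho> \<longrightarrow>
      \<bar>v \<bullet> (y - p)\<bar> < \<epsilon> \<and> y = c (v \<bullet> (y - p))" if \<epsilon>: "0 < \<epsilon>" "\<epsilon> \<le> \<epsilon>2" for \<epsilon>
  proof -
    have "open (of_real_vec -` U)" using U(1) continuous_on_of_real_vec open_vimage by blast
    then obtain r where r: "r > 0" "ball p r \<subseteq> of_real_vec -` U"
      using U(2) open_contains_ball by blast
    show ?thesis
    proof (intro exI[of _ "min r \<epsilon>"] conjI allI impI)
      show "min r \<epsilon> > 0" using r \<epsilon> by simp
      fix y assume y: "prod_grad w J y = 0" "dist y p < min r \<epsilon>"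
      have "y \<in> ball p r" using y(2) by (simp add: dist_commute)
      then have yU: "of_real_vec y \<in> U" using r(2) by blast
      have "\<bar>v \<bullet> (y - p)\<bar> \<le> norm v * norm (y - p)" by (rule Cauchy_Schwarz_ineq2)
      then show s: "\<bar>v \<bullet> (y - p)\<bar> < \<epsilon>" using v(1) y(2) by (simp add: dist_norm)
      then have s2: "\<bar>v \<bullet> (y - p)\<bar> < \<epsilon>2" using \<epsilon> by simp
      have "\<Phi> (of_real_vec y) = of_real (v \<bullet> (y - p)) *s of_real_vec v"
        unfolding \<Phi>R y(1) by (simp add: of_real_vec_def vec_eq_iff)
      then have "\<Phi> (of_real_vec y) = \<Phi> (\<gamma> (of_real (v \<bullet> (y - p))))" using \<gamma> tb[OF s2] by simp
      then have "of_real_vec y = \<gamma> (of_real (v \<bullet> (y - p)))"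
        using U(3) yU \<gamma> tb[OF s2] unfolding inj_on_def by blast
      then show "y = c (v \<bullet> (y - p))" using \<gamma>real[OF s2] by simp
    qed
  qed
  have cp: "c 0 = p"
    using \<gamma>real[of 0] \<gamma>0 \<epsilon>2(1) by simp
  \<comment> \<open>For real \<open>t\<close>,
    \<open>\<Phi> (\<gamma> t) = t *s of_real_vec v\<close> says that the gradient at
    \<open>c t\<close> is \<open>g t\<close> times \<open>v\<close>. The critical points
    accumulating at \<open>p\<close> give zeros of \<open>g\<close> accumulating at 0, so
    \<open>g\<close> vanishes identically.\<close>
  define g where "g t = t - L (\<gamma> t)" for t
  have gzero: "g t = 0" if "t \<in> ball 0 \<epsilon>2" for t
  proof (rule analytic_continuation[where f=g and S="ball 0 \<epsilon>2" and U="{t \<in> ball 0 \<epsilon>2. g t = 0}" and \<xi>=0])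
    show "g holomorphic_on ball 0 \<epsilon>2"
      unfolding g_def L_def
      by (intro holomorphic_intros holomorphic_on_subset[OF hol]) (use \<epsilon>2 in auto)
    show "0 islimpt {t \<in> ball 0 \<epsilon>2. g t = 0}"
      unfolding islimpt_approachable
    proof (intro allI impI)
      fix e :: real assume e: "e > 0"
      define \<epsilon> where "\<epsilon> = min e \<epsilon>2"
      obtain \<rho> where \<rho>: "\<rho> > 0" "\<And>y. prod_grad w J y = 0 \<Longrightarrow> dist y p < \<rho> \<Longrightarrow>
        \<bar>v \<bullet> (y - p)\<bar> < \<epsilon> \<and> y = c (v \<bullet> (y - p))"
        using near[of \<epsilon>] e \<epsilon>2(1) unfolding \<epsilon>_def by auto
      obtain y where y: "prod_grad w J y = 0" "y \<noteq> p" "dist y p < \<rho>"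
        using p(2) \<rho>(1) unfolding islimpt_approachable by blast
      define s where "s = v \<bullet> (y - p)"
      have s: "\<bar>s\<bar> < \<epsilon>" "y = c s" using \<rho>(2)[OF y(1,3)] by (auto simp: s_def)
      have s2: "\<bar>s\<bar> < \<epsilon>2" using s(1) by (simp add: \<epsilon>_def)
      have "s \<noteq> 0" using s(2) y(2) cp by auto
      moreover have "g (of_real s) = 0"
        unfolding g_def \<gamma>real[OF s2] LvR s(2)[symmetric] by (simp add: s_def)
      ultimately show "\<exists>x'\<in>{t \<in> ball 0 \<epsilon>2. g t = 0}. x' \<noteq> 0 \<and> dist x' 0 < e"
        using s s2 by (intro bexI[of _ "of_real s"]) (auto simp: \<epsilon>_def)
    qed
  qed (use \<epsilon>2 that in auto)
  have on_curve: "prod_grad w J (c t) = 0 \<and> v \<bullet> (c t - p) = t" if t: "\<bar>t\<bar> < \<epsilon>2" for t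
  proof -
    have "of_real (v \<bullet> (c t - p)) = complex_of_real t"
      using gzero[of "of_real t"] tb[OF t] unfolding g_def \<gamma>real[OF t] LvR by simp
    then have 1: "v \<bullet> (c t - p) = t" by (simp only: of_real_eq_iff)
    have "\<Phi> (of_real_vec (c t)) = of_real t *s of_real_vec v"
      using \<gamma>[of "of_real t"] tb[OF t] \<gamma>real[OF t] by simp
    also have "\<dots> = of_real_vec (t *\<^sub>R v)" by (simp add: of_real_vec_def vec_eq_iff)
    finally have "prod_grad w J (c t) + t *\<^sub>R v = t *\<^sub>R v" unfolding \<Phi>R 1 by simp
    then show ?thesis using 1 by simp
  qed
  show thesis
  proof (rule that[of \<epsilon>2 c c'])
    show "(c has_vector_derivative c' t) (at t)" if t: "t \<in> {-\<epsilon>2<..<\<epsilon>2}" for t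
    proof -
      have tt: "\<bar>t\<bar> < \<epsilon>2" using t by auto
      have "((\<lambda>t. Re (\<gamma> (of_real t) $ i)) has_derivative (\<lambda>h. h * Re (deriv (\<lambda>t. \<gamma> t $ i) (of_real t)))) (at t)" for i
      proof -
        have "((\<lambda>t. \<gamma> t $ i) has_field_derivative deriv (\<lambda>t. \<gamma> t $ i) (of_real t)) (at (of_real t))"
          by (rule holomorphic_derivI[OF hol open_ball]) (use tb[OF tt] in blast)
        then have 1: "((\<lambda>t. \<gamma> t $ i) has_derivative (*) (deriv (\<lambda>t. \<gamma> t $ i) (of_real t))) (at (of_real t))"
          by (simp add: has_field_derivative_def)
        have 2: "(complex_of_real has_derivative complex_of_real) (at t)"
          by (rule bounded_linear_imp_has_derivative) (rule bounded_linear_of_real)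
        have "((\<lambda>t. Re (\<gamma> (of_real t) $ i)) has_derivative (\<lambda>h. Re (deriv (\<lambda>t. \<gamma> t $ i) (of_real t) * of_real h))) (at t)"
          by (rule bounded_linear.has_derivative[OF bounded_linear_Re has_derivative_compose[OF 2 1]])
        then show ?thesis by (rule has_derivative_eq_rhs) (simp add: fun_eq_iff)
      qed
      from has_derivative_vec_lambda[OF this]
      have "(c has_derivative (\<lambda>h. \<chi> i. h * Re (deriv (\<lambda>t. \<gamma> t $ i) (of_real t)))) (at t)"
        unfolding c_def .
      then show ?thesis unfolding has_vector_derivative_def
        by (rule has_derivative_eq_rhs) (simp add: fun_eq_iff vec_eq_iff c'_def)
    qed
    show "continuous_on {-\<epsilon>2<..<\<epsilon>2} c'"
      unfolding c'_def
    proof (intro continuous_on_vec_lambda continuous_on_Re)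
      fix i
      have "continuous_on (ball 0 \<epsilon>1) (deriv (\<lambda>t. \<gamma> t $ i))"
        by (intro holomorphic_on_imp_continuous_on holomorphic_deriv hol open_ball)
      then show "continuous_on {-\<epsilon>2<..<\<epsilon>2} (\<lambda>t. deriv (\<lambda>t. \<gamma> t $ i) (of_real t))"
        by (rule continuous_on_compose2[OF _ continuous_on_of_real_id]) (use tb in auto)
    qed
    show "prod_grad w J (c t) = 0 \<and> v \<bullet> (c t - p) = t" if "t \<in> {-\<epsilon>2<..<\<epsilon>2}" for t
      using on_curve[of t] that by auto
    show "\<exists>\<rho>>0. \<forall>y. prod_grad w J y = 0 \<longrightarrow> dist y p < \<rho> \<longrightarrow> (\<exists>t\<in>{-\<epsilon>2<..<\<epsilon>2}. y = c t)"
      using near[OF \<epsilon>2(1) order_refl] by (force simp: abs_less_iff)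
  qed (use \<epsilon>2 cp in auto)
qed

section \<open>The set of accumulation points and its charts\<close>

lemma critical_point_not_limit:
  fixes w :: "'i \<Rightarrow> real ^ 'n" and p0 :: "real ^ 'n"
  assumes J: "finite J" "J \<noteq> {}"
    and tr: "\<And>(x :: real ^ 'n) e f. norm e = 1 \<Longrightarrow> norm f = 1 \<Longrightarrow> e \<bullet> f = 0 \<Longrightarrow>
      0 < e \<bullet> (prod_hess w J x *v e) + f \<bullet> (prod_hess w J x *v f)"
    and p0: "prod_grad w J p0 = 0"
  shows "\<not> p0 islimpt {x. prod_grad w J x = 0}"
proof
  assume lim: "p0 islimpt {x. prod_grad w J x = 0}"
  define Z where "Z = {x :: real ^ 'n. prod_grad w J x = 0}"
  define W where "W = Z \<inter> {x. x islimpt Z}"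
  have "closed Z" unfolding Z_def
    by (intro closed_Collect_eq continuous_on_prod_grad continuous_on_const)
  then have "closed W" unfolding W_def by (intro closed_Int closed_limpts)
  moreover obtain R where R: "\<And>x. prod_grad w J x = 0 \<Longrightarrow> norm (x :: real ^ 'n) < R / 2"
    by (rule prod_grad_zeros_bounded[of J w, OF J]) (rule that)
  have "bounded W" unfolding bounded_iff
  proof (intro exI ballI)
    fix x assume "x \<in> W"
    then show "norm x \<le> R / 2" using R[of x] by (simp add: W_def Z_def)
  qed
  ultimately have "compact W" by (simp add: compact_eq_bounded_closed)
  moreover have "W \<noteq> {}" using p0 lim by (auto simp: W_def Z_def)
  moreover have "\<exists>v \<epsilon> c c'. arc_chart W p v \<epsilon> c c'" if p: "p \<in> W" for p
  proof -
    have pZ: "prod_grad w J p = 0" "p islimpt {x. prod_grad w J x = 0}" using p by (auto simp: W_def Z_def)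
    obtain v where v: "norm v = 1" "prod_hess w J p *v v = 0"
      using kernel_at_limit_of_zeros[OF prod_grad_has_derivative pZ] by blast
    \<comment> \<open>A second kernel vector orthogonal to \<open>v\<close> would span with
      \<open>v\<close> a plane of trace 0.\<close>
    have ker: "h = 0" if h: "prod_hess w J p *v h = 0" "v \<bullet> h = 0" for h
    proof (rule ccontr)
      assume "h \<noteq> 0"
      then have "0 < v \<bullet> (prod_hess w J p *v v) + (h /\<^sub>R norm h) \<bullet> (prod_hess w J p *v (h /\<^sub>R norm h))"
        using v(1) h(2) by (intro tr) auto
      then show False using v(2) h(1) by (simp add: matrix_vector_mult_scaleR)
    qed
    show ?thesis
    proof (rule critical_curve_through_limit_point[OF pZ v])
      show "h = 0" if "prod_hess w J p *v h = 0" "v \<bullet> h = 0" for h by (rule ker[OF that])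
    next
      fix \<epsilon> c c'
      assume \<epsilon>: "\<epsilon> > 0" and c0: "c 0 = p"
        and cd: "\<And>t. t \<in> {-\<epsilon><..<\<epsilon>} \<Longrightarrow> (c has_vector_derivative c' t) (at t)" and cc': "continuous_on {-\<epsilon><..<\<epsilon>} c'"
        and cZ: "\<And>t. t \<in> {-\<epsilon><..<\<epsilon>} \<Longrightarrow> prod_grad w J (c t) = 0 \<and> v \<bullet> (c t - p) = t"
        and "\<exists>\<rho>>0. \<forall>y. prod_grad w J y = 0 \<longrightarrow> dist y p < \<rho> \<longrightarrow> (\<exists>t\<in>{-\<epsilon><..<\<epsilon>}. y = c t)"
      then obtain \<rho> where \<rho>: "\<rho> > 0" "\<And>y. prod_grad w J y = 0 \<Longrightarrow> dist y p < \<rho> \<Longrightarrow> \<exists>t\<in>{-\<epsilon><..<\<epsilon>}. y = c t"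
        by blast
      have I0: "0 \<in> {-\<epsilon><..<\<epsilon>}" using \<epsilon> by simp
      have c0d: "(c has_derivative (\<lambda>h. h *\<^sub>R c' 0)) (at 0)" using cd[OF I0] by (simp add: has_vector_derivative_def)
      \<comment> \<open>The gradient vanishes along \<open>c\<close>, so \<open>c' 0\<close> lies in
        the kernel of the Hessian; its component along \<open>v\<close> is 1. Hence
        \<open>c' 0 = v\<close>, and by continuity the speed is at most 2 on a shorter
        interval.\<close>
      have "((\<lambda>t. prod_grad w J (c t)) has_derivative (\<lambda>h. prod_hess w J (c 0) *v (h *\<^sub>R c' 0))) (at 0)"
        by (rule has_derivative_compose[OF c0d prod_grad_has_derivative])
      moreover have "((\<lambda>t. prod_grad w J (c t)) has_derivative (\<lambda>h. 0)) (at 0)"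
        by (rule has_derivative_transform_within_open[OF has_derivative_const[of 0] open_greaterThanLessThan I0]) (use cZ in auto)
      ultimately have "(\<lambda>h. prod_hess w J (c 0) *v (h *\<^sub>R c' 0)) = (\<lambda>h. 0)" by (rule has_derivative_unique)
      from fun_cong[OF this, of 1] have Hc': "prod_hess w J p *v c' 0 = 0" by (simp add: c0)
      have "((\<lambda>t. v \<bullet> (c t - p)) has_derivative (\<lambda>h. v \<bullet> (h *\<^sub>R c' 0 - 0))) (at 0)"
        by (intro has_derivative_inner_right has_derivative_diff c0d has_derivative_const)
      moreover have "((\<lambda>t. v \<bullet> (c t - p)) has_derivative (\<lambda>h. h)) (at 0)"
        by (rule has_derivative_transform_within_open[OF has_derivative_ident open_greaterThanLessThan I0]) (use cZ in auto)
      ultimately have "(\<lambda>h. v \<bullet> (h *\<^sub>R c' 0 - 0)) = (\<lambda>h. h)" by (rule has_derivative_unique)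
      from fun_cong[OF this, of 1] have "v \<bullet> c' 0 = 1" by simp
      then have "prod_hess w J p *v (c' 0 - v) = 0" "v \<bullet> (c' 0 - v) = 0"
        using Hc' v by (simp_all add: matrix_vector_mult_diff_distrib inner_diff_right norm_eq_1)
      then have "c' 0 - v = 0" by (rule ker)
      then have "norm (c' 0) = 1" using v(1) by simp
      have "\<exists>\<delta>>0. \<forall>t\<in>{-\<epsilon><..<\<epsilon>}. dist t 0 < \<delta> \<longrightarrow> dist (c' t) (c' 0) < 1"
        using cc'[unfolded continuous_on_iff] I0 zero_less_one by blast
      then obtain \<delta> where \<delta>: "\<delta> > 0" "\<And>t. t \<in> {-\<epsilon><..<\<epsilon>} \<Longrightarrow> dist t 0 < \<delta> \<Longrightarrow> dist (c' t) (c' 0) < 1"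
        by blast
      define \<epsilon>' where "\<epsilon>' = min \<delta> \<epsilon>"
      have \<epsilon>': "\<epsilon>' > 0" "\<epsilon>' \<le> \<epsilon>" using \<delta>(1) \<epsilon> by (auto simp: \<epsilon>'_def)
      have c'2: "norm (c' t) \<le> 2" if t: "t \<in> {-\<epsilon>'<..<\<epsilon>'}" for t
      proof -
        have "t \<in> {-\<epsilon><..<\<epsilon>}" "dist t 0 < \<delta>" using t by (auto simp: \<epsilon>'_def)
        from \<delta>(2)[OF this] have "norm (c' t - c' 0) < 1" by (simp add: dist_norm)
        then show ?thesis using norm_triangle_ineq2[of "c' t" "c' 0"] \<open>norm (c' 0) = 1\<close> by linarith
      qed
      have sub: "{-\<epsilon>'<..<\<epsilon>'} \<subseteq> {-\<epsilon><..<\<epsilon>}" using \<epsilon>' by auto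
      have inW: "c t \<in> W" if t: "t \<in> {-\<epsilon>'<..<\<epsilon>'}" for t
      proof -
        have tI: "t \<in> {-\<epsilon><..<\<epsilon>}" using t sub by blast
        \<comment> \<open>The curve must lie in \<open>W\<close>, not merely in the critical set:
          each of its points is a limit of other points of the curve, which differ from it in their
          coordinate along \<open>v\<close>.\<close>
        have "c t islimpt Z"
          unfolding islimpt_approachable
        proof (intro allI impI)
          fix e :: real assume e: "e > 0"
          have "isCont c t" using cd[OF tI] has_vector_derivative_continuous by blast
          then obtain d where d: "d > 0" "\<And>s. dist s t < d \<Longrightarrow> dist (c s) (c t) < e"
            using e unfolding continuous_at_eps_delta by blast
          obtain m where m: "0 < m" "m < d" "m < \<epsilon> - t"
            using dense[of 0 "min d (\<epsilon> - t)"] d(1) tI by auto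
          define s where "s = t + m"
          have "s \<noteq> t" "dist s t < d" "- \<epsilon> < s" "s < \<epsilon>"
            using m tI by (auto simp: s_def dist_real_def)
          then have s: "s \<noteq> t" "dist s t < d" "s \<in> {-\<epsilon><..<\<epsilon>}" by simp_all
          have "c s \<noteq> c t" using cZ[OF s(3)] cZ[OF tI] s(1) by auto
          then show "\<exists>x'\<in>Z. x' \<noteq> c t \<and> dist x' (c t) < e"
            using cZ[OF s(3)] d(2)[OF s(2)] by (intro bexI[of _ "c s"]) (auto simp: Z_def)
        qed
        then show ?thesis using cZ[OF tI] by (simp add: W_def Z_def)
      qed
      have "C1_curve_in W {-\<epsilon>'<..<\<epsilon>'} c c'"
        unfolding C1_curve_in_def using cd sub inW continuous_on_subset[OF cc' sub] by auto
      moreover have "\<exists>\<rho>>0. \<forall>y\<in>W. dist y p < \<rho> \<longrightarrow> (\<exists>t\<in>{-\<epsilon>'<..<\<epsilon>'}. y = c t)"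
      proof (intro exI[of _ "min \<rho> \<epsilon>'"] conjI ballI impI)
        show "min \<rho> \<epsilon>' > 0" using \<rho> \<epsilon>' by simp
        fix y assume y: "y \<in> W" "dist y p < min \<rho> \<epsilon>'"
        then obtain t where t: "t \<in> {-\<epsilon><..<\<epsilon>}" "y = c t" using \<rho>(2)[of y] by (auto simp: W_def Z_def)
        have "\<bar>t\<bar> = \<bar>v \<bullet> (y - p)\<bar>" using cZ[OF t(1)] t(2) by simp
        also have "\<dots> \<le> norm v * norm (y - p)" by (rule Cauchy_Schwarz_ineq2)
        also have "\<dots> < \<epsilon>'" using v(1) y(2) by (simp add: dist_norm)
        finally show "\<exists>t\<in>{-\<epsilon>'<..<\<epsilon>'}. y = c t" using t(2) by (intro bexI[of _ t]) auto
      qed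
      ultimately have "arc_chart W p v \<epsilon>' c c'"
        unfolding arc_chart_def using \<epsilon>' v(1) c0 cZ sub c'2 by auto
      then show "\<exists>v \<epsilon> c c'. arc_chart W p v \<epsilon> c c'" by blast
    qed
  qed
  moreover have "all_forms_almost_exact W"
    unfolding all_forms_almost_exact_def
  proof (intro allI impI)
    fix \<psi> :: "real ^ 'n \<Rightarrow> real" and v :: "real ^ 'n" and e :: real
    assume "continuous_on UNIV \<psi>" "e > 0"
    then have "\<exists>K. \<forall>S c c'. C1_curve_in {x. prod_grad w J x = 0} S c c' \<longrightarrow> (\<forall>t\<in>S. \<exists>k.
      ((\<lambda>s. K (c s)) has_real_derivative k) (at t) \<and> \<bar>k - \<psi> (c t) * (v \<bullet> c' t)\<bar> \<le> e * norm (c' t))"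
      by (intro almost_primitive_on_critical_curves J tr)
    then obtain K where "\<forall>S c c'. C1_curve_in {x. prod_grad w J x = 0} S c c' \<longrightarrow> (\<forall>t\<in>S. \<exists>k.
      ((\<lambda>s. K (c s)) has_real_derivative k) (at t) \<and> \<bar>k - \<psi> (c t) * (v \<bullet> c' t)\<bar> \<le> e * norm (c' t))"
      by blast
    moreover have "C1_curve_in {x. prod_grad w J x = 0} S c c'" if "C1_curve_in W S c c'" for S c c'
      using that by (auto simp: C1_curve_in_def W_def Z_def)
    ultimately show "\<exists>K. \<forall>S c c'. C1_curve_in W S c c' \<longrightarrow> (\<forall>t\<in>S. \<exists>k.
      ((\<lambda>s. K (c s)) has_real_derivative k) (at t) \<and> \<bar>k - \<psi> (c t) * (v \<bullet> c' t)\<bar> \<le> e * norm (c' t))"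
      by blast
  qed
  ultimately show False by (rule no_compact_arcwise_charted_set)
qed

theorem theorem0p1:
  fixes w :: "nat \<Rightarrow> real ^ 'n" and r :: nat
    and F f :: "real ^ 'n \<Rightarrow> real"
  assumes N3: "CARD('n) \<ge> 3"
    and distinct: "inj_on w {1..r}"
    and not_in_plane: "\<not> (\<exists>S. affine S \<and> aff_dim S = 2 \<and> w ` {1..r} \<subseteq> S)"
    and F_def: "\<And>x. F x = (\<Prod>j\<in>{1..r}. (norm (x - w j))\<^sup>2)"
    and f_def: "\<And>x. x \<notin> w ` {1..r} \<Longrightarrow> f x = (\<Sum>j\<in>{1..r}. ln ((norm (x - w j))\<^sup>2))"
  shows
    "(\<forall>x. critical_point f (- w ` {1..r}) x \<longrightarrow>
        pos_index (hessian f x) \<ge> CARD('n) - 1 \<and> neg_index (hessian f x) \<in> {0, 1})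
   \<and> (\<forall>x. critical_point F UNIV x \<longrightarrow>
        pos_index (hessian F x) \<ge> CARD('n) - 1 \<and> neg_index (hessian F x) \<in> {0, 1})
   \<and> (\<forall>x. critical_point f (- w ` {1..r}) x \<longrightarrow>
        (\<exists>e>0. \<forall>y. 0 < dist y x \<and> dist y x < e \<longrightarrow> \<not> critical_point f (- w ` {1..r}) y))
   \<and> (\<forall>x. critical_point F UNIV x \<longrightarrow>
        (\<exists>e>0. \<forall>y. 0 < dist y x \<and> dist y x < e \<longrightarrow> \<not> critical_point F UNIV y))"
proof -
  let ?J = "{1..r}"
  have J: "finite ?J" by simp
  \<comment> \<open>An empty family would lie in every plane. A plane exists because the dimension
    is at least 3, for instance the one spanned by two coordinate axes.\<close>
  have J0: "?J \<noteq> {}"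
  proof
    assume "?J = {}"
    have "\<exists>i j :: 'n. i \<noteq> j"
    proof (rule ccontr)
      assume "\<not> (\<exists>i j :: 'n. i \<noteq> j)"
      then have "CARD('n) \<le> Suc 0" by (simp add: card_le_Suc0_iff_eq)
      then show False using N3 by simp
    qed
    then obtain i j :: 'n where "i \<noteq> j" by blast
    then have "axis i 1 \<bullet> (axis j 1 :: real ^ 'n) = 0" by (simp add: inner_axis_axis)
    note plane = affine_plane_through[OF norm_axis_1 norm_axis_1 this, of 0]
    have "w ` ?J \<subseteq> (+) 0 ` span {axis i 1, axis j (1 :: real)}" unfolding \<open>?J = {}\<close> by (simp only: image_empty empty_subsetI)
    then show False using not_in_plane plane by blast
  qed
  note tr = hess_trace_pos[OF J distinct not_in_plane]
  have critf: "critical_point f (- w ` ?J) x \<longleftrightarrow> x \<notin> w ` ?J \<and> prod_grad w ?J x = 0" for x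
    by (rule critical_point_log_prod_iff[OF J]) (rule f_def)
  note critF = critical_point_prod_iff[OF F_def]
  have indF: "pos_index (hessian F x) \<ge> CARD('n) - 1 \<and> neg_index (hessian F x) \<in> {0, 1}" for x
    unfolding hessian_prod[OF F_def] by (rule index_of_plane_trace_positive[OF transpose_prod_hess tr])
  have indf: "pos_index (hessian f x) \<ge> CARD('n) - 1 \<and> neg_index (hessian f x) \<in> {0, 1}"
    if "x \<notin> w ` ?J" "prod_grad w ?J x = 0" for x
  proof -
    define s where "s = 1 / (\<Prod>j\<in>?J. sqd (w j) x)"
    have "(\<Prod>j\<in>?J. sqd (w j) x) > 0" using that(1) by (intro prod_pos) (auto simp: sqd_real)
    then have s: "s > 0" by (simp add: s_def)
    have h: "hessian f x = s *\<^sub>R prod_hess w ?J x" unfolding s_def by (rule hessian_log_prod[OF J f_def that])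
    show ?thesis
    proof (rule index_of_plane_trace_positive)
      show "transpose (hessian f x) = hessian f x"
        unfolding h using transpose_prod_hess[of w ?J x] by (simp add: transpose_def vec_eq_iff)
      fix e g :: "real ^ 'n" assume "norm e = 1" "norm g = 1" "e \<bullet> g = 0"
      then have "0 < s * (e \<bullet> (prod_hess w ?J x *v e) + g \<bullet> (prod_hess w ?J x *v g))"
        by (intro mult_pos_pos s tr)
      then show "0 < e \<bullet> (hessian f x *v e) + g \<bullet> (hessian f x *v g)"
        unfolding h by (simp add: scaleR_matrix_vector_assoc[symmetric] distrib_left)
    qed
  qed
  have iso: "\<exists>e>0. \<forall>y. 0 < dist y x \<and> dist y x < e \<longrightarrow> prod_grad w ?J y \<noteq> 0"
    if "prod_grad w ?J x = 0" for x :: "real ^ 'n"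
  proof -
    have "\<not> x islimpt {x. prod_grad w ?J x = 0}"
    proof (rule critical_point_not_limit[OF J J0])
      show "prod_grad w ?J x = 0" by (rule that)
    qed (rule tr)
    then show ?thesis unfolding islimpt_approachable zero_less_dist_iff by blast
  qed
  \<comment> \<open>Only the outer fourfold conjunction is split, the index claims stay paired. Each
    block then settles both the index claim and the isolation claim for one function.\<close>
  show ?thesis
  proof (intro conjI[OF _ conjI[OF _ conjI]] allI impI)
    fix x
    assume "critical_point f (- w ` ?J) x"
    then have x: "x \<notin> w ` ?J" "prod_grad w ?J x = 0" using critf by blast+
    show "pos_index (hessian f x) \<ge> CARD('n) - 1 \<and> neg_index (hessian f x) \<in> {0, 1}" by (rule indf[OF x])
    obtain e where "e > 0" "\<And>y. 0 < dist y x \<and> dist y x < e \<Longrightarrow> prod_grad w ?J y \<noteq> 0"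
      using iso[OF x(2)] by blast
    then show "\<exists>e>0. \<forall>y. 0 < dist y x \<and> dist y x < e \<longrightarrow> \<not> critical_point f (- w ` ?J) y"
      unfolding critf by blast
  next
    fix x
    assume "critical_point F UNIV x"
    then have x: "prod_grad w ?J x = 0" using critF by blast
    show "pos_index (hessian F x) \<ge> CARD('n) - 1 \<and> neg_index (hessian F x) \<in> {0, 1}" by (rule indF)
    show "\<exists>e>0. \<forall>y. 0 < dist y x \<and> dist y x < e \<longrightarrow> \<not> critical_point F UNIV y"
      unfolding critF by (rule iso[OF x])
  qed
qed

end
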